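(* Let $u\in\mathrm{BMOA}_{\mathrm{simp}}(\mathbb T)$ with spectral measure $\rho$ and unimodular function $\Psi=\Psi_u\in L^\infty(\rho)$, let $U:L^2(\rho)\to\overline{\mathrm{Ran}}\,H_u$ be the unitary operator $Uf=f(|H_u^{\mathrm e}|)u$, and let $\Sigma^*=U^*\big(S^*|_{\overline{\mathrm{Ran}}\,H_u}\big)U$, a contraction on $L^2(\rho)$. Then the Fourier coefficients of $u$ are $$\widehat u_k=\langle(\Sigma^* )^k\mathbf 1,q\rangle_{L^2(\rho)},\qquad k\ge0,$$ or equivalently $$u(z)=\langle(I-z\Sigma^* )^{-1}\mathbf 1,q\rangle_{L^2(\rho)},\qquad z\in\mathbb D,$$ where $q\in L^2(\rho)$, $q(s):=\overline{\Psi(s)}/s$, and $\mathbf 1\in L^2(\rho)$ is the function identically equal to $1$.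
   Context: $H^2=H^2(\mathbb T)$ is the Hardy space on the unit circle (its elements are also viewed as analytic functions in the unit disc $\mathbb D$), $P:L^2(\mathbb T)\to H^2$ the orthogonal projection, $S$ the shift $Sf(z)=zf(z)$. For $u\in\mathrm{BMOA}(\mathbb T)$, $H_uf=P(u\overline f)$ is the bounded anti-linear Hankel operator on $H^2$, and $\widetilde H_u:=S^*H_u=H_uS$. The operators $H_u^2,\widetilde H_u^2$ are linear and positive semi-definite; $|H_u|:=(H_u^2)^{1/2}$. The closure $\overline{\mathrm{Ran}}\,H_u$ of the range of $H_u$ is invariant under $H_u$, $S^*$ and $\widetilde H_u$; $H_u^{\mathrm e}$, $\widetilde H_u^{\mathrm e}$ are the restrictions of $H_u$, $\widetilde H_u$ to it. $\mathrm{BMOA}_{\mathrm{simp}}(\mathbb T)$ is the set of $u\in\mathrm{BMOA}(\mathbb T)$ such that $(H_u^{\mathrm e})^2$ and $(\widetilde H_u^{\mathrm e})^2$ both have simple spectra (possess a cyclic vector). For such $u$, the vector $u$ is cyclic for $|H_u^{\mathrm e}|$; $\rho$ is the spectral measure of $|H_u|$ with respect to $u$: $\int f\,d\rho=\langle f(|H_u|)u,u\rangle$ for continuous $f$. It is carried by $(0,\infty)$ and satisfies $\int s^{-2}d\rho(s)\le1$. $\Psi_u$ is the unimodular function, unique in $L^\infty(\rho)$, such that $H_u^{\mathrm e}f(|H_u^{\mathrm e}|)u=|H_u^{\mathrm e}|\,\overline{\Psi_u}(|H_u^{\mathrm e}|)\,\overline f(|H_u^{\mathrm e}|)u$ for all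 $f\in L^2(\rho)$. *)

theory Defs
  imports "HOL-Analysis.Analysis" "HOL-Computational_Algebra.Polynomial"
begin

text \<open>
  Elements of an \<open>L\<^sup>2\<close> space are represented by functions, with equality almost everywhere as
  equality of vectors; accordingly operators are maps on functions, and every identity between
  vectors is an identity almost everywhere.  A Hilbert space is given by a measure \<open>M\<close> and a
  closed subspace \<open>V\<close> of \<open>L2 M\<close>.  An operator on \<open>V\<close> is only ever evaluated on \<open>V\<close>, so that
  its restriction to an invariant subspace \<open>W\<close> is the same map, considered on \<open>W\<close>.
\<close>

section \<open>Square integrable functions and operators\<close>

definition L2 :: "'a measure \<Rightarrow> ('a \<Rightarrow> complex) set" where
  "L2 M = {f \<in> borel_measurable M. integrable M (\<lambda>x. (cmod (f x))\<^sup>2)}"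

definition inner2 :: "'a measure \<Rightarrow> ('a \<Rightarrow> complex) \<Rightarrow> ('a \<Rightarrow> complex) \<Rightarrow> complex" where
  "inner2 M f g = (\<integral>x. f x * cnj (g x) \<partial>M)"

definition norm2 :: "'a measure \<Rightarrow> ('a \<Rightarrow> complex) \<Rightarrow> real" where
  "norm2 M f = sqrt (\<integral>x. (cmod (f x))\<^sup>2 \<partial>M)"

definition eq_ae :: "'a measure \<Rightarrow> ('a \<Rightarrow> complex) \<Rightarrow> ('a \<Rightarrow> complex) \<Rightarrow> bool" where
  "eq_ae M f g \<longleftrightarrow> (AE x in M. f x = g x)"

definition bounded_linear_on ::
  "'a measure \<Rightarrow> ('a \<Rightarrow> complex) set \<Rightarrow> (('a \<Rightarrow> complex) \<Rightarrow> ('a \<Rightarrow> complex)) \<Rightarrow> bool" where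
  "bounded_linear_on M V T \<longleftrightarrow>
     (\<forall>f\<in>V. T f \<in> V) \<and>
     (\<forall>f\<in>V. \<forall>g\<in>V. \<forall>a b.
        eq_ae M (T (\<lambda>x. a * f x + b * g x)) (\<lambda>x. a * T f x + b * T g x)) \<and>
     (\<exists>C. \<forall>f\<in>V. norm2 M (T f) \<le> C * norm2 M f)"

definition bounded_antilinear_on ::
  "'a measure \<Rightarrow> ('a \<Rightarrow> complex) set \<Rightarrow> (('a \<Rightarrow> complex) \<Rightarrow> ('a \<Rightarrow> complex)) \<Rightarrow> bool" where
  "bounded_antilinear_on M V T \<longleftrightarrow>
     (\<forall>f\<in>V. T f \<in> V) \<and>
     (\<forall>f\<in>V. \<forall>g\<in>V. \<forall>a b.
        eq_ae M (T (\<lambda>x. a * f x + b * g x)) (\<lambda>x. cnj a * T f x + cnj b * T g x)) \<and>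
     (\<exists>C. \<forall>f\<in>V. norm2 M (T f) \<le> C * norm2 M f)"

definition contraction_on ::
  "'a measure \<Rightarrow> ('a \<Rightarrow> complex) set \<Rightarrow> (('a \<Rightarrow> complex) \<Rightarrow> ('a \<Rightarrow> complex)) \<Rightarrow> bool" where
  "contraction_on M V T \<longleftrightarrow>
     bounded_linear_on M V T \<and> (\<forall>f\<in>V. norm2 M (T f) \<le> norm2 M f)"

definition inverse_on ::
  "'a measure \<Rightarrow> ('a \<Rightarrow> complex) set \<Rightarrow> (('a \<Rightarrow> complex) \<Rightarrow> ('a \<Rightarrow> complex)) \<Rightarrow>
   (('a \<Rightarrow> complex) \<Rightarrow> ('a \<Rightarrow> complex)) \<Rightarrow> bool" where
  "inverse_on M V T R \<longleftrightarrow>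
     bounded_linear_on M V R \<and> (\<forall>f\<in>V. eq_ae M (T (R f)) f \<and> eq_ae M (R (T f)) f)"

text \<open>The Hilbert space adjoint of an operator from \<open>V\<close> (in \<open>L2 M\<close>) to \<open>W\<close> (in \<open>L2 N\<close>);
  its values are unique up to almost everywhere equality.\<close>

definition adjoint2 ::
  "'a measure \<Rightarrow> ('a \<Rightarrow> complex) set \<Rightarrow> 'b measure \<Rightarrow> ('b \<Rightarrow> complex) set \<Rightarrow>
   (('a \<Rightarrow> complex) \<Rightarrow> ('b \<Rightarrow> complex)) \<Rightarrow> ('b \<Rightarrow> complex) \<Rightarrow> ('a \<Rightarrow> complex)" where
  "adjoint2 M V N W T =
     (SOME T'. (\<forall>g\<in>W. T' g \<in> V) \<and> (\<forall>f\<in>V. \<forall>g\<in>W. inner2 N (T f) g = inner2 M f (T' g)))"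

definition closure_range ::
  "'a measure \<Rightarrow> ('a \<Rightarrow> complex) set \<Rightarrow> (('a \<Rightarrow> complex) \<Rightarrow> ('a \<Rightarrow> complex)) \<Rightarrow>
   ('a \<Rightarrow> complex) set" where
  "closure_range M V T =
     {g \<in> V. \<forall>e>0. \<exists>f\<in>V. norm2 M (\<lambda>x. g x - T f x) < e}"

definition poly_op ::
  "complex poly \<Rightarrow> (('a \<Rightarrow> complex) \<Rightarrow> ('a \<Rightarrow> complex)) \<Rightarrow> ('a \<Rightarrow> complex) \<Rightarrow> ('a \<Rightarrow> complex)" where
  "poly_op p T f = (\<lambda>x. \<Sum>i\<le>degree p. coeff p i * (T ^^ i) f x)"

definition cyclic_vector ::
  "'a measure \<Rightarrow> ('a \<Rightarrow> complex) set \<Rightarrow> (('a \<Rightarrow> complex) \<Rightarrow> ('a \<Rightarrow> complex)) \<Rightarrow>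
   ('a \<Rightarrow> complex) \<Rightarrow> bool" where
  "cyclic_vector M V T v \<longleftrightarrow>
     v \<in> V \<and> (\<forall>f\<in>V. \<forall>e>0. \<exists>p. norm2 M (\<lambda>x. f x - poly_op p T v x) < e)"

definition simple_spectrum ::
  "'a measure \<Rightarrow> ('a \<Rightarrow> complex) set \<Rightarrow> (('a \<Rightarrow> complex) \<Rightarrow> ('a \<Rightarrow> complex)) \<Rightarrow> bool" where
  "simple_spectrum M V T \<longleftrightarrow> (\<exists>v. cyclic_vector M V T v)"

section \<open>Spectral resolutions and functional calculus\<close>

definition projection_valued_measure ::
  "'a measure \<Rightarrow> ('a \<Rightarrow> complex) set \<Rightarrow> (real set \<Rightarrow> ('a \<Rightarrow> complex) \<Rightarrow> ('a \<Rightarrow> complex)) \<Rightarrow> bool"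
  where
  "projection_valued_measure M V E \<longleftrightarrow>
     (\<forall>B\<in>sets borel. bounded_linear_on M V (E B)) \<and>
     (\<forall>B\<in>sets borel. \<forall>f\<in>V. \<forall>g\<in>V. inner2 M (E B f) g = inner2 M f (E B g)) \<and>
     (\<forall>B\<in>sets borel. \<forall>C\<in>sets borel. \<forall>f\<in>V. eq_ae M (E (B \<inter> C) f) (E B (E C f))) \<and>
     (\<forall>f\<in>V. eq_ae M (E UNIV f) f) \<and>
     (\<forall>f\<in>V. \<forall>g\<in>V. \<forall>B :: nat \<Rightarrow> real set. range B \<subseteq> sets borel \<longrightarrow> disjoint_family B \<longrightarrow>
        (\<lambda>n. inner2 M (E (B n) f) g) sums inner2 M (E (\<Union>n. B n) f) g)"

text \<open>The positive measure \<open>B \<mapsto> \<langle>E(B)f, f\<rangle>\<close>.\<close>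

definition scalar_measure ::
  "'a measure \<Rightarrow> (real set \<Rightarrow> ('a \<Rightarrow> complex) \<Rightarrow> ('a \<Rightarrow> complex)) \<Rightarrow> ('a \<Rightarrow> complex) \<Rightarrow> real measure"
  where
  "scalar_measure M E f = measure_of UNIV (sets borel) (\<lambda>B. ennreal (Re (inner2 M (E B f) f)))"

text \<open>The integral \<open>\<integral>h d\<langle>E(\<cdot>)f, g\<rangle>\<close> of a bounded Borel function \<open>h\<close> against the complex measure
  \<open>B \<mapsto> \<langle>E(B)f, g\<rangle>\<close>, which polarization writes in terms of positive measures.\<close>

definition spectral_integral ::
  "'a measure \<Rightarrow> (real set \<Rightarrow> ('a \<Rightarrow> complex) \<Rightarrow> ('a \<Rightarrow> complex)) \<Rightarrow> (real \<Rightarrow> complex) \<Rightarrow>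
   ('a \<Rightarrow> complex) \<Rightarrow> ('a \<Rightarrow> complex) \<Rightarrow> complex" where
  "spectral_integral M E h f g =
     (\<Sum>k<4. \<i> ^ k * (\<integral>s. h s \<partial>scalar_measure M E (\<lambda>x. f x + \<i> ^ k * g x))) / 4"

definition truncate_at :: "nat \<Rightarrow> (real \<Rightarrow> complex) \<Rightarrow> real \<Rightarrow> complex" where
  "truncate_at n h s = (if cmod (h s) \<le> real n then h s else 0)"

text \<open>\<open>fun_calc M V E h f g\<close>: the vector \<open>f\<close> of \<open>V\<close> is in the domain of the (possibly unbounded)
  operator \<open>h(T) = \<integral>h dE\<close>, where \<open>E\<close> is the spectral resolution of \<open>T\<close>, and \<open>h(T)f = g\<close>.
  That is, \<open>\<integral>|h|\<^sup>2 d\<langle>E(\<cdot>)f, f\<rangle> < \<infinity>\<close> and \<open>\<langle>g, k\<rangle> = \<integral>h d\<langle>E(\<cdot>)f, k\<rangle>\<close> for all \<open>k\<close>.  The last integral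
  converges absolutely, but \<open>h\<close> need not be integrable against the four positive measures of
  the polarization identity; hence the limit of truncations.\<close>

definition fun_calc ::
  "'a measure \<Rightarrow> ('a \<Rightarrow> complex) set \<Rightarrow> (real set \<Rightarrow> ('a \<Rightarrow> complex) \<Rightarrow> ('a \<Rightarrow> complex)) \<Rightarrow>
   (real \<Rightarrow> complex) \<Rightarrow> ('a \<Rightarrow> complex) \<Rightarrow> ('a \<Rightarrow> complex) \<Rightarrow> bool" where
  "fun_calc M V E h f g \<longleftrightarrow>
     f \<in> V \<and> g \<in> V \<and> h \<in> borel_measurable borel \<and>
     integrable (scalar_measure M E f) (\<lambda>s. (cmod (h s))\<^sup>2) \<and>
     (\<forall>k\<in>V. (\<lambda>n. spectral_integral M E (truncate_at n h) f k) \<longlonglongrightarrow> inner2 M g k)"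

definition spectral_resolution ::
  "'a measure \<Rightarrow> ('a \<Rightarrow> complex) set \<Rightarrow> (('a \<Rightarrow> complex) \<Rightarrow> ('a \<Rightarrow> complex)) \<Rightarrow>
   (real set \<Rightarrow> ('a \<Rightarrow> complex) \<Rightarrow> ('a \<Rightarrow> complex)) \<Rightarrow> bool" where
  "spectral_resolution M V T E \<longleftrightarrow>
     projection_valued_measure M V E \<and> (\<forall>f\<in>V. fun_calc M V E complex_of_real f (T f))"

section \<open>Hardy space and BMOA\<close>

definition circ :: "complex measure" where
  "circ = distr (uniform_measure lborel {0..2 * pi}) borel cis"

definition fourier :: "(complex \<Rightarrow> complex) \<Rightarrow> int \<Rightarrow> complex" where
  "fourier f n = inner2 circ f (\<lambda>z. z powi n)"

definition H2 :: "(complex \<Rightarrow> complex) set" where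
  "H2 = {f \<in> L2 circ. \<forall>n<0. fourier f n = 0}"

text \<open>The analytic function in the unit disc with boundary values \<open>f\<close>.\<close>

definition disc_ext :: "(complex \<Rightarrow> complex) \<Rightarrow> complex \<Rightarrow> complex" where
  "disc_ext f z = (\<Sum>n. fourier f (int n) * z ^ n)"

definition arc :: "real \<Rightarrow> real \<Rightarrow> complex set" where
  "arc a h = cis ` {a..a + h}"

definition arc_mean :: "(complex \<Rightarrow> complex) \<Rightarrow> complex set \<Rightarrow> complex" where
  "arc_mean f I = (LINT z:I|circ. f z) / complex_of_real (measure circ I)"

definition BMO :: "(complex \<Rightarrow> complex) set" where
  "BMO = {f. integrable circ f \<and>
     (\<exists>C. \<forall>a h. 0 < h \<and> h \<le> 2 * pi \<longrightarrow>
        (LINT z:arc a h|circ. cmod (f z - arc_mean f (arc a h))) / measure circ (arc a h) \<le> C)}"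

definition BMOA :: "(complex \<Rightarrow> complex) set" where
  "BMOA = BMO \<inter> H2"

section \<open>Hankel operators\<close>

definition shift :: "(complex \<Rightarrow> complex) \<Rightarrow> complex \<Rightarrow> complex" where
  "shift f = (\<lambda>z. z * f z)"

definition shift_star :: "(complex \<Rightarrow> complex) \<Rightarrow> complex \<Rightarrow> complex" where
  "shift_star = adjoint2 circ H2 circ H2 shift"

text \<open>\<open>g \<in> L\<^sup>2\<close> and \<open>h\<close> is its orthogonal projection onto \<open>H\<^sup>2\<close>.\<close>

definition szego_projection :: "(complex \<Rightarrow> complex) \<Rightarrow> (complex \<Rightarrow> complex) \<Rightarrow> bool" where
  "szego_projection g h \<longleftrightarrow>
     g \<in> L2 circ \<and> h \<in> H2 \<and> (\<forall>k\<in>H2. inner2 circ (\<lambda>z. g z - h z) k = 0)"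

text \<open>\<open>H\<close> is the operator \<open>H\<^sub>u\<close>.  For \<open>u\<close> in \<open>BMOA\<close> and \<open>f\<close> in \<open>H\<^sup>2\<close> the product \<open>u \<sqdot> cnj f\<close> need not be
  square integrable; it is for \<open>f\<close> in a dense subspace, containing the polynomials, and the
  formula \<open>H\<^sub>u f = P(u \<sqdot> cnj f)\<close> on this subspace determines the bounded operator \<open>H\<^sub>u\<close>.\<close>

definition is_hankel ::
  "(complex \<Rightarrow> complex) \<Rightarrow> ((complex \<Rightarrow> complex) \<Rightarrow> (complex \<Rightarrow> complex)) \<Rightarrow> bool" where
  "is_hankel u H \<longleftrightarrow>
     bounded_antilinear_on circ H2 H \<and>
     (\<forall>f\<in>H2. (\<lambda>z. u z * cnj (f z)) \<in> L2 circ \<longrightarrow> szego_projection (\<lambda>z. u z * cnj (f z)) (H f))"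

definition hankel_tilde ::
  "((complex \<Rightarrow> complex) \<Rightarrow> (complex \<Rightarrow> complex)) \<Rightarrow> (complex \<Rightarrow> complex) \<Rightarrow> (complex \<Rightarrow> complex)" where
  "hankel_tilde H = shift_star \<circ> H"

text \<open>\<open>A = (H\<^sup>2)\<^bsup>1/2\<^esup>\<close>, the unique positive semi-definite square root.\<close>

definition is_modulus ::
  "((complex \<Rightarrow> complex) \<Rightarrow> (complex \<Rightarrow> complex)) \<Rightarrow> ((complex \<Rightarrow> complex) \<Rightarrow> (complex \<Rightarrow> complex)) \<Rightarrow>
   bool" where
  "is_modulus H A \<longleftrightarrow>
     bounded_linear_on circ H2 A \<and>
     (\<forall>f\<in>H2. 0 \<le> Re (inner2 circ (A f) f) \<and> Im (inner2 circ (A f) f) = 0) \<and>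
     (\<forall>f\<in>H2. eq_ae circ (A (A f)) (H (H f)))"

text \<open>The operator \<open>H\<^sub>u\<close> exists for every \<open>u\<close> in \<open>BMOA\<close> and is unique up to almost everywhere
  equality of its values.\<close>

definition BMOA_simp :: "(complex \<Rightarrow> complex) set" where
  "BMOA_simp = {u \<in> BMOA. \<exists>H. is_hankel u H \<and>
     simple_spectrum circ (closure_range circ H2 H) (H \<circ> H) \<and>
     simple_spectrum circ (closure_range circ H2 H) (hankel_tilde H \<circ> hankel_tilde H)}"

text \<open>\<open>\<rho>\<close> is the spectral measure with respect to \<open>u\<close> of the operator on \<open>H\<^sup>2\<close> with spectral
  resolution \<open>E\<close>.\<close>

definition is_spectral_measure ::
  "(real set \<Rightarrow> (complex \<Rightarrow> complex) \<Rightarrow> (complex \<Rightarrow> complex)) \<Rightarrow> (complex \<Rightarrow> complex) \<Rightarrow>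
   real measure \<Rightarrow> bool" where
  "is_spectral_measure E u \<rho> \<longleftrightarrow>
     sets \<rho> = sets borel \<and> finite_measure \<rho> \<and>
     (\<forall>f. continuous_on UNIV f \<longrightarrow>
        (\<exists>g. fun_calc circ H2 E f u g \<and> integrable \<rho> f \<and> (\<integral>s. f s \<partial>\<rho>) = inner2 circ g u))"

text \<open>\<open>U f = f(|H\<^sub>u\<^sup>e|)u\<close> for \<open>f\<close> in \<open>L\<^sup>2(\<rho>)\<close>; here \<open>R\<close> is the closure of the range of \<open>H\<^sub>u\<close>, which reduces
  \<open>|H\<^sub>u|\<close>, so that the spectral resolution of \<open>|H\<^sub>u\<^sup>e|\<close> is the restriction to \<open>R\<close> of the spectral
  resolution \<open>E\<close> of \<open>|H\<^sub>u|\<close>.\<close>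

definition is_spectral_map ::
  "(complex \<Rightarrow> complex) set \<Rightarrow> (real set \<Rightarrow> (complex \<Rightarrow> complex) \<Rightarrow> (complex \<Rightarrow> complex)) \<Rightarrow>
   (complex \<Rightarrow> complex) \<Rightarrow> real measure \<Rightarrow> ((real \<Rightarrow> complex) \<Rightarrow> (complex \<Rightarrow> complex)) \<Rightarrow> bool" where
  "is_spectral_map R E u \<rho> U \<longleftrightarrow> (\<forall>f\<in>L2 \<rho>. fun_calc circ R E f u (U f))"

text \<open>\<open>\<Psi>\<close> is the unimodular function with
  \<open>H f(|H\<^sup>e|)u = |H| cnj\<Psi>(|H\<^sup>e|) cnjf(|H\<^sup>e|)u\<close> for all \<open>f\<close> in \<open>L\<^sup>2(\<rho>)\<close>, where \<open>A = |H|\<close>.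
  The vectors \<open>x\<close>, \<open>y\<close>, \<open>w\<close> are \<open>f(|H\<^sup>e|)u\<close>, \<open>cnjf(|H\<^sup>e|)u\<close> and \<open>cnj\<Psi>(|H\<^sup>e|)y\<close>.\<close>

definition is_Psi ::
  "(complex \<Rightarrow> complex) set \<Rightarrow> (real set \<Rightarrow> (complex \<Rightarrow> complex) \<Rightarrow> (complex \<Rightarrow> complex)) \<Rightarrow>
   ((complex \<Rightarrow> complex) \<Rightarrow> (complex \<Rightarrow> complex)) \<Rightarrow> ((complex \<Rightarrow> complex) \<Rightarrow> (complex \<Rightarrow> complex)) \<Rightarrow>
   (complex \<Rightarrow> complex) \<Rightarrow> real measure \<Rightarrow> (real \<Rightarrow> complex) \<Rightarrow> bool" where
  "is_Psi R E H A u \<rho> \<Psi> \<longleftrightarrow>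
     \<Psi> \<in> borel_measurable \<rho> \<and> (AE s in \<rho>. cmod (\<Psi> s) = 1) \<and>
     (\<forall>f\<in>L2 \<rho>. \<exists>x y w.
        fun_calc circ R E f u x \<and>
        fun_calc circ R E (\<lambda>s. cnj (f s)) u y \<and>
        fun_calc circ R E (\<lambda>s. cnj (\<Psi> s)) y w \<and>
        eq_ae circ (H x) (A w))"

end

theory Submission
  imports Defs
begin

text \<open>
  Let \<open>W\<close> be the range of \<open>U\<close>, the closed cyclic subspace of \<open>|H|\<close> generated by \<open>u\<close>, and \<open>N\<close> its
  orthogonal complement in the closed range \<open>R\<close> of \<open>H\<close>.  Both reduce \<open>H\<^sup>2\<close>, and also \<open>Ht\<^sup>2\<close>, where
  \<open>Ht = S\<^sup>* H = H S\<close>, since \<open>Ht\<^sup>2 = H\<^sup>2 - \<langle>\<cdot>, u\<rangle> u\<close>.  An antilinear operator commuting with an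
  operator that has a cyclic vector leaves the reducing subspaces of the latter invariant; hence \<open>H\<close> and
  \<open>Ht\<close> map \<open>W\<close> into itself.  As \<open>H W\<close> is dense in \<open>W\<close> and \<open>S\<^sup>* H = Ht\<close>, also \<open>S\<^sup>*\<close> does, so that the
  powers of \<open>\<Sigma>\<^sup>*\<close> correspond under \<open>U\<close> to those of \<open>S\<^sup>*\<close> on \<open>W\<close>.
  Finally \<open>U q\<close> is the projection of \<open>1\<close> onto \<open>R\<close>, because \<open>H (U q) = u = H 1\<close>, and
  \<open>\<langle>(S\<^sup>*)\<^sup>k u, 1\<rangle>\<close> is the \<open>k\<close>-th Fourier coefficient of \<open>u\<close>.
\<close>

section \<open>Hilbert space geometry of square integrable functions\<close>

text \<open>What shapes the proof is that \<open>U\<close> is given only as an isometry: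
  \<open>U \<circ> Us\<close> is the projection onto \<open>W\<close>, so every factor of
  \<open>Sig ^^ k\<close> inserts this projection, and it drops out only if
  \<open>shift_star\<close> preserves \<open>W\<close>. This is where the two simple spectra enter,
  one for \<open>H\<close>, the other for \<open>Ht\<close>. For linear operators, commuting with a
  cyclic self-adjoint operator means being a function of it; the antilinear case is reached by
  approximation instead, through a form in which a polynomial of the operator can be moved from one
  argument to the other. The rank one term in the square of \<open>Ht\<close> arises because
  \<open>shift \<circ> shift_star\<close> is the identity minus the projection onto the constants,
  and \<open>H\<close> maps the constant \<open>1\<close> to \<open>u\<close>. That \<open>1\<close>
  is a unit vector with \<open>H 1 = u\<close> also makes \<open>1/s\<close> square integrable,
  hence \<open>q\<close> a vector of \<open>L2 \<rho>\<close>. As \<open>1/s\<close> is unbounded,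
  compositions in the functional calculus are handled by a relation \<open>cal\<close> that asks
  only for integrability and is stable under multiplying by a further function.\<close>

lemma L2_measurable [measurable_dest]: "f \<in> L2 M \<Longrightarrow> f \<in> borel_measurable M"
  by (simp add: L2_def)

lemma L2_integrable: "f \<in> L2 M \<Longrightarrow> integrable M (\<lambda>x. (cmod (f x))\<^sup>2)"
  by (simp add: L2_def)

lemma borel_measurable_cnj [measurable (raw)]:
  "f \<in> borel_measurable M \<Longrightarrow> (\<lambda>x. cnj (f x)) \<in> borel_measurable M"
  by (rule borel_measurable_continuous_on[of cnj]) (auto intro: continuous_intros)

lemma L2_lincomb:
  assumes f: "f \<in> L2 M" and g: "g \<in> L2 M"
  shows "(\<lambda>x. a * f x + b * g x) \<in> L2 M"
proof -
  have [measurable]: "f \<in> borel_measurable M" "g \<in> borel_measurable M"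
    using f g by (auto simp: L2_def)
  have "integrable M (\<lambda>x. 2 * (cmod a)\<^sup>2 * (cmod (f x))\<^sup>2 + 2 * (cmod b)\<^sup>2 * (cmod (g x))\<^sup>2)"
    using L2_integrable[OF f] L2_integrable[OF g] by auto
  moreover have "(cmod (a * f x + b * g x))\<^sup>2
      \<le> 2 * (cmod a)\<^sup>2 * (cmod (f x))\<^sup>2 + 2 * (cmod b)\<^sup>2 * (cmod (g x))\<^sup>2" for x
  proof -
    have "(cmod (a * f x + b * g x))\<^sup>2 \<le> (cmod (a * f x) + cmod (b * g x))\<^sup>2"
      by (intro power_mono norm_triangle_ineq) auto
    also have "\<dots> \<le> 2 * (cmod (a * f x))\<^sup>2 + 2 * (cmod (b * g x))\<^sup>2"
      using sum_squares_bound[of "cmod (a * f x)" "cmod (b * g x)"] by (simp add: power2_sum)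
    finally show ?thesis by (simp add: norm_mult power_mult_distrib)
  qed
  ultimately have "integrable M (\<lambda>x. (cmod (a * f x + b * g x))\<^sup>2)"
    by (rule_tac Bochner_Integration.integrable_bound) (auto intro!: AE_I2)
  then show ?thesis by (simp add: L2_def)
qed

lemma zero_in_L2 [simp]: "(\<lambda>x. 0) \<in> L2 M"
  by (simp add: L2_def)

section \<open>Linear subspaces of square integrable functions\<close>

definition subspace2 :: "'a measure \<Rightarrow> ('a \<Rightarrow> complex) set \<Rightarrow> bool" where
  "subspace2 M V \<longleftrightarrow> V \<subseteq> L2 M \<and> (\<lambda>x. 0) \<in> V \<and>
     (\<forall>f\<in>V. \<forall>g\<in>V. \<forall>a b. (\<lambda>x. a * f x + b * g x) \<in> V)"

lemma subspace2_L2 [simp]: "subspace2 M (L2 M)"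
  by (simp add: subspace2_def L2_lincomb)

lemma subspace2D: "subspace2 M V \<Longrightarrow> f \<in> V \<Longrightarrow> f \<in> L2 M"
  by (auto simp: subspace2_def)

lemma subspace2_zero: "subspace2 M V \<Longrightarrow> (\<lambda>x. 0) \<in> V"
  by (auto simp: subspace2_def)

lemma subspace2_lincomb:
  "subspace2 M V \<Longrightarrow> f \<in> V \<Longrightarrow> g \<in> V \<Longrightarrow> (\<lambda>x. a * f x + b * g x) \<in> V"
  by (auto simp: subspace2_def)

lemma subspace2_add: "subspace2 M V \<Longrightarrow> f \<in> V \<Longrightarrow> g \<in> V \<Longrightarrow> (\<lambda>x. f x + g x) \<in> V"
  using subspace2_lincomb[of M V f g 1 1] by simp

lemma subspace2_diff: "subspace2 M V \<Longrightarrow> f \<in> V \<Longrightarrow> g \<in> V \<Longrightarrow> (\<lambda>x. f x - g x) \<in> V"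
  using subspace2_lincomb[of M V f g 1 "-1"] by simp

lemma subspace2_scale: "subspace2 M V \<Longrightarrow> f \<in> V \<Longrightarrow> (\<lambda>x. a * f x) \<in> V"
  using subspace2_lincomb[of M V f f a 0] by simp

lemma subspace2_sum:
  "subspace2 M V \<Longrightarrow> (\<And>i. i \<in> I \<Longrightarrow> f i \<in> V) \<Longrightarrow> (\<lambda>x. \<Sum>i\<in>I. f i x) \<in> V"
  by (induction I rule: infinite_finite_induct) (auto intro: subspace2_zero subspace2_add)

lemmas L2_add = subspace2_add[OF subspace2_L2]
lemmas L2_diff = subspace2_diff[OF subspace2_L2]
lemmas L2_scale = subspace2_scale[OF subspace2_L2]
lemmas L2_sum = subspace2_sum[OF subspace2_L2]
lemmas L2_intros = L2_add L2_diff L2_scale L2_sum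

lemma L2_cnj: "f \<in> L2 M \<Longrightarrow> (\<lambda>x. cnj (f x)) \<in> L2 M"
  by (auto simp: L2_def borel_measurable_cnj)

section \<open>Inner product, norm and almost everywhere equality\<close>

lemma integrable_inner2:
  assumes f: "f \<in> L2 M" and g: "g \<in> L2 M"
  shows "integrable M (\<lambda>x. f x * cnj (g x))"
proof -
  have [measurable]: "f \<in> borel_measurable M" "g \<in> borel_measurable M"
    using f g by (auto simp: L2_def)
  have "integrable M (\<lambda>x. (cmod (f x))\<^sup>2 + (cmod (g x))\<^sup>2)"
    using L2_integrable[OF f] L2_integrable[OF g] by auto
  moreover have "cmod (f x * cnj (g x)) \<le> (cmod (f x))\<^sup>2 + (cmod (g x))\<^sup>2" for x
  proof -
    have "2 * cmod (f x) * cmod (g x) \<le> (cmod (f x))\<^sup>2 + (cmod (g x))\<^sup>2"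
      by (rule sum_squares_bound)
    moreover have "0 \<le> cmod (f x) * cmod (g x)" by simp
    ultimately show ?thesis unfolding norm_mult complex_mod_cnj by linarith
  qed
  ultimately show ?thesis
    by (rule_tac Bochner_Integration.integrable_bound) (auto intro!: AE_I2)
qed

lemma inner2_cnj: "cnj (inner2 M f g) = inner2 M g f"
  unfolding inner2_def by (subst Bochner_Integration.integral_cnj[symmetric]) (simp add: mult.commute)

lemma inner2_flip: "inner2 M k f = inner2 M k g \<Longrightarrow> inner2 M f k = inner2 M g k"
  by (metis inner2_cnj)

lemma inner2_add_left:
  assumes "f \<in> L2 M" "g \<in> L2 M" "h \<in> L2 M"
  shows "inner2 M (\<lambda>x. f x + g x) h = inner2 M f h + inner2 M g h"
  unfolding inner2_def using assms
  by (simp add: distrib_right integrable_inner2 Bochner_Integration.integral_add)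

lemma inner2_diff_left:
  assumes "f \<in> L2 M" "g \<in> L2 M" "h \<in> L2 M"
  shows "inner2 M (\<lambda>x. f x - g x) h = inner2 M f h - inner2 M g h"
  unfolding inner2_def using assms
  by (simp add: left_diff_distrib integrable_inner2 Bochner_Integration.integral_diff)

lemma inner2_scale_left: "inner2 M (\<lambda>x. a * f x) h = a * inner2 M f h"
  unfolding inner2_def by (simp add: mult.assoc)

lemma inner2_zero_left [simp]: "inner2 M (\<lambda>x. 0) h = 0"
  and inner2_zero_right [simp]: "inner2 M h (\<lambda>x. 0) = 0"
  unfolding inner2_def by simp_all

lemma inner2_sum_left:
  assumes "\<And>i. i \<in> I \<Longrightarrow> f i \<in> L2 M" "h \<in> L2 M"
  shows "inner2 M (\<lambda>x. \<Sum>i\<in>I. f i x) h = (\<Sum>i\<in>I. inner2 M (f i) h)"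
  using assms
  by (induction I rule: infinite_finite_induct) (auto simp: inner2_add_left L2_sum)

lemma inner2_add_right:
  assumes "f \<in> L2 M" "g \<in> L2 M" "h \<in> L2 M"
  shows "inner2 M h (\<lambda>x. f x + g x) = inner2 M h f + inner2 M h g"
  using inner2_add_left[OF assms] by (metis inner2_cnj complex_cnj_add)

lemma inner2_diff_right:
  assumes "f \<in> L2 M" "g \<in> L2 M" "h \<in> L2 M"
  shows "inner2 M h (\<lambda>x. f x - g x) = inner2 M h f - inner2 M h g"
  using inner2_diff_left[OF assms] by (metis inner2_cnj complex_cnj_diff)

lemma inner2_scale_right: "inner2 M h (\<lambda>x. a * f x) = cnj a * inner2 M h f"
  using inner2_scale_left by (metis inner2_cnj complex_cnj_mult)

lemma inner2_sum_right:
  assumes "\<And>i. i \<in> I \<Longrightarrow> f i \<in> L2 M" "h \<in> L2 M"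
  shows "inner2 M h (\<lambda>x. \<Sum>i\<in>I. f i x) = (\<Sum>i\<in>I. inner2 M h (f i))"
  using assms
  by (induction I rule: infinite_finite_induct) (auto simp: inner2_add_right L2_sum)

lemmas inner2_left = inner2_add_left inner2_diff_left inner2_scale_left inner2_sum_left
lemmas inner2_right = inner2_add_right inner2_diff_right inner2_scale_right inner2_sum_right

lemma norm2_nonneg [simp]: "0 \<le> norm2 M f"
  unfolding norm2_def by simp

lemma norm2_square: "(norm2 M f)\<^sup>2 = (\<integral>x. (cmod (f x))\<^sup>2 \<partial>M)"
  unfolding norm2_def by simp

lemma inner2_self: "inner2 M f f = complex_of_real ((norm2 M f)\<^sup>2)"
  unfolding inner2_def norm2_square complex_norm_square[symmetric]
  by (rule integral_complex_of_real)

lemma norm2_eq_inner2: "(norm2 M f)\<^sup>2 = Re (inner2 M f f)"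
  by (simp add: inner2_self)

lemma norm2_zero [simp]: "norm2 M (\<lambda>x. 0) = 0"
  by (simp add: norm2_def)

lemma norm2_eq_0:
  assumes "f \<in> L2 M"
  shows "norm2 M f = 0 \<longleftrightarrow> eq_ae M f (\<lambda>x. 0)"
  using integral_nonneg_eq_0_iff_AE[OF L2_integrable[OF assms]]
  by (simp add: norm2_def eq_ae_def)

lemma eq_ae_refl [simp]: "eq_ae M f f"
  by (simp add: eq_ae_def)

lemma eq_ae_sym: "eq_ae M f g \<Longrightarrow> eq_ae M g f"
  by (auto simp: eq_ae_def)

lemma eq_ae_trans [trans]: "eq_ae M f g \<Longrightarrow> eq_ae M g h \<Longrightarrow> eq_ae M f h"
  unfolding eq_ae_def by (auto elim: AE_mp)

lemma eq_ae_lincomb: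
  "eq_ae M f f' \<Longrightarrow> eq_ae M g g' \<Longrightarrow>
     eq_ae M (\<lambda>x. a * f x + b * g x) (\<lambda>x. a * f' x + b * g' x)"
  unfolding eq_ae_def by (elim AE_mp) auto

lemma eq_ae_diff:
  "eq_ae M f f' \<Longrightarrow> eq_ae M g g' \<Longrightarrow> eq_ae M (\<lambda>x. f x - g x) (\<lambda>x. f' x - g' x)"
  using eq_ae_lincomb[of M f f' g g' 1 "-1"] by simp

lemma eq_ae_iff_norm2_diff:
  assumes "f \<in> L2 M" "g \<in> L2 M"
  shows "eq_ae M f g \<longleftrightarrow> norm2 M (\<lambda>x. f x - g x) = 0"
  unfolding norm2_eq_0[OF L2_diff[OF assms]] by (simp add: eq_ae_def)

lemma inner2_cong:
  assumes "eq_ae M f f'" "eq_ae M g g'" "f \<in> L2 M" "f' \<in> L2 M" "g \<in> L2 M" "g' \<in> L2 M"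
  shows "inner2 M f g = inner2 M f' g'"
  unfolding inner2_def using assms
  by (intro integral_cong_AE borel_measurable_times borel_measurable_cnj)
     (auto simp: eq_ae_def L2_measurable elim: AE_mp)

lemma norm2_cong:
  assumes "eq_ae M f f'" "f \<in> L2 M" "f' \<in> L2 M"
  shows "norm2 M f = norm2 M f'"
  using inner2_cong[OF assms(1) assms(1)] assms
  by (metis norm2_eq_inner2 norm2_nonneg power2_eq_iff_nonneg)

lemma cauchy_schwarz2:
  assumes f: "f \<in> L2 M" and g: "g \<in> L2 M"
  shows "cmod (inner2 M f g) \<le> norm2 M f * norm2 M g"
proof (cases "norm2 M g = 0")
  case True
  then have "eq_ae M g (\<lambda>x. 0)" using norm2_eq_0[OF g] by simp
  then have "inner2 M f g = inner2 M f (\<lambda>x. 0)"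
    using f g by (intro inner2_cong) auto
  then show ?thesis by simp
next
  case False
  define b where "b = (norm2 M g)\<^sup>2"
  have b: "b > 0" using False by (simp add: b_def)
  define c where "c = inner2 M f g"
  \<comment> \<open>\<open>a * g\<close> is the component of \<open>f\<close> along
    \<open>g\<close>; the estimate is the nonnegativity of the squared norm of the remainder
    \<open>h\<close>.\<close>
  define a where "a = c / complex_of_real b"
  define h where "h = (\<lambda>x. f x - a * g x)"
  have "inner2 M h h = inner2 M f f - cnj a * c - a * (cnj c - cnj a * complex_of_real b)"
    unfolding h_def
    by (simp add: inner2_left inner2_right L2_intros f g)
       (simp add: c_def inner2_cnj inner2_self[of M g] b_def ring_distribs)
  also have "\<dots> = inner2 M f f - (cmod c)\<^sup>2 / b"
    using b complex_norm_square[of c] by (simp add: a_def mult.commute)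
  finally have "(norm2 M h)\<^sup>2 = (norm2 M f)\<^sup>2 - (cmod c)\<^sup>2 / b"
    by (simp add: norm2_eq_inner2)
  then have "(cmod c)\<^sup>2 / b \<le> (norm2 M f)\<^sup>2"
    by (smt (verit) zero_le_power2)
  then have "(cmod c)\<^sup>2 \<le> (norm2 M f * norm2 M g)\<^sup>2"
    using b by (simp add: b_def power_mult_distrib field_simps)
  then show ?thesis
    unfolding c_def by (rule power2_le_imp_le) simp
qed

lemma norm2_scale: "norm2 M (\<lambda>x. a * f x) = cmod a * norm2 M f"
  by (simp add: norm2_def norm_mult power_mult_distrib real_sqrt_mult)

lemma norm2_triangle:
  assumes f: "f \<in> L2 M" and g: "g \<in> L2 M"
  shows "norm2 M (\<lambda>x. f x + g x) \<le> norm2 M f + norm2 M g"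
proof (rule power2_le_imp_le)
  have "inner2 M (\<lambda>x. f x + g x) (\<lambda>x. f x + g x) =
      inner2 M f f + inner2 M g g + (inner2 M f g + cnj (inner2 M f g))"
    using f g by (simp add: inner2_left inner2_right L2_intros inner2_cnj)
  then have "(norm2 M (\<lambda>x. f x + g x))\<^sup>2
      = (norm2 M f)\<^sup>2 + (norm2 M g)\<^sup>2 + 2 * Re (inner2 M f g)"
    by (simp add: norm2_eq_inner2)
  also have "\<dots> \<le> (norm2 M f)\<^sup>2 + (norm2 M g)\<^sup>2 + 2 * (norm2 M f * norm2 M g)"
    using cauchy_schwarz2[OF f g] complex_Re_le_cmod[of "inner2 M f g"] by linarith
  finally show "(norm2 M (\<lambda>x. f x + g x))\<^sup>2 \<le> (norm2 M f + norm2 M g)\<^sup>2"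
    by (simp add: power2_sum)
qed simp

lemma norm2_minus_commute: "norm2 M (\<lambda>x. f x - g x) = norm2 M (\<lambda>x. g x - f x)"
  by (simp add: norm2_def norm_minus_commute)

lemma norm2_diff_triangle:
  assumes "f \<in> L2 M" "g \<in> L2 M" "h \<in> L2 M"
  shows "norm2 M (\<lambda>x. f x - h x) \<le> norm2 M (\<lambda>x. f x - g x) + norm2 M (\<lambda>x. g x - h x)"
  using norm2_triangle[OF L2_diff[OF assms(1,2)] L2_diff[OF assms(2,3)]] by simp

lemma norm2_diff_le:
  assumes "f \<in> L2 M" "g \<in> L2 M"
  shows "norm2 M f - norm2 M g \<le> norm2 M (\<lambda>x. f x - g x)"
  using norm2_triangle[OF L2_diff[OF assms] assms(2)] by simp

lemma norm2_sum:
  assumes "\<And>i. i \<in> I \<Longrightarrow> f i \<in> L2 M"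
  shows "norm2 M (\<lambda>x. \<Sum>i\<in>I. f i x) \<le> (\<Sum>i\<in>I. norm2 M (f i))"
  using assms
proof (induction I rule: infinite_finite_induct)
  case (insert a I)
  then show ?case
    using norm2_triangle[of "f a" M "\<lambda>x. \<Sum>i\<in>I. f i x"] L2_sum[of I f M] by auto
qed auto

lemma pythagoras2:
  assumes f: "f \<in> L2 M" and g: "g \<in> L2 M" and "inner2 M f g = 0"
  shows "(norm2 M (\<lambda>x. f x + g x))\<^sup>2 = (norm2 M f)\<^sup>2 + (norm2 M g)\<^sup>2"
proof -
  have "inner2 M g f = 0" using assms(3) by (metis inner2_cnj complex_cnj_zero)
  then show ?thesis
    using assms by (simp add: norm2_eq_inner2 inner2_left inner2_right L2_intros)
qed

lemma eq_ae_by_inner2: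
  assumes V: "subspace2 M V" and "f \<in> V" "g \<in> V"
    and eq: "\<And>k. k \<in> V \<Longrightarrow> inner2 M f k = inner2 M g k"
  shows "eq_ae M f g"
proof -
  have L: "f \<in> L2 M" "g \<in> L2 M" using assms subspace2D by blast+
  have "inner2 M (\<lambda>x. f x - g x) (\<lambda>x. f x - g x) = 0"
    using eq[OF subspace2_diff[OF V assms(2,3)]] L by (simp add: inner2_left L2_intros)
  then have "(norm2 M (\<lambda>x. f x - g x))\<^sup>2 = 0" by (simp add: norm2_eq_inner2)
  then show ?thesis using eq_ae_iff_norm2_diff[OF L] by simp
qed

lemma tendsto_inner2:
  assumes F: "\<And>n. F n \<in> L2 M" and f: "f \<in> L2 M" and g: "g \<in> L2 M"
    and lim: "(\<lambda>n. norm2 M (\<lambda>x. F n x - f x)) \<longlonglongrightarrow> 0"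
  shows "(\<lambda>n. inner2 M (F n) g) \<longlonglongrightarrow> inner2 M f g"
proof (rule LIM_zero_cancel, rule Lim_null_comparison)
  show "(\<lambda>n. norm2 M (\<lambda>x. F n x - f x) * norm2 M g) \<longlonglongrightarrow> 0"
    using tendsto_mult[OF lim tendsto_const[of "norm2 M g"]] by simp
  show "\<forall>\<^sub>F n in sequentially. norm (inner2 M (F n) g - inner2 M f g)
      \<le> norm2 M (\<lambda>x. F n x - f x) * norm2 M g"
    using cauchy_schwarz2[OF L2_diff[OF F f] g] F f g by (simp add: inner2_diff_left)
qed

text \<open>Along a subsequence the differences \<open>d\<^sub>n\<close> satisfy \<open>\<parallel>d\<^sub>n\<parallel>\<^sup>2 \<le> 4\<^sup>-\<^sup>n\<close>; then \<open>\<Sum>\<^sub>n 2\<^sup>n |d\<^sub>n|\<^sup>2\<close> is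
  integrable, and \<open>2 |d\<^sub>n| \<le> 2\<^sup>n |d\<^sub>n|\<^sup>2 + 2\<^sup>-\<^sup>n\<close> gives pointwise convergence almost everywhere.\<close>

lemma L2_complete:
  assumes F: "\<And>n. F n \<in> L2 M"
    and cauchy: "\<And>e. e > 0 \<Longrightarrow> \<exists>N. \<forall>m\<ge>N. \<forall>n\<ge>N. norm2 M (\<lambda>x. F m x - F n x) < e"
  obtains g where "g \<in> L2 M" "(\<lambda>n. norm2 M (\<lambda>x. F n x - g x)) \<longlonglongrightarrow> 0"
proof -
  have [measurable]: "\<And>n. F n \<in> borel_measurable M" using F by (simp add: L2_def)
  obtain N where N: "\<And>k m n. m \<ge> N k \<Longrightarrow> n \<ge> N k \<Longrightarrow> norm2 M (\<lambda>x. F m x - F n x) < (1/2)^k"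
    using cauchy[of "(1/2)^k" for k] by (metis zero_less_power half_gt_zero zero_less_one)
  \<comment> \<open>Summing the \<open>N i\<close> puts both \<open>r k\<close> and
    \<open>r (Suc k)\<close> beyond \<open>N k\<close>; the added \<open>k\<close> makes
    \<open>r\<close> tend to infinity.\<close>
  define r where "r k = (\<Sum>i\<le>k. N i) + k" for k
  have r: "N k \<le> r k" "N k \<le> r (Suc k)" "k \<le> r k" for k
  proof -
    have "N k \<le> sum N {..k}" by (rule member_le_sum) auto
    then show "N k \<le> r k" "N k \<le> r (Suc k)" "k \<le> r k" by (auto simp: r_def)
  qed
  define d where "d k = (\<lambda>x. F (r (Suc k)) x - F (r k) x)" for k
  have dL: "d k \<in> L2 M" for k unfolding d_def by (intro L2_diff F)
  have [measurable]: "\<And>n. d n \<in> borel_measurable M" using dL by (simp add: L2_def)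
  have dn: "norm2 M (d k) < (1/2)^k" for k unfolding d_def using r by (intro N)
  have "(\<integral>\<^sup>+x. (\<Sum>k. ennreal (2^k * (cmod (d k x))\<^sup>2)) \<partial>M)
      = (\<Sum>k. \<integral>\<^sup>+x. ennreal (2^k * (cmod (d k x))\<^sup>2) \<partial>M)"
    by (intro nn_integral_suminf) auto
  also have "\<dots> \<le> (\<Sum>k. ennreal ((1/2)^k))"
  proof (intro suminf_le allI)
    fix k
    have "(\<integral>\<^sup>+x. ennreal (2^k * (cmod (d k x))\<^sup>2) \<partial>M) = ennreal (2^k * (norm2 M (d k))\<^sup>2)"
      unfolding norm2_square using L2_integrable[OF dL[of k]]
      by (subst nn_integral_eq_integral) auto
    also have "2^k * (norm2 M (d k))\<^sup>2 \<le> 2^k * ((1/2)^k)\<^sup>2"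
      using dn[of k] by (intro mult_left_mono power_mono) auto
    also have "\<dots> = (1/2::real)^k"
      by (simp add: power2_eq_square power_one_over)
    finally show "(\<integral>\<^sup>+x. ennreal (2^k * (cmod (d k x))\<^sup>2) \<partial>M) \<le> ennreal ((1/2)^k)"
      by (simp add: ennreal_leI)
  qed auto
  also have "\<dots> = ennreal (\<Sum>k. (1/2)^k)"
    by (intro suminf_ennreal2) auto
  finally have "(\<integral>\<^sup>+x. (\<Sum>k. ennreal (2^k * (cmod (d k x))\<^sup>2)) \<partial>M) \<noteq> \<infinity>"
    by (auto simp: top_unique)
  then have "AE x in M. (\<Sum>k. ennreal (2^k * (cmod (d k x))\<^sup>2)) \<noteq> \<infinity>"
    by (intro nn_integral_noteq_infinite) auto
  then have conv: "AE x in M. convergent (\<lambda>k. F (r k) x)"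
  proof (rule AE_mp, intro AE_I2 impI)
    fix x assume "(\<Sum>k. ennreal (2^k * (cmod (d k x))\<^sup>2)) \<noteq> \<infinity>"
    then have s1: "summable (\<lambda>k. 2^k * (cmod (d k x))\<^sup>2)"
      by (intro summable_suminf_not_top) auto
    have "summable (\<lambda>k. 2^k * (cmod (d k x))\<^sup>2 + (1/2)^k)"
      by (intro summable_add s1 summable_geometric) auto
    then have "summable (\<lambda>k. d k x)"
    proof (rule summable_comparison_test[rotated], intro exI allI impI)
      fix k :: nat
      have "2 * (cmod (d k x) * 2^k) * 1 \<le> (cmod (d k x) * 2^k)\<^sup>2 + 1\<^sup>2"
        by (rule sum_squares_bound)
      then have "2 * cmod (d k x) \<le> 2^k * (cmod (d k x))\<^sup>2 + (1/2)^k"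
        by (simp add: power2_eq_square power_one_over field_simps)
      then show "norm (d k x) \<le> 2^k * (cmod (d k x))\<^sup>2 + (1/2)^k"
        using norm_ge_zero[of "d k x"] by linarith
    qed
    then have "convergent (\<lambda>n. \<Sum>k<n. d k x)" by (simp add: summable_iff_convergent)
    moreover have "(\<Sum>k<n. d k x) = F (r n) x - F (r 0) x" for n
      unfolding d_def by (rule sum_lessThan_telescope)
    ultimately show "convergent (\<lambda>k. F (r k) x)"
      by (simp add: convergent_diff_const_right_iff)
  qed
  define g where "g x = lim (\<lambda>k. F (r k) x)" for x
  have [measurable]: "g \<in> borel_measurable M"
    unfolding g_def by measurable
  have lim: "AE x in M. (\<lambda>k. F (r k) x) \<longlonglongrightarrow> g x"
    using conv by (auto simp: g_def convergent_LIMSEQ_iff)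
  \<comment> \<open>Fatou's lemma along the subsequence turns the Cauchy bound into a bound for the
    distance to the pointwise limit. Membership of \<open>g\<close> in \<open>L2 M\<close> is not
    yet known, hence the nonnegative integral instead of \<open>norm2\<close>.\<close>
  have close: "\<exists>K. \<forall>n\<ge>K. (\<integral>\<^sup>+x. ennreal ((cmod (F n x - g x))\<^sup>2) \<partial>M) \<le> ennreal (e\<^sup>2)"
    if e: "e > 0" for e
  proof -
    obtain K where K: "\<And>m n. m \<ge> K \<Longrightarrow> n \<ge> K \<Longrightarrow> norm2 M (\<lambda>x. F m x - F n x) < e"
      using cauchy[OF e] by blast
    have "(\<integral>\<^sup>+x. ennreal ((cmod (F n x - g x))\<^sup>2) \<partial>M) \<le> ennreal (e\<^sup>2)" if n: "n \<ge> K" for n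
    proof -
      have "(\<integral>\<^sup>+x. ennreal ((cmod (F n x - g x))\<^sup>2) \<partial>M)
          \<le> (\<integral>\<^sup>+x. liminf (\<lambda>k. ennreal ((cmod (F n x - F (r k) x))\<^sup>2)) \<partial>M)"
      proof (rule nn_integral_mono_AE, use lim in \<open>rule AE_mp\<close>, intro AE_I2 impI)
        fix x assume "(\<lambda>k. F (r k) x) \<longlonglongrightarrow> g x"
        then have "(\<lambda>k. ennreal ((cmod (F n x - F (r k) x))\<^sup>2))
            \<longlonglongrightarrow> ennreal ((cmod (F n x - g x))\<^sup>2)"
          by (intro tendsto_intros)
        from lim_imp_Liminf[OF _ this]
        show "ennreal ((cmod (F n x - g x))\<^sup>2)
            \<le> liminf (\<lambda>k. ennreal ((cmod (F n x - F (r k) x))\<^sup>2))" by simp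
      qed
      also have "\<dots> \<le> liminf (\<lambda>k. \<integral>\<^sup>+x. ennreal ((cmod (F n x - F (r k) x))\<^sup>2) \<partial>M)"
        by (intro nn_integral_liminf) auto
      also have "\<dots> \<le> ennreal (e\<^sup>2)"
      proof (rule Liminf_le)
        show "\<forall>\<^sub>F k in sequentially. (\<integral>\<^sup>+x. ennreal ((cmod (F n x - F (r k) x))\<^sup>2) \<partial>M) \<le> ennreal (e\<^sup>2)"
        proof (rule eventually_sequentiallyI[of K])
          fix k assume "K \<le> k"
          then have "r k \<ge> K" using r(3)[of k] by simp
          then have "norm2 M (\<lambda>x. F n x - F (r k) x) < e" using K n by blast
          then have "(norm2 M (\<lambda>x. F n x - F (r k) x))\<^sup>2 \<le> e\<^sup>2" by (intro power_mono) auto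
          moreover have "(\<integral>\<^sup>+x. ennreal ((cmod (F n x - F (r k) x))\<^sup>2) \<partial>M)
              = ennreal ((norm2 M (\<lambda>x. F n x - F (r k) x))\<^sup>2)"
            unfolding norm2_square using L2_integrable[OF L2_diff[OF F[of n] F[of "r k"]]]
            by (subst nn_integral_eq_integral) auto
          ultimately show "(\<integral>\<^sup>+x. ennreal ((cmod (F n x - F (r k) x))\<^sup>2) \<partial>M) \<le> ennreal (e\<^sup>2)"
            by (simp add: ennreal_leI)
        qed
      qed simp
      finally show ?thesis .
    qed
    then show ?thesis by blast
  qed
  obtain n0 where n0: "(\<integral>\<^sup>+x. ennreal ((cmod (F n0 x - g x))\<^sup>2) \<partial>M) \<le> ennreal (1\<^sup>2)"
    using close[of 1] by auto
  have "(\<lambda>x. F n0 x - g x) \<in> L2 M"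
    unfolding L2_def using n0
    by (auto intro!: integrableI_bounded simp: less_top[symmetric] top_unique)
  from L2_diff[OF F[of n0] this] have gL: "g \<in> L2 M" by simp
  have "(\<lambda>n. norm2 M (\<lambda>x. F n x - g x)) \<longlonglongrightarrow> 0"
  proof (rule LIMSEQ_I)
    fix e :: real assume e: "e > 0"
    then obtain K where K: "\<And>n. n \<ge> K \<Longrightarrow>
        (\<integral>\<^sup>+x. ennreal ((cmod (F n x - g x))\<^sup>2) \<partial>M) \<le> ennreal ((e/2)\<^sup>2)"
      using close[of "e/2"] by auto
    have "norm2 M (\<lambda>x. F n x - g x) \<le> e/2" if n: "n \<ge> K" for n
    proof (rule power2_le_imp_le)
      have "ennreal ((norm2 M (\<lambda>x. F n x - g x))\<^sup>2) = (\<integral>\<^sup>+x. ennreal ((cmod (F n x - g x))\<^sup>2) \<partial>M)"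
        unfolding norm2_square using L2_integrable[OF L2_diff[OF F[of n] gL]]
        by (subst nn_integral_eq_integral) auto
      then have "ennreal ((norm2 M (\<lambda>x. F n x - g x))\<^sup>2) \<le> ennreal ((e/2)\<^sup>2)"
        using K[OF n] by simp
      then show "(norm2 M (\<lambda>x. F n x - g x))\<^sup>2 \<le> (e/2)\<^sup>2" by simp
    qed (use e in simp)
    then show "\<exists>K. \<forall>n\<ge>K. norm (norm2 M (\<lambda>x. F n x - g x) - 0) < e"
      using e by (intro exI[of _ K]) force
  qed
  with gL show thesis by (rule that)
qed


text \<open>A minimizing sequence is Cauchy by the parallelogram law. \<open>S\<close> is not
  assumed closed, so the foot \<open>g\<close> is only a limit of elements of \<open>S\<close>;
  where it lies is settled separately for each space by a closedness argument.\<close>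

lemma projection2:
  assumes S: "subspace2 M S" and f: "f \<in> L2 M"
  obtains g where "g \<in> L2 M" "\<And>e. e > 0 \<Longrightarrow> \<exists>s\<in>S. norm2 M (\<lambda>x. g x - s x) < e"
    "\<And>s. s \<in> S \<Longrightarrow> inner2 M (\<lambda>x. f x - g x) s = 0"
proof -
  define D where "D = (\<lambda>s. norm2 M (\<lambda>x. f x - s x)) ` S"
  define d where "d = Inf D"
  have bdd: "bdd_below D" unfolding D_def by (rule bdd_belowI[of _ 0]) auto
  have ne: "D \<noteq> {}" using subspace2_zero[OF S] by (auto simp: D_def)
  have d_le: "d \<le> norm2 M (\<lambda>x. f x - s x)" if "s \<in> S" for s
    unfolding d_def using that bdd by (intro cInf_lower) (auto simp: D_def)
  have d0: "d \<ge> 0" unfolding d_def by (rule cInf_greatest[OF ne]) (auto simp: D_def)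
  have "\<exists>s\<in>S. norm2 M (\<lambda>x. f x - s x) < d + 1 / Suc n" for n
  proof -
    have "Inf D < d + 1 / Suc n" by (simp add: d_def)
    from cInf_lessD[OF ne this] show ?thesis by (auto simp: D_def)
  qed
  then obtain F where FS: "\<And>n. F n \<in> S" and Fd: "\<And>n. norm2 M (\<lambda>x. f x - F n x) < d + 1 / Suc n"
    by metis
  have FL: "F n \<in> L2 M" for n using FS S subspace2D by blast
  have Flim: "(\<lambda>n. norm2 M (\<lambda>x. f x - F n x)) \<longlonglongrightarrow> d"
  proof (rule real_tendsto_sandwich[where f="\<lambda>_. d" and h="\<lambda>n. d + 1 / real (Suc n)"])
    show "(\<lambda>n. d + 1 / real (Suc n)) \<longlonglongrightarrow> d"
      using tendsto_add[OF tendsto_const[of d] LIMSEQ_Suc[OF lim_1_over_n]] by simp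
    show "\<forall>\<^sub>F n in sequentially. norm2 M (\<lambda>x. f x - F n x) \<le> d + 1 / real (Suc n)"
      using Fd by (intro always_eventually allI less_imp_le)
    show "\<forall>\<^sub>F n in sequentially. d \<le> norm2 M (\<lambda>x. f x - F n x)"
      using d_le FS by (intro always_eventually) auto
  qed simp
  \<comment> \<open>The midpoint of \<open>F m\<close> and \<open>F n\<close> lies in
    \<open>S\<close>, so its distance from \<open>f\<close> is at least \<open>d\<close>; this
    accounts for the term \<open>4 * d\<^sup>2\<close> in the parallelogram identity.\<close>
  have par: "(norm2 M (\<lambda>x. F m x - F n x))\<^sup>2
      \<le> 2 * (norm2 M (\<lambda>x. f x - F m x))\<^sup>2 + 2 * (norm2 M (\<lambda>x. f x - F n x))\<^sup>2 - 4 * d\<^sup>2" for m n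
  proof -
    define s where "s = (\<lambda>x. (1/2) * F m x + (1/2) * F n x)"
    have s: "s \<in> S" unfolding s_def by (intro subspace2_lincomb[OF S] FS)
    define a where "a = (\<lambda>x. f x - F m x)"
    define b where "b = (\<lambda>x. f x - F n x)"
    have ab: "a \<in> L2 M" "b \<in> L2 M" unfolding a_def b_def by (intro L2_diff f FL)+
    have "norm2 M (\<lambda>x. a x + b x) = norm2 M (\<lambda>x. 2 * (f x - s x))"
      by (rule arg_cong[of _ _ "norm2 M"]) (auto simp: a_def b_def s_def)
    then have 1: "norm2 M (\<lambda>x. a x + b x) = 2 * norm2 M (\<lambda>x. f x - s x)"
      by (simp only: norm2_scale norm_numeral)
    have 2: "norm2 M (\<lambda>x. b x - a x) = norm2 M (\<lambda>x. F m x - F n x)"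
      by (rule arg_cong[of _ _ "norm2 M"]) (auto simp: a_def b_def)
    have p: "(norm2 M (\<lambda>x. a x + b x))\<^sup>2 + (norm2 M (\<lambda>x. b x - a x))\<^sup>2
        = 2 * (norm2 M a)\<^sup>2 + 2 * (norm2 M b)\<^sup>2"
      using ab by (simp add: norm2_eq_inner2 inner2_left inner2_right L2_intros)
    have "d\<^sup>2 \<le> (norm2 M (\<lambda>x. f x - s x))\<^sup>2" using d_le[OF s] d0 by (rule power_mono)
    then show ?thesis using p[unfolded 1 2] by (simp add: power_mult_distrib a_def b_def)
  qed
  have "\<exists>N. \<forall>m\<ge>N. \<forall>n\<ge>N. norm2 M (\<lambda>x. F m x - F n x) < e" if e: "e > 0" for e
  proof -
    have "(\<lambda>n. (norm2 M (\<lambda>x. f x - F n x))\<^sup>2) \<longlonglongrightarrow> d\<^sup>2" by (intro tendsto_intros Flim)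
    moreover have "d\<^sup>2 < d\<^sup>2 + e\<^sup>2 / 4" using e by simp
    ultimately have "\<forall>\<^sub>F n in sequentially. (norm2 M (\<lambda>x. f x - F n x))\<^sup>2 < d\<^sup>2 + e\<^sup>2 / 4"
      by (rule order_tendstoD)
    then obtain N where N: "\<And>n. n \<ge> N \<Longrightarrow> (norm2 M (\<lambda>x. f x - F n x))\<^sup>2 < d\<^sup>2 + e\<^sup>2 / 4"
      by (auto simp: eventually_sequentially)
    have "norm2 M (\<lambda>x. F m x - F n x) < e" if "m \<ge> N" "n \<ge> N" for m n
    proof (rule power_less_imp_less_base)
      show "(norm2 M (\<lambda>x. F m x - F n x))\<^sup>2 < e\<^sup>2"
        using par[of m n] N[OF that(1)] N[OF that(2)] by linarith
    qed (use e in simp)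
    then show ?thesis by blast
  qed
  then obtain g where g: "g \<in> L2 M" and lim: "(\<lambda>n. norm2 M (\<lambda>x. F n x - g x)) \<longlonglongrightarrow> 0"
    using L2_complete[of F M] FL by blast
  have close: "\<exists>s\<in>S. norm2 M (\<lambda>x. g x - s x) < e" if e: "e > 0" for e
  proof -
    obtain n where "norm2 M (\<lambda>x. F n x - g x) < e"
      using order_tendstoD(2)[OF lim e] by (auto simp: eventually_sequentially)
    then show ?thesis using FS norm2_minus_commute[of M g "F n"] by (metis (no_types))
  qed
  have gd: "norm2 M (\<lambda>x. f x - g x) \<le> d"
  proof (rule LIMSEQ_le_const)
    show "(\<lambda>n. norm2 M (\<lambda>x. f x - F n x) + norm2 M (\<lambda>x. F n x - g x)) \<longlonglongrightarrow> d"
      using tendsto_add[OF Flim lim] by simp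
    show "\<exists>N. \<forall>n\<ge>N. norm2 M (\<lambda>x. f x - g x)
        \<le> norm2 M (\<lambda>x. f x - F n x) + norm2 M (\<lambda>x. F n x - g x)"
      using norm2_diff_triangle[OF f FL g] by blast
  qed
  \<comment> \<open>Although \<open>g\<close> need not be in \<open>S\<close>, translating it by an
    element of \<open>S\<close> cannot bring it closer to \<open>f\<close> than \<open>d\<close>:
    replace \<open>g\<close> by a nearby \<open>t\<close> in \<open>S\<close>.\<close>
  have dg: "d \<le> norm2 M (\<lambda>x. f x - (g x + s x))" if s: "s \<in> S" for s
  proof (rule field_le_epsilon)
    fix e :: real assume "e > 0"
    then obtain t where t: "t \<in> S" "norm2 M (\<lambda>x. g x - t x) < e" using close by blast
    have L: "t \<in> L2 M" "s \<in> L2 M" using s t S subspace2D by blast+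
    have "d \<le> norm2 M (\<lambda>x. f x - (t x + s x))"
      by (intro d_le subspace2_add[OF S] t s)
    also have "\<dots> \<le> norm2 M (\<lambda>x. f x - (g x + s x)) + norm2 M (\<lambda>x. (g x + s x) - (t x + s x))"
      by (intro norm2_diff_triangle L2_intros f g L)
    finally show "d \<le> norm2 M (\<lambda>x. f x - (g x + s x)) + e" using t(2) by simp
  qed
  have "inner2 M (\<lambda>x. f x - g x) s = 0" if s: "s \<in> S" for s
  proof (cases "norm2 M s = 0")
    case True
    have sL: "s \<in> L2 M" using s S subspace2D by blast
    then have "cmod (inner2 M (\<lambda>x. f x - g x) s) \<le> 0"
      using cauchy_schwarz2[OF L2_diff[OF f g] sL] True by simp
    then show ?thesis by simp
  next
    case False
    have sL: "s \<in> L2 M" using s S subspace2D by blast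
    define h where "h = (\<lambda>x. f x - g x)"
    have hL: "h \<in> L2 M" unfolding h_def by (intro L2_diff f g)
    define b where "b = (norm2 M s)\<^sup>2"
    have b: "b > 0" using False by (simp add: b_def)
    define c where "c = inner2 M h s"
    \<comment> \<open>\<open>a * s\<close> is the component of \<open>h\<close> along
      \<open>s\<close>. Subtracting it lowers the squared distance by
      \<open>(cmod c)\<^sup>2 / b\<close>, which minimality forbids unless
      \<open>c = 0\<close>.\<close>
    define a where "a = c / complex_of_real b"
    have "inner2 M (\<lambda>x. h x - a * s x) (\<lambda>x. h x - a * s x)
        = inner2 M h h - cnj a * c - a * (cnj c - cnj a * complex_of_real b)"
      by (simp add: inner2_left inner2_right L2_intros hL sL)
         (simp add: c_def inner2_cnj inner2_self[of M s] b_def ring_distribs)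
    also have "\<dots> = inner2 M h h - (cmod c)\<^sup>2 / b"
      using b complex_norm_square[of c] by (simp add: a_def mult.commute)
    finally have eq: "(norm2 M (\<lambda>x. h x - a * s x))\<^sup>2 = (norm2 M h)\<^sup>2 - (cmod c)\<^sup>2 / b"
      by (simp add: norm2_eq_inner2)
    have "d \<le> norm2 M (\<lambda>x. h x - a * s x)"
      using dg[OF subspace2_scale[OF S s, of a]] by (simp add: h_def algebra_simps)
    then have "norm2 M h \<le> norm2 M (\<lambda>x. h x - a * s x)" using gd by (simp add: h_def)
    then have "(norm2 M h)\<^sup>2 \<le> (norm2 M (\<lambda>x. h x - a * s x))\<^sup>2" by (rule power_mono) simp
    then have "(cmod c)\<^sup>2 / b \<le> 0" using eq by linarith
    then have "c = 0" using b by (simp add: divide_le_0_iff)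
    then show ?thesis by (simp add: c_def h_def)
  qed
  with g close show thesis by (intro that) auto
qed

section \<open>Functional calculus\<close>

lemma L2_bounded:
  assumes "finite_measure M" "f \<in> borel_measurable M" "\<And>x. cmod (f x) \<le> C"
  shows "f \<in> L2 M"
proof -
  interpret finite_measure M by fact
  have "integrable M (\<lambda>x. (cmod (f x))\<^sup>2)"
    using assms by (intro integrable_const_bound[where B="C\<^sup>2"]) (auto intro!: AE_I2 power_mono)
  then show ?thesis using assms by (simp add: L2_def)
qed

lemma integrable_bounded:
  fixes f :: "'a \<Rightarrow> 'b::{banach, second_countable_topology}"
  assumes "finite_measure M" "f \<in> borel_measurable M" "\<And>x. norm (f x) \<le> C"
  shows "integrable M f"
  using assms by (intro finite_measure.integrable_const_bound[where B=C]) auto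

lemma L2_simple_approx:
  assumes h: "h \<in> L2 M"
  obtains F where "\<And>n. simple_function M (F n)" "\<And>n. F n \<in> L2 M"
    "\<And>n x. x \<in> space M \<Longrightarrow> cmod (F n x) \<le> 2 * cmod (h x)"
    "\<And>x. x \<in> space M \<Longrightarrow> (\<lambda>n. F n x) \<longlonglongrightarrow> h x"
    "(\<lambda>n. norm2 M (\<lambda>x. F n x - h x)) \<longlonglongrightarrow> 0"
proof -
  have [measurable]: "h \<in> borel_measurable M" using h by (simp add: L2_def)
  obtain F where F: "\<And>n. simple_function M (F n)"
      "\<And>x. x \<in> space M \<Longrightarrow> (\<lambda>n. F n x) \<longlonglongrightarrow> h x"
      "\<And>n x. x \<in> space M \<Longrightarrow> dist (F n x) 0 \<le> 2 * dist (h x) 0"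
  proof -
    obtain F where "\<forall>n. simple_function M (F n)" "\<forall>x\<in>space M. (\<lambda>n. F n x) \<longlonglongrightarrow> h x"
      "\<forall>n. \<forall>x\<in>space M. dist (F n x) 0 \<le> 2 * dist (h x) 0"
      using borel_measurable_implies_sequence_metric[OF \<open>h \<in> borel_measurable M\<close>, of 0] by blast
    then show thesis by (intro that[of F]) auto
  qed
  have [measurable]: "\<And>n. F n \<in> borel_measurable M"
    using F(1) by (rule borel_measurable_simple_function)
  \<comment> \<open>The factor 9 is the square of 3: from \<open>|F n| \<le> 2 |h|\<close> follows
    \<open>|F n - h| \<le> 3 |h|\<close>. The same majorant covers \<open>|F n|\<close>
    squared.\<close>
  have int: "integrable M (\<lambda>x. 9 * (cmod (h x))\<^sup>2)" using L2_integrable[OF h] by auto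
  have FL: "F n \<in> L2 M" for n
  proof -
    have "integrable M (\<lambda>x. (cmod (F n x))\<^sup>2)"
    proof (rule Bochner_Integration.integrable_bound[OF int])
      have "(cmod (F n x))\<^sup>2 \<le> 9 * (cmod (h x))\<^sup>2" if "x \<in> space M" for x
      proof -
        have "(cmod (F n x))\<^sup>2 \<le> (2 * cmod (h x))\<^sup>2" using F(3)[OF that] by (intro power_mono) auto
        then show ?thesis by (simp add: power_mult_distrib) (smt (verit) zero_le_power2)
      qed
      then show "AE x in M. norm ((cmod (F n x))\<^sup>2) \<le> norm (9 * (cmod (h x))\<^sup>2)" by auto
    qed simp
    then show ?thesis by (simp add: L2_def)
  qed
  have "(\<lambda>n. \<integral>x. (cmod (F n x - h x))\<^sup>2 \<partial>M) \<longlonglongrightarrow> (\<integral>x. 0 \<partial>M)"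
  proof (rule integral_dominated_convergence[OF _ _ int])
    show "AE x in M. (\<lambda>n. (cmod (F n x - h x))\<^sup>2) \<longlonglongrightarrow> 0"
    proof (rule AE_I2)
      fix x assume "x \<in> space M"
      then have "(\<lambda>n. F n x - h x) \<longlonglongrightarrow> 0" using F(2) by (simp add: LIM_zero_iff)
      then have "(\<lambda>n. (cmod (F n x - h x))\<^sup>2) \<longlonglongrightarrow> (cmod 0)\<^sup>2" by (intro tendsto_intros)
      then show "(\<lambda>n. (cmod (F n x - h x))\<^sup>2) \<longlonglongrightarrow> 0" by simp
    qed
    fix n
    have "(cmod (F n x - h x))\<^sup>2 \<le> 9 * (cmod (h x))\<^sup>2" if "x \<in> space M" for x
    proof -
      have "cmod (F n x - h x) \<le> 3 * cmod (h x)"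
        using F(3)[OF that, of n] norm_triangle_ineq4[of "F n x" "h x"] by simp
      then have "(cmod (F n x - h x))\<^sup>2 \<le> (3 * cmod (h x))\<^sup>2" by (intro power_mono) auto
      then show ?thesis by (simp add: power_mult_distrib)
    qed
    then show "AE x in M. norm ((cmod (F n x - h x))\<^sup>2) \<le> 9 * (cmod (h x))\<^sup>2" by auto
  qed auto
  then have "(\<lambda>n. sqrt (\<integral>x. (cmod (F n x - h x))\<^sup>2 \<partial>M)) \<longlonglongrightarrow> sqrt 0"
    by (intro tendsto_real_sqrt) simp
  then have "(\<lambda>n. norm2 M (\<lambda>x. F n x - h x)) \<longlonglongrightarrow> 0" by (simp add: norm2_def)
  with F FL show thesis by (intro that[of F]) auto
qed

text \<open>Open half-lines determine a finite Borel measure, and their indicators are bounded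
  limits of continuous functions. This identifies \<open>\<rho>\<close>, which is given only through
  integrals of continuous functions.\<close>

lemma finite_borel_measure_eqI:
  fixes M N :: "real measure"
  assumes M: "finite_measure M" "sets M = sets borel" and N: "finite_measure N" "sets N = sets borel"
    and eq: "\<And>f :: real \<Rightarrow> real. continuous_on UNIV f \<Longrightarrow> (\<And>x. \<bar>f x\<bar> \<le> 1) \<Longrightarrow>
      (\<integral>x. f x \<partial>M) = (\<integral>x. f x \<partial>N)"
  shows "M = N"
proof (rule measure_eqI_lessThan)
  interpret M: finite_measure M by fact
  interpret N: finite_measure N by fact
  fix a :: real
  show "emeasure M {a<..} < \<infinity>" by (simp add: M.emeasure_eq_measure)
  \<comment> \<open>Continuous ramps of slope \<open>n\<close>, increasing to the indicator of the
    half-line.\<close>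
  define F where "F n x = min 1 (real n * max 0 (x - a))" for n x
  have cont: "continuous_on UNIV (F n)" for n unfolding F_def by (intro continuous_intros)
  have bound: "\<bar>F n x\<bar> \<le> 1" for n x by (auto simp: F_def)
  have lim: "(\<lambda>n. F n x) \<longlonglongrightarrow> indicator {a<..} x" for x
  proof (cases "a < x")
    case True
    obtain m :: nat where m: "1 / (x - a) < real m" using reals_Archimedean2 by blast
    have "F n x = 1" if "n \<ge> m" for n
    proof -
      have "1 / (x - a) < real n" using m that by linarith
      then show ?thesis using True by (simp add: F_def field_simps)
    qed
    then show ?thesis using True by (intro tendsto_eventually) (auto simp: eventually_sequentially)
  qed (auto simp: F_def)
  have conv: "(\<lambda>n. \<integral>x. F n x \<partial>L) \<longlonglongrightarrow> measure L {a<..}"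
    if L: "finite_measure L" and sets [measurable_cong]: "sets L = sets borel" for L
  proof -
    interpret L: finite_measure L by fact
    have [measurable]: "F n \<in> borel_measurable L" for n unfolding F_def by measurable
    have "(\<lambda>n. \<integral>x. F n x \<partial>L) \<longlonglongrightarrow> (\<integral>x. indicator {a<..} x \<partial>L)"
      by (rule integral_dominated_convergence[where w="\<lambda>_. 1"]) (use lim bound in auto)
    then show ?thesis using sets_eq_imp_space_eq[OF sets] by simp
  qed
  have "(\<lambda>n. \<integral>x. F n x \<partial>M) = (\<lambda>n. \<integral>x. F n x \<partial>N)"
    using eq[OF cont bound] by auto
  then have "measure M {a<..} = measure N {a<..}"
    using conv[OF M] conv[OF N] LIMSEQ_unique by metis
  then show "emeasure M {a<..} = emeasure N {a<..}"
    by (simp add: M.emeasure_eq_measure N.emeasure_eq_measure)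
qed (use M N in auto)

text \<open>The functional calculus of a step function \<open>h\<close>: each value times the
  spectral projection of its level set. All other vectors of the calculus are norm limits of
  these.\<close>

definition simple_op ::
  "(real set \<Rightarrow> ('a \<Rightarrow> complex) \<Rightarrow> ('a \<Rightarrow> complex)) \<Rightarrow> (real \<Rightarrow> complex) \<Rightarrow>
   ('a \<Rightarrow> complex) \<Rightarrow> ('a \<Rightarrow> complex)" where
  "simple_op E h f = (\<lambda>x. \<Sum>c\<in>range h. c * E (h -` {c}) f x)"

lemma simple_function_borelD:
  fixes h :: "real \<Rightarrow> complex"
  assumes "simple_function borel h"
  shows "finite (range h)" "h -` {c} \<in> sets borel" "h \<in> borel_measurable borel"
proof -
  show "finite (range h)" and "h \<in> borel_measurable borel"
    using assms simple_functionD(1)[OF assms] borel_measurable_simple_function[OF assms] by auto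
  show "h -` {c} \<in> sets borel" using simple_functionD(2)[OF assms, of "{c}"] by simp
qed

lemma simple_function_rep:
  fixes h :: "real \<Rightarrow> complex"
  assumes "simple_function borel h"
  shows "h s = (\<Sum>c\<in>range h. c * indicator (h -` {c}) s)"
proof -
  have "(\<Sum>c\<in>range h. c * indicator (h -` {c}) s) = (\<Sum>c\<in>range h. if c = h s then c else 0)"
    by (intro sum.cong) (auto simp: indicator_def)
  then show "h s = (\<Sum>c\<in>range h. c * indicator (h -` {c}) s)"
    using simple_function_borelD(1)[OF assms] by simp
qed

lemma bounded_simple_function:
  fixes h :: "real \<Rightarrow> complex"
  assumes "simple_function borel h"
  shows "\<exists>C. \<forall>s. cmod (h s) \<le> C"
proof -
  have "bounded (range h)" by (rule finite_imp_bounded[OF simple_function_borelD(1)[OF assms]])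
  then show ?thesis by (auto simp: bounded_iff)
qed

lemma fun_calc_borel: "fun_calc M V E h f g \<Longrightarrow> h \<in> borel_measurable borel"
  by (simp add: fun_calc_def)

section \<open>The calculus of a projection-valued measure\<close>

locale spectral_space =
  fixes M :: "'a measure" and V and E
  assumes V: "subspace2 M V" and pvm: "projection_valued_measure M V E"
begin

abbreviation "mu \<equiv> scalar_measure M E"
abbreviation "sI \<equiv> spectral_integral M E"

lemma VL2: "f \<in> V \<Longrightarrow> f \<in> L2 M"
  using V subspace2D by blast

lemma E_in: "B \<in> sets borel \<Longrightarrow> f \<in> V \<Longrightarrow> E B f \<in> V"
  using pvm by (auto simp: projection_valued_measure_def bounded_linear_on_def)

lemma E_L2: "B \<in> sets borel \<Longrightarrow> f \<in> V \<Longrightarrow> E B f \<in> L2 M"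
  using E_in VL2 by blast

lemma E_adj: "B \<in> sets borel \<Longrightarrow> f \<in> V \<Longrightarrow> g \<in> V \<Longrightarrow> inner2 M (E B f) g = inner2 M f (E B g)"
  using pvm by (auto simp: projection_valued_measure_def)

lemma E_Int: "B \<in> sets borel \<Longrightarrow> C \<in> sets borel \<Longrightarrow> f \<in> V \<Longrightarrow> eq_ae M (E (B \<inter> C) f) (E B (E C f))"
  using pvm by (auto simp: projection_valued_measure_def)

lemma E_UNIV: "f \<in> V \<Longrightarrow> eq_ae M (E UNIV f) f"
  using pvm by (auto simp: projection_valued_measure_def)

lemma E_lincomb:
  "B \<in> sets borel \<Longrightarrow> f \<in> V \<Longrightarrow> g \<in> V \<Longrightarrow>
     eq_ae M (E B (\<lambda>x. a * f x + b * g x)) (\<lambda>x. a * E B f x + b * E B g x)"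
  using pvm by (auto simp: projection_valued_measure_def bounded_linear_on_def)

lemma E_inner_E:
  assumes B: "B \<in> sets borel" and C: "C \<in> sets borel" and f: "f \<in> V" and g: "g \<in> V"
  shows "inner2 M (E B f) (E C g) = inner2 M (E (B \<inter> C) f) g"
proof -
  have "inner2 M (E B f) (E C g) = inner2 M (E C (E B f)) g"
    using E_adj[OF C E_in[OF B f] g] by simp
  also have "\<dots> = inner2 M (E (C \<inter> B) f) g"
    using assms by (intro inner2_cong eq_ae_sym[OF E_Int] eq_ae_refl E_L2 E_in VL2) auto
  finally show ?thesis by (simp add: Int_commute)
qed

lemma E_self: "B \<in> sets borel \<Longrightarrow> f \<in> V \<Longrightarrow> inner2 M (E B f) f = complex_of_real ((norm2 M (E B f))\<^sup>2)"
  using E_inner_E[of B B f f] by (simp add: inner2_self)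

lemma sets_mu [simp, measurable_cong]: "sets (mu f) = sets borel"
  unfolding scalar_measure_def using sets.sigma_sets_eq[of "borel :: real measure"] by simp

lemma space_mu [simp]: "space (mu f) = UNIV"
  unfolding scalar_measure_def by (simp add: space_measure_of_conv)

text \<open>\<open>measure_of\<close> yields the zero measure unless its set function is a measure,
  so positivity and countable additivity must be checked before any value of \<open>mu f\<close> is
  known.\<close>

lemma emeasure_mu:
  assumes f: "f \<in> V" and B: "B \<in> sets borel"
  shows "emeasure (mu f) B = ennreal ((norm2 M (E B f))\<^sup>2)"
proof -
  have E_eq: "Re (inner2 M (E B f) f) = (norm2 M (E B f))\<^sup>2" if "B \<in> sets borel" for B
    using E_self[OF that f] by simp
  have sums: "(\<lambda>n. (norm2 M (E (C n) f))\<^sup>2) sums (norm2 M (E (\<Union>n. C n) f))\<^sup>2"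
    if C: "range C \<subseteq> sets borel" "disjoint_family C" for C :: "nat \<Rightarrow> real set"
  proof -
    have "(\<lambda>n. inner2 M (E (C n) f) f) sums inner2 M (E (\<Union>n. C n) f) f"
      using pvm f C by (auto simp: projection_valued_measure_def)
    then have "(\<lambda>n. Re (inner2 M (E (C n) f) f)) sums Re (inner2 M (E (\<Union>n. C n) f) f)"
      by (rule sums_Re)
    moreover have "C n \<in> sets borel" "(\<Union>n. C n) \<in> sets borel" for n using C by auto
    ultimately show ?thesis by (simp add: E_eq)
  qed
  have "emeasure (mu f) B = ennreal (Re (inner2 M (E B f) f))"
  proof (rule emeasure_measure_of)
    show "mu f = measure_of UNIV (sets borel) (\<lambda>B. ennreal (Re (inner2 M (E B f) f)))"
      by (simp add: scalar_measure_def)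
    \<comment> \<open>The empty set is its own countable disjoint union, so additivity makes a
      constant series summable, which forces the constant to be zero.\<close>
    have empty: "(norm2 M (E {} f))\<^sup>2 = 0"
    proof -
      have "(\<lambda>n::nat. (norm2 M (E {} f))\<^sup>2) sums (norm2 M (E (\<Union>n::nat. {}) f))\<^sup>2"
        by (rule sums) (auto simp: disjoint_family_on_def)
      then have "(\<lambda>n::nat. (norm2 M (E {} f))\<^sup>2) sums (norm2 M (E {} f))\<^sup>2"
        by (simp only: UN_empty2)
      then have "summable (\<lambda>n::nat. (norm2 M (E {} f))\<^sup>2)" by (rule sums_summable)
      then show ?thesis by (simp add: summable_const_iff)
    qed
    show "positive (sets (mu f)) (\<lambda>B. ennreal (Re (inner2 M (E B f) f)))"
      using empty by (simp add: positive_def E_eq)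
    show "countably_additive (sets (mu f)) (\<lambda>B. ennreal (Re (inner2 M (E B f) f)))"
    proof (rule countably_additiveI)
      fix C :: "nat \<Rightarrow> real set"
      assume C: "range C \<subseteq> sets (mu f)" "disjoint_family C" "\<Union> (range C) \<in> sets (mu f)"
      then have CB: "C n \<in> sets borel" "(\<Union>n. C n) \<in> sets borel" for n by auto
      have "(\<lambda>n. (norm2 M (E (C n) f))\<^sup>2) sums (norm2 M (E (\<Union>n. C n) f))\<^sup>2"
        using C by (intro sums) auto
      then have "(\<Sum>n. ennreal ((norm2 M (E (C n) f))\<^sup>2)) = ennreal ((norm2 M (E (\<Union>n. C n) f))\<^sup>2)"
        by (intro sums_unique[symmetric]) (simp only: sums_ennreal zero_le_power2)
      then show "(\<Sum>n. ennreal (Re (inner2 M (E (C n) f) f))) = ennreal (Re (inner2 M (E (\<Union> (range C)) f) f))"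
        by (simp only: E_eq[OF CB(1)] E_eq[OF CB(2)])
    qed
  qed (use B sets.space_closed[of "borel :: real measure"] in auto)
  then show ?thesis by (simp add: E_eq[OF B])
qed

lemma finite_mu: "f \<in> V \<Longrightarrow> finite_measure (mu f)"
  by (intro finite_measureI) (simp add: emeasure_mu)

lemma measure_mu: "f \<in> V \<Longrightarrow> B \<in> sets borel \<Longrightarrow> measure (mu f) B = (norm2 M (E B f))\<^sup>2"
  by (simp add: measure_def emeasure_mu)

lemma integral_indicator_mu:
  assumes "f \<in> V" "B \<in> sets borel"
  shows "(\<integral>s. indicator B s \<partial>mu f) = inner2 M (E B f) f"
proof -
  have "(\<integral>s. indicator B s \<partial>mu f) = (\<integral>s. complex_of_real (indicator B s) \<partial>mu f)"
    by (simp add: of_real_indicator)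
  also have "\<dots> = complex_of_real (measure (mu f) B)" by simp
  finally show ?thesis using assms by (simp add: measure_mu E_self)
qed

lemma V_shift: "f \<in> V \<Longrightarrow> k \<in> V \<Longrightarrow> (\<lambda>x. f x + c * k x) \<in> V"
  using subspace2_lincomb[OF V, of f k 1 c] by simp

lemma integrable_mu_bounded:
  "f \<in> V \<Longrightarrow> h \<in> borel_measurable borel \<Longrightarrow> (\<And>s. cmod (h s) \<le> C) \<Longrightarrow> integrable (mu f) h"
  by (rule integrable_bounded[OF finite_mu]) auto

text \<open>Expanding the quadratic form at \<open>f + c * k\<close> gives four terms; after
  weighting by \<open>c\<close> and averaging over the four powers \<open>c\<close> of
  \<open>\<i>\<close>, only the one with the factor \<open>cnj c\<close> survives.\<close>

lemma sI_indicator: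
  assumes f: "f \<in> V" and k: "k \<in> V" and B: "B \<in> sets borel"
  shows "sI (indicator B) f k = inner2 M (E B f) k"
proof -
  have pol: "(\<integral>s. indicator B s \<partial>mu (\<lambda>x. f x + c * k x)) =
      inner2 M (E B f) f + cnj c * inner2 M (E B f) k + c * inner2 M (E B k) f
        + c * cnj c * inner2 M (E B k) k" for c
  proof -
    have "eq_ae M (E B (\<lambda>x. 1 * f x + c * k x)) (\<lambda>x. 1 * E B f x + c * E B k x)"
      by (rule E_lincomb[OF B f k])
    then have "inner2 M (E B (\<lambda>x. f x + c * k x)) (\<lambda>x. f x + c * k x)
        = inner2 M (\<lambda>x. E B f x + c * E B k x) (\<lambda>x. f x + c * k x)"
      using f k B by (intro inner2_cong) (auto intro!: L2_add L2_scale E_in VL2 V_shift)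
    then show ?thesis
      using f k B by (simp add: integral_indicator_mu V_shift inner2_left inner2_right L2_intros
          E_L2 VL2 algebra_simps)
  qed
  show ?thesis
    unfolding spectral_integral_def pol
    by (simp add: eval_nat_numeral algebra_simps)
qed

lemma sI_scale: "sI (\<lambda>s. a * h s) f k = a * sI h f k"
  unfolding spectral_integral_def by (simp add: sum_distrib_left mult_ac)

lemma sI_diff:
  assumes "f \<in> V" "k \<in> V" "h \<in> borel_measurable borel" "\<And>s. cmod (h s) \<le> C"
    "h' \<in> borel_measurable borel" "\<And>s. cmod (h' s) \<le> C'"
  shows "sI (\<lambda>s. h s - h' s) f k = sI h f k - sI h' f k"
proof -
  have "integrable (mu (\<lambda>x. f x + c * k x)) h" "integrable (mu (\<lambda>x. f x + c * k x)) h'" for c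
    using assms by (auto intro: integrable_mu_bounded V_shift)
  then show ?thesis
    unfolding spectral_integral_def
    by (simp add: Bochner_Integration.integral_diff sum_subtractf right_diff_distrib diff_divide_distrib)
qed

lemma sI_sum:
  assumes "finite I" "f \<in> V" "k \<in> V" "\<And>i. i \<in> I \<Longrightarrow> h i \<in> borel_measurable borel"
    "\<And>i s. i \<in> I \<Longrightarrow> cmod (h i s) \<le> C i"
  shows "sI (\<lambda>s. \<Sum>i\<in>I. h i s) f k = (\<Sum>i\<in>I. sI (h i) f k)"
proof -
  have "integrable (mu (\<lambda>x. f x + c * k x)) (h i)" if "i \<in> I" for c i
    using assms that by (auto intro: integrable_mu_bounded V_shift)
  then have "(\<integral>s. (\<Sum>i\<in>I. h i s) \<partial>mu (\<lambda>x. f x + c * k x))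
      = (\<Sum>i\<in>I. \<integral>s. h i s \<partial>mu (\<lambda>x. f x + c * k x))" for c
    by (intro Bochner_Integration.integral_sum)
  then have "sI (\<lambda>s. \<Sum>i\<in>I. h i s) f k
      = (\<Sum>n<4. \<Sum>i\<in>I. \<i> ^ n * (\<integral>s. h i s \<partial>mu (\<lambda>x. f x + \<i> ^ n * k x))) / 4"
    unfolding spectral_integral_def by (simp only: sum_distrib_left)
  also have "\<dots> = (\<Sum>i\<in>I. sI (h i) f k)"
    unfolding spectral_integral_def by (subst sum.swap) (simp only: sum_divide_distrib)
  finally show ?thesis .
qed

lemma simple_op_in:
  "simple_function borel h \<Longrightarrow> f \<in> V \<Longrightarrow> simple_op E h f \<in> V"
  unfolding simple_op_def
  by (intro subspace2_sum[OF V] subspace2_scale[OF V] E_in simple_function_borelD)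

lemma inner_simple_op:
  assumes h: "simple_function borel h" and f: "f \<in> V" and k: "k \<in> L2 M"
  shows "inner2 M (simple_op E h f) k = (\<Sum>c\<in>range h. c * inner2 M (E (h -` {c}) f) k)"
  unfolding simple_op_def using f k simple_function_borelD(2)[OF h]
  by (simp add: inner2_left L2_scale E_L2)

lemma inner_simple_op_right:
  assumes h: "simple_function borel h" and f: "f \<in> V" and k: "k \<in> L2 M"
  shows "inner2 M k (simple_op E h f) = (\<Sum>c\<in>range h. cnj c * inner2 M k (E (h -` {c}) f))"
  unfolding simple_op_def using f k simple_function_borelD(2)[OF h]
  by (simp add: inner2_right L2_scale E_L2)

lemma sI_simple:
  assumes h: "simple_function borel h" and f: "f \<in> V" and k: "k \<in> V"
  shows "sI h f k = inner2 M (simple_op E h f) k"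
proof -
  note hD = simple_function_borelD[OF h]
  have "sI h f k = sI (\<lambda>s. \<Sum>c\<in>range h. c * indicator (h -` {c}) s) f k"
    by (intro arg_cong[of _ _ "\<lambda>h. sI h f k"] ext simple_function_rep h)
  also have "\<dots> = (\<Sum>c\<in>range h. c * sI (indicator (h -` {c})) f k)"
  proof -
    have "cmod (c * indicator (h -` {c}) s) \<le> cmod c" for c s by (auto simp: indicator_def)
    then show ?thesis using hD f k by (subst sI_sum[where C=cmod]) (auto simp: sI_scale)
  qed
  finally show ?thesis using h hD f k by (simp add: sI_indicator inner_simple_op VL2)
qed

lemma L2_mu_simple: "simple_function borel h \<Longrightarrow> f \<in> V \<Longrightarrow> h \<in> L2 (mu f)"
  using bounded_simple_function[of h] simple_function_borelD(3)[of h]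
  by (auto intro!: L2_bounded[OF finite_mu])

text \<open>Both squared norms expand into the same double sum over pairs of values, because the
  inner product of two spectral pieces of \<open>f\<close> is the mass that \<open>mu f\<close>
  gives to the intersection of the two sets.\<close>

lemma norm_simple_op:
  assumes h: "simple_function borel h" and f: "f \<in> V"
  shows "norm2 M (simple_op E h f) = norm2 (mu f) h"
proof -
  note hD = simple_function_borelD[OF h]
  have 1: "(\<integral>s. c * indicator (h -` {c}) s * cnj (d * indicator (h -` {d}) s) \<partial>mu f)
      = c * cnj d * inner2 M (E (h -` {c}) f) (E (h -` {d}) f)" for c d
  proof -
    have "(\<lambda>s. c * indicator (h -` {c}) s * cnj (d * indicator (h -` {d}) s))
        = (\<lambda>s. c * cnj d * indicator (h -` {c} \<inter> h -` {d}) s)"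
      by (auto simp: indicator_def)
    moreover have "inner2 M (E (h -` {c}) f) (E (h -` {d}) f) = inner2 M (E (h -` {c} \<inter> h -` {d}) f) f"
      using hD f by (intro E_inner_E)
    ultimately show ?thesis using hD f by (simp add: integral_indicator_mu)
  qed
  have int: "integrable (mu f) (\<lambda>s. c * indicator (h -` {c}) s * cnj (d * indicator (h -` {d}) s))" for c d
    using hD f by (intro integrable_mu_bounded[where C="cmod c * cmod d"])
      (auto simp: indicator_def norm_mult intro!: borel_measurable_times borel_measurable_cnj)
  have "inner2 (mu f) h h = (\<integral>s. (\<Sum>c\<in>range h. c * indicator (h -` {c}) s) *
      cnj (\<Sum>d\<in>range h. d * indicator (h -` {d}) s) \<partial>mu f)"
    unfolding inner2_def
    by (intro Bochner_Integration.integral_cong refl arg_cong2[of _ _ _ _ "\<lambda>a b. a * cnj b"]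
        simple_function_rep h)
  also have "\<dots> = (\<integral>s. (\<Sum>c\<in>range h. \<Sum>d\<in>range h.
      c * indicator (h -` {c}) s * cnj (d * indicator (h -` {d}) s)) \<partial>mu f)"
    by (simp only: cnj_sum sum_product)
  also have "\<dots> = (\<Sum>c\<in>range h. \<Sum>d\<in>range h. c * cnj d * inner2 M (E (h -` {c}) f) (E (h -` {d}) f))"
    using int 1 by (simp add: Bochner_Integration.integral_sum Bochner_Integration.integrable_sum)
  also have "\<dots> = (\<Sum>d\<in>range h. cnj d * (\<Sum>c\<in>range h. c * inner2 M (E (h -` {c}) f) (E (h -` {d}) f)))"
    by (subst sum.swap) (simp add: sum_distrib_left mult_ac)
  also have "\<dots> = inner2 M (simple_op E h f) (simple_op E h f)"
    using h f by (simp add: inner_simple_op simple_op_in VL2 inner_simple_op_right hD E_L2)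
  finally show ?thesis by (metis norm2_eq_inner2 norm2_nonneg power2_eq_iff_nonneg)
qed

text \<open>The bound uses the norm in \<open>L2 (mu f)\<close> alone, although \<open>sI\<close> is
  built from four other measures. For step functions it is Cauchy-Schwarz with
  \<open>norm_simple_op\<close>; the approximating step functions converge pointwise, so dominated
  convergence works for all four measures at once. The constant \<open>C\<close> serves only as
  majorant there.\<close>

lemma sI_bound:
  assumes f: "f \<in> V" and k: "k \<in> V" and h: "h \<in> borel_measurable borel" "\<And>s. cmod (h s) \<le> C"
  shows "cmod (sI h f k) \<le> norm2 (mu f) h * norm2 M k"
proof -
  have hL: "h \<in> L2 (mu f)" using h by (intro L2_bounded[OF finite_mu[OF f]]) auto
  obtain F where F: "\<And>n. simple_function (mu f) (F n)" "\<And>n. F n \<in> L2 (mu f)"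
    "\<And>n x. cmod (F n x) \<le> 2 * cmod (h x)" "\<And>x. (\<lambda>n. F n x) \<longlonglongrightarrow> h x"
    "(\<lambda>n. norm2 (mu f) (\<lambda>x. F n x - h x)) \<longlonglongrightarrow> 0"
    by (rule L2_simple_approx[OF hL], rule that) auto
  have Fs: "simple_function borel (F n)" for n
    using F(1)[of n] simple_function_cong_algebra[of "mu f" borel "F n"] by simp
  note [measurable] = simple_function_borelD(3)[OF Fs] h(1)
  have "(\<lambda>n. \<integral>s. F n s \<partial>mu (\<lambda>x. f x + c * k x)) \<longlonglongrightarrow> (\<integral>s. h s \<partial>mu (\<lambda>x. f x + c * k x))" for c
  proof (rule integral_dominated_convergence[where w="\<lambda>_. 2 * C"])
    interpret finite_measure "mu (\<lambda>x. f x + c * k x)" using f k by (intro finite_mu V_shift)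
    show "integrable (mu (\<lambda>x. f x + c * k x)) (\<lambda>_. 2 * C)" by simp
    show "AE s in mu (\<lambda>x. f x + c * k x). norm (F n s) \<le> 2 * C" for n
      using F(3) h(2) by (intro AE_I2) (smt (verit))
  qed (use F(4) in auto)
  then have "(\<lambda>n. sI (F n) f k) \<longlonglongrightarrow> sI h f k"
    unfolding spectral_integral_def by (intro tendsto_intros) auto
  then have 1: "(\<lambda>n. cmod (sI (F n) f k)) \<longlonglongrightarrow> cmod (sI h f k)" by (rule tendsto_norm)
  have 2: "(\<lambda>n. (norm2 (mu f) (\<lambda>x. F n x - h x) + norm2 (mu f) h) * norm2 M k)
      \<longlonglongrightarrow> (0 + norm2 (mu f) h) * norm2 M k"
    by (intro tendsto_intros F(5))
  have "cmod (sI (F n) f k) \<le> (norm2 (mu f) (\<lambda>x. F n x - h x) + norm2 (mu f) h) * norm2 M k" for n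
  proof -
    have "cmod (sI (F n) f k) \<le> norm2 (mu f) (F n) * norm2 M k"
      using cauchy_schwarz2[of "simple_op E (F n) f" M k] f k Fs[of n]
      by (simp add: sI_simple norm_simple_op VL2 simple_op_in)
    also have "\<dots> \<le> (norm2 (mu f) (\<lambda>x. F n x - h x) + norm2 (mu f) h) * norm2 M k"
      using norm2_triangle[OF L2_diff[OF F(2) hL] hL, of n] by (intro mult_right_mono) auto
    finally show ?thesis .
  qed
  then have "cmod (sI h f k) \<le> (0 + norm2 (mu f) h) * norm2 M k"
    by (intro LIMSEQ_le[OF 1 2]) auto
  then show ?thesis by simp
qed

lemma fun_calc_L2: "fun_calc M V E h f g \<Longrightarrow> h \<in> L2 (mu f)"
  by (auto simp: fun_calc_def L2_def)

text \<open>This turns the weak description of \<open>g\<close>, a limit of truncated spectral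
  integrals, into a norm estimate. The weak limit is tested on the difference
  \<open>k = g - simple_op E h' f\<close> itself: \<open>sI_bound\<close> then gives
  \<open>norm2 M k\<close> squared at most \<open>norm2 M k\<close> times the claimed bound.\<close>

lemma fun_calc_approx:
  assumes fc: "fun_calc M V E h f g" and h': "simple_function borel h'"
  shows "norm2 M (\<lambda>x. g x - simple_op E h' f x) \<le> norm2 (mu f) (\<lambda>s. h s - h' s)"
proof -
  have f: "f \<in> V" and g: "g \<in> V" and [measurable]: "h \<in> borel_measurable borel"
    and lim: "\<And>k. k \<in> V \<Longrightarrow> (\<lambda>n. sI (truncate_at n h) f k) \<longlonglongrightarrow> inner2 M g k"
    using fc by (auto simp: fun_calc_def)
  have hL: "h \<in> L2 (mu f)" by (rule fun_calc_L2[OF fc])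
  have h'L: "h' \<in> L2 (mu f)" by (rule L2_mu_simple[OF h' f])
  note hh = L2_diff[OF hL h'L]
  note [measurable] = simple_function_borelD(3)[OF h']
  obtain C' where C': "\<And>s. cmod (h' s) \<le> C'" using bounded_simple_function[OF h'] by auto
  have [measurable]: "truncate_at n h \<in> borel_measurable borel" for n
    unfolding truncate_at_def by measurable
  have tb: "cmod (truncate_at n h s) \<le> real n" for n s by (simp add: truncate_at_def)
  define k where "k = (\<lambda>x. g x - simple_op E h' f x)"
  have k: "k \<in> V" unfolding k_def by (intro subspace2_diff[OF V] g simple_op_in h' f)
  have "(\<lambda>n. sI (\<lambda>s. truncate_at n h s - h' s) f k) \<longlonglongrightarrow> inner2 M g k - inner2 M (simple_op E h' f) k"
    using tendsto_diff[OF lim[OF k] tendsto_const[of "sI h' f k"]]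
    by (subst sI_diff[OF f k _ tb _ C']) (auto simp: sI_simple h' f k)
  moreover have "inner2 M g k - inner2 M (simple_op E h' f) k = complex_of_real ((norm2 M k)\<^sup>2)"
    using g f h' k by (simp add: k_def inner2_diff_left[symmetric] VL2 simple_op_in inner2_self
        L2_diff)
  ultimately have "(\<lambda>n. sI (\<lambda>s. truncate_at n h s - h' s) f k) \<longlonglongrightarrow> complex_of_real ((norm2 M k)\<^sup>2)"
    by simp
  from tendsto_norm[OF this]
  have 1: "(\<lambda>n. cmod (sI (\<lambda>s. truncate_at n h s - h' s) f k)) \<longlonglongrightarrow> (norm2 M k)\<^sup>2"
    by (simp add: norm_power)
  have trunc_lim: "(\<lambda>n. truncate_at n h s) \<longlonglongrightarrow> h s" for s
  proof (rule tendsto_eventually)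
    obtain m :: nat where "cmod (h s) \<le> real m" using real_arch_simple by blast
    then show "\<forall>\<^sub>F n in sequentially. truncate_at n h s = h s"
      by (intro eventually_sequentiallyI[of m]) (auto simp: truncate_at_def)
  qed
  have "(\<lambda>n. \<integral>s. (cmod (truncate_at n h s - h' s))\<^sup>2 \<partial>mu f) \<longlonglongrightarrow> (\<integral>s. (cmod (h s - h' s))\<^sup>2 \<partial>mu f)"
  proof (rule integral_dominated_convergence)
    \<comment> \<open>A truncation equals \<open>h s\<close> or \<open>0\<close>, so its difference
      from \<open>h' s\<close> is dominated by one of the two summands.\<close>
    show "integrable (mu f) (\<lambda>s. (cmod (h s - h' s))\<^sup>2 + (cmod (h' s))\<^sup>2)"
      using L2_integrable[OF hh] L2_integrable[OF h'L] by auto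
    show "AE s in mu f. (\<lambda>n. (cmod (truncate_at n h s - h' s))\<^sup>2) \<longlonglongrightarrow> (cmod (h s - h' s))\<^sup>2"
      by (intro AE_I2 tendsto_intros trunc_lim)
    show "AE s in mu f. norm ((cmod (truncate_at n h s - h' s))\<^sup>2)
        \<le> (cmod (h s - h' s))\<^sup>2 + (cmod (h' s))\<^sup>2" for n
      by (intro AE_I2) (simp add: truncate_at_def)
  qed auto
  then have 2: "(\<lambda>n. norm2 (mu f) (\<lambda>s. truncate_at n h s - h' s)) \<longlonglongrightarrow> norm2 (mu f) (\<lambda>s. h s - h' s)"
    unfolding norm2_def by (rule tendsto_real_sqrt)
  have "cmod (sI (\<lambda>s. truncate_at n h s - h' s) f k)
      \<le> norm2 (mu f) (\<lambda>s. truncate_at n h s - h' s) * norm2 M k" for n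
  proof (rule sI_bound[OF f k])
    show "cmod (truncate_at n h s - h' s) \<le> real n + C'" for s
      using norm_triangle_ineq4[of "truncate_at n h s" "h' s"] tb[of n s] C'[of s] by linarith
  qed measurable
  then have "(norm2 M k)\<^sup>2 \<le> norm2 (mu f) (\<lambda>s. h s - h' s) * norm2 M k"
    by (intro LIMSEQ_le[OF 1 tendsto_mult[OF 2 tendsto_const]]) auto
  then have "norm2 M k \<le> norm2 (mu f) (\<lambda>s. h s - h' s)"
    by (cases "norm2 M k = 0") (auto simp: power2_eq_square less_le)
  then show ?thesis by (simp add: k_def)
qed

text \<open>\<open>g = h(T) f\<close>, for functions \<open>h\<close> that are merely integrable with respect to \<open>mu f\<close>: the last
  condition says that \<open>g\<close> is in the closed cyclic subspace generated by \<open>f\<close>.\<close>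

definition cal :: "(real \<Rightarrow> complex) \<Rightarrow> ('a \<Rightarrow> complex) \<Rightarrow> ('a \<Rightarrow> complex) \<Rightarrow> bool" where
  "cal h f g \<longleftrightarrow> f \<in> V \<and> g \<in> V \<and> integrable (mu f) h \<and>
     (\<forall>B\<in>sets borel. inner2 M g (E B f) = (\<integral>s. h s * indicator B s \<partial>mu f)) \<and>
     (\<forall>k\<in>V. (\<forall>B\<in>sets borel. inner2 M k (E B f) = 0) \<longrightarrow> inner2 M k g = 0)"

lemma fun_calc_seq:
  assumes fc: "fun_calc M V E h f g"
  obtains F where "\<And>n. simple_function borel (F n)" "\<And>n. F n \<in> L2 (mu f)"
    "\<And>n s. cmod (F n s) \<le> 2 * cmod (h s)" "\<And>s. (\<lambda>n. F n s) \<longlonglongrightarrow> h s"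
    "(\<lambda>n. norm2 (mu f) (\<lambda>s. F n s - h s)) \<longlonglongrightarrow> 0"
    "(\<lambda>n. norm2 M (\<lambda>x. simple_op E (F n) f x - g x)) \<longlonglongrightarrow> 0"
proof -
  obtain F where F: "\<And>n. simple_function (mu f) (F n)" "\<And>n. F n \<in> L2 (mu f)"
    "\<And>n x. cmod (F n x) \<le> 2 * cmod (h x)" "\<And>x. (\<lambda>n. F n x) \<longlonglongrightarrow> h x"
    "(\<lambda>n. norm2 (mu f) (\<lambda>x. F n x - h x)) \<longlonglongrightarrow> 0"
    by (rule L2_simple_approx[OF fun_calc_L2[OF fc]], rule that) auto
  have Fs: "simple_function borel (F n)" for n
    using F(1)[of n] simple_function_cong_algebra[of "mu f" borel "F n"] by simp
  have "(\<lambda>n. norm2 M (\<lambda>x. simple_op E (F n) f x - g x)) \<longlonglongrightarrow> 0"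
  proof (rule Lim_null_comparison[OF _ F(5)], intro always_eventually allI)
    show "norm (norm2 M (\<lambda>x. simple_op E (F n) f x - g x)) \<le> norm2 (mu f) (\<lambda>x. F n x - h x)" for n
      using fun_calc_approx[OF fc Fs, of n] norm2_minus_commute[of M g] norm2_minus_commute[of "mu f" h]
      by simp
  qed
  with F Fs show thesis by (intro that[of F]) auto
qed

text \<open>The rule that \<open>\<phi>(T)\<close> applied to \<open>h(T) f\<close> is
  \<open>(\<phi> h)(T) f\<close>. Only the product must be integrable, so an unbounded factor may
  cancel against its reciprocal. For a step function in place of \<open>\<phi>\<close>, its level
  sets are moved by symmetry of \<open>E\<close> onto the test vector \<open>E B f\<close>, where
  \<open>cal h f g\<close> evaluates the inner product.\<close>

lemma fun_calc_compose:
  assumes c: "cal h f g" and fc: "fun_calc M V E \<phi> g w" and int: "integrable (mu f) (\<lambda>s. \<phi> s * h s)"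
  shows "cal (\<lambda>s. \<phi> s * h s) f w"
proof -
  have V: "f \<in> V" "g \<in> V" "w \<in> V" and ih [measurable]: "integrable (mu f) h"
    using c fc by (auto simp: cal_def fun_calc_def)
  have [measurable]: "\<phi> \<in> borel_measurable borel" using fc by (simp add: fun_calc_def)
  have c1: "inner2 M g (E B f) = (\<integral>s. h s * indicator B s \<partial>mu f)" if "B \<in> sets borel" for B
    using c that by (simp add: cal_def)
  have c2: "inner2 M k g = 0" if "k \<in> V" "\<And>B. B \<in> sets borel \<Longrightarrow> inner2 M k (E B f) = 0" for k
    using c that by (simp add: cal_def)
  obtain F where F: "\<And>n. simple_function borel (F n)" "\<And>n. F n \<in> L2 (mu g)"
    "\<And>n s. cmod (F n s) \<le> 2 * cmod (\<phi> s)" "\<And>s. (\<lambda>n. F n s) \<longlonglongrightarrow> \<phi> s"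
    "(\<lambda>n. norm2 (mu g) (\<lambda>s. F n s - \<phi> s)) \<longlonglongrightarrow> 0"
    "(\<lambda>n. norm2 M (\<lambda>x. simple_op E (F n) g x - w x)) \<longlonglongrightarrow> 0"
    using fun_calc_seq[OF fc] by blast
  note [measurable] = simple_function_borelD(3)[OF F(1)]
  have lim: "(\<lambda>n. inner2 M (simple_op E (F n) g) k) \<longlonglongrightarrow> inner2 M w k" if "k \<in> V" for k
    using F V that by (intro tendsto_inner2) (auto intro: VL2 simple_op_in)
  have "inner2 M w (E B f) = (\<integral>s. \<phi> s * h s * indicator B s \<partial>mu f)" if B [measurable]: "B \<in> sets borel" for B
  proof (rule LIMSEQ_unique[OF lim])
    show "E B f \<in> V" by (intro E_in B V)
    have "inner2 M (simple_op E (F n) g) (E B f) = (\<integral>s. F n s * h s * indicator B s \<partial>mu f)" for n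
    proof -
      note FD = simple_function_borelD[OF F(1)[of n]]
      have "inner2 M (simple_op E (F n) g) (E B f) = (\<Sum>c\<in>range (F n). c * inner2 M (E (F n -` {c}) g) (E B f))"
        using F(1) V B by (intro inner_simple_op E_L2)
      also have "\<dots> = (\<Sum>c\<in>range (F n). c * (\<integral>s. h s * indicator (F n -` {c} \<inter> B) s \<partial>mu f))"
      proof (intro sum.cong refl, rule arg_cong[of _ _ "(*) _"])
        fix c
        have "inner2 M (E (F n -` {c}) g) (E B f) = inner2 M g (E (F n -` {c}) (E B f))"
          using FD V B by (intro E_adj E_in)
        also have "\<dots> = inner2 M g (E (F n -` {c} \<inter> B) f)"
          using FD V B by (intro inner2_cong eq_ae_refl eq_ae_sym[OF E_Int] VL2 E_in) auto
        finally show "inner2 M (E (F n -` {c}) g) (E B f) = (\<integral>s. h s * indicator (F n -` {c} \<inter> B) s \<partial>mu f)"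
          using FD B by (simp add: c1)
      qed
      also have "\<dots> = (\<integral>s. (\<Sum>c\<in>range (F n). c * (h s * indicator (F n -` {c} \<inter> B) s)) \<partial>mu f)"
      proof -
        have "integrable (mu f) (\<lambda>s. c * (h s * indicator (F n -` {c} \<inter> B) s))" for c
          using FD B ih by (intro integrable_mult_right Bochner_Integration.integrable_bound[OF ih])
            (auto simp: indicator_def intro!: borel_measurable_times)
        then show ?thesis by (subst Bochner_Integration.integral_sum) auto
      qed
      also have "\<dots> = (\<integral>s. F n s * h s * indicator B s \<partial>mu f)"
      proof (intro Bochner_Integration.integral_cong refl)
        fix s
        have "(\<Sum>c\<in>range (F n). c * (h s * indicator (F n -` {c} \<inter> B) s))
            = (\<Sum>c\<in>range (F n). c * indicator (F n -` {c}) s) * (h s * indicator B s)"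
          by (simp add: sum_distrib_right sum_distrib_left indicator_inter_arith mult_ac)
        also have "(\<Sum>c\<in>range (F n). c * indicator (F n -` {c}) s) = F n s"
          by (rule simple_function_rep[OF F(1), symmetric])
        finally show "(\<Sum>c\<in>range (F n). c * (h s * indicator (F n -` {c} \<inter> B) s)) = F n s * h s * indicator B s"
          by (simp add: mult_ac)
      qed
      finally show ?thesis .
    qed
    moreover have "(\<lambda>n. \<integral>s. F n s * h s * indicator B s \<partial>mu f) \<longlonglongrightarrow> (\<integral>s. \<phi> s * h s * indicator B s \<partial>mu f)"
    proof (rule integral_dominated_convergence)
      show "integrable (mu f) (\<lambda>s. 2 * cmod (\<phi> s * h s))" using int by auto
      show "AE s in mu f. (\<lambda>n. F n s * h s * indicator B s) \<longlonglongrightarrow> \<phi> s * h s * indicator B s"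
        by (intro AE_I2 tendsto_intros F)
      show "AE s in mu f. norm (F n s * h s * indicator B s) \<le> 2 * cmod (\<phi> s * h s)" for n
      proof (intro AE_I2)
        fix s
        have "cmod (F n s) * cmod (h s) \<le> 2 * cmod (\<phi> s) * cmod (h s)"
          by (intro mult_right_mono F) auto
        then show "norm (F n s * h s * indicator B s) \<le> 2 * cmod (\<phi> s * h s)"
          by (auto simp: norm_mult indicator_def)
      qed
    qed measurable
    ultimately show "(\<lambda>n. inner2 M (simple_op E (F n) g) (E B f)) \<longlonglongrightarrow> (\<integral>s. \<phi> s * h s * indicator B s \<partial>mu f)"
      by simp
  qed
  \<comment> \<open>If \<open>k\<close> is orthogonal to all \<open>E B f\<close>, so are all
    \<open>E B k\<close>. These are then orthogonal to \<open>g\<close>, which makes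
    \<open>k\<close> orthogonal to every \<open>E B g\<close>, and \<open>w\<close> is a limit of
    combinations of the latter.\<close>
  moreover have "inner2 M k w = 0" if k: "k \<in> V" "\<forall>B\<in>sets borel. inner2 M k (E B f) = 0" for k
  proof -
    have "inner2 M k (E B g) = 0" if B: "B \<in> sets borel" for B
    proof -
      have "inner2 M (E B k) (E C f) = 0" if C: "C \<in> sets borel" for C
      proof -
        have "inner2 M (E B k) (E C f) = inner2 M k (E B (E C f))"
          using k B C V by (intro E_adj E_in)
        also have "\<dots> = inner2 M k (E (B \<inter> C) f)"
          using k B C V by (intro inner2_cong eq_ae_refl eq_ae_sym[OF E_Int] VL2 E_in) auto
        also have "\<dots> = 0" using k B C by auto
        finally show ?thesis .
      qed
      then have "inner2 M (E B k) g = 0" using c2[of "E B k"] k B by (auto intro: E_in)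
      then show ?thesis using E_adj[OF B k(1) V(2)] by simp
    qed
    then have "inner2 M k (simple_op E (F n) g) = 0" for n
      using inner_simple_op_right[OF F(1) V(2) VL2[OF k(1)]] simple_function_borelD(2)[OF F(1)] by simp
    then have "inner2 M (simple_op E (F n) g) k = 0" for n by (metis inner2_cnj complex_cnj_zero)
    with lim[OF k(1)] have "inner2 M w k = 0" by (simp add: LIMSEQ_const_iff)
    then show ?thesis by (metis inner2_cnj complex_cnj_zero)
  qed
  ultimately show ?thesis using V int by (simp add: cal_def)
qed

lemma cal_one:
  assumes f: "f \<in> V"
  shows "cal (\<lambda>s. 1) f f"
proof -
  have "inner2 M f (E B f) = (\<integral>s. indicator B s \<partial>mu f)" if "B \<in> sets borel" for B
    using that f by (simp add: integral_indicator_mu E_adj)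
  moreover have "inner2 M k f = 0" if k: "k \<in> V" "\<forall>B\<in>sets borel. inner2 M k (E B f) = 0" for k
  proof -
    have "inner2 M k f = inner2 M k (E UNIV f)"
      using k f by (intro inner2_cong eq_ae_refl eq_ae_sym[OF E_UNIV] VL2 E_in) auto
    then show ?thesis using k by simp
  qed
  ultimately show ?thesis
    using f finite_mu[OF f] by (auto simp: cal_def finite_measure.integrable_const)
qed

lemma fun_calc_cal:
  assumes fc: "fun_calc M V E h f g"
  shows "cal h f g"
proof -
  have f: "f \<in> V" and [measurable]: "h \<in> borel_measurable borel"
    using fc by (auto simp: fun_calc_def)
  interpret mu: finite_measure "mu f" by (rule finite_mu[OF f])
  have "integrable (mu f) (\<lambda>s. h s * cnj 1)"
    using fun_calc_L2[OF fc] by (intro integrable_inner2) (auto simp: L2_def)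
  then show ?thesis using fun_calc_compose[OF cal_one[OF f] fc] by simp
qed

text \<open>By the integral condition the difference is orthogonal to every \<open>E B f\<close>; by
  the last condition of \<open>cal\<close> it is then orthogonal to \<open>g\<close> and to
  \<open>g'\<close>, hence to itself.\<close>

lemma cal_unique:
  assumes c: "cal h f g" "cal h' f g'" and eq: "AE s in mu f. h s = h' s"
  shows "eq_ae M g g'"
proof -
  have Vs: "f \<in> V" "g \<in> V" "g' \<in> V"
    and [measurable]: "h \<in> borel_measurable (mu f)" "h' \<in> borel_measurable (mu f)"
    using c by (auto simp: cal_def)
  define d where "d = (\<lambda>x. g x - g' x)"
  have d: "d \<in> V" unfolding d_def by (intro subspace2_diff[OF V] Vs)
  have "inner2 M d (E B f) = 0" if B [measurable]: "B \<in> sets borel" for B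
  proof -
    have "(\<integral>s. h s * indicator B s \<partial>mu f) = (\<integral>s. h' s * indicator B s \<partial>mu f)"
      using eq by (intro integral_cong_AE) auto
    then show ?thesis
      unfolding d_def using c B Vs by (simp add: inner2_diff_left VL2 E_L2 cal_def)
  qed
  then have "inner2 M d g = 0" "inner2 M d g' = 0" using c d by (auto simp: cal_def)
  then have "inner2 M d d = 0" using Vs d by (simp add: d_def inner2_right VL2)
  then have "norm2 M d = 0" by (simp add: inner2_self)
  then show ?thesis using eq_ae_iff_norm2_diff[of g M g'] Vs VL2 by (simp add: d_def)
qed

lemma cal_inner:
  assumes c: "cal h f g"
  shows "inner2 M g f = (\<integral>s. h s \<partial>mu f)"
proof -
  have V: "f \<in> V" "g \<in> V" using c by (auto simp: cal_def)
  have "inner2 M g f = inner2 M g (E UNIV f)"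
    using V by (intro inner2_cong eq_ae_refl eq_ae_sym[OF E_UNIV] VL2 E_in) auto
  then show ?thesis using c by (simp add: cal_def)
qed

text \<open>Only \<open>h'\<close> is approximated by step functions; for \<open>g\<close> the
  relation \<open>cal\<close> already supplies the inner products with all spectral pieces of
  \<open>f\<close>.\<close>

lemma fun_calc_isometry:
  assumes g: "fun_calc M V E h f g" and g': "fun_calc M V E h' f g'"
  shows "inner2 M g g' = inner2 (mu f) h h'"
proof -
  have V: "f \<in> V" "g \<in> V" "g' \<in> V" using g g' by (auto simp: fun_calc_def)
  note [measurable] = fun_calc_borel[OF g]
  obtain F where F: "\<And>n. simple_function borel (F n)" "\<And>n. F n \<in> L2 (mu f)"
    "\<And>n s. cmod (F n s) \<le> 2 * cmod (h' s)" "\<And>s. (\<lambda>n. F n s) \<longlonglongrightarrow> h' s"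
    "(\<lambda>n. norm2 (mu f) (\<lambda>s. F n s - h' s)) \<longlonglongrightarrow> 0"
    "(\<lambda>n. norm2 M (\<lambda>x. simple_op E (F n) f x - g' x)) \<longlonglongrightarrow> 0"
    using fun_calc_seq[OF g'] by blast
  have "inner2 M (simple_op E (F n) f) g = inner2 (mu f) (F n) h" for n
  proof -
    note FD = simple_function_borelD[OF F(1)[of n]]
    have ih: "integrable (mu f) h" using fun_calc_cal[OF g] by (simp add: cal_def)
    have int: "integrable (mu f) (\<lambda>s. cnj c * (h s * indicator (F n -` {c}) s))" for c
      using FD ih by (intro integrable_mult_right Bochner_Integration.integrable_bound[OF ih])
        (auto simp: indicator_def intro!: borel_measurable_times)
    have "inner2 M g (simple_op E (F n) f) = (\<Sum>c\<in>range (F n). cnj c * inner2 M g (E (F n -` {c}) f))"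
      using F(1) V by (intro inner_simple_op_right VL2)
    also have "\<dots> = (\<Sum>c\<in>range (F n). \<integral>s. cnj c * (h s * indicator (F n -` {c}) s) \<partial>mu f)"
      using fun_calc_cal[OF g] FD by (simp add: cal_def)
    also have "\<dots> = (\<integral>s. (\<Sum>c\<in>range (F n). cnj c * (h s * indicator (F n -` {c}) s)) \<partial>mu f)"
      using int by (subst Bochner_Integration.integral_sum) auto
    also have "\<dots> = (\<integral>s. h s * cnj (F n s) \<partial>mu f)"
    proof (intro Bochner_Integration.integral_cong refl)
      fix s
      have "(\<Sum>c\<in>range (F n). cnj c * (h s * indicator (F n -` {c}) s))
          = h s * cnj (\<Sum>c\<in>range (F n). c * indicator (F n -` {c}) s)"
        by (simp add: sum_distrib_left mult_ac) (auto intro!: sum.cong simp: indicator_def)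
      then show "(\<Sum>c\<in>range (F n). cnj c * (h s * indicator (F n -` {c}) s)) = h s * cnj (F n s)"
        by (simp only: simple_function_rep[OF F(1), of n s, symmetric])
    qed
    finally have "inner2 M g (simple_op E (F n) f) = inner2 (mu f) h (F n)" by (simp add: inner2_def)
    then show ?thesis by (metis inner2_cnj)
  qed
  moreover have "(\<lambda>n. inner2 M (simple_op E (F n) f) g) \<longlonglongrightarrow> inner2 M g' g"
    using F V by (intro tendsto_inner2) (auto intro: VL2 simple_op_in)
  moreover have "(\<lambda>n. inner2 (mu f) (F n) h) \<longlonglongrightarrow> inner2 (mu f) h' h"
    using F fun_calc_L2[OF g] fun_calc_L2[OF g'] by (intro tendsto_inner2) auto
  ultimately have "inner2 M g' g = inner2 (mu f) h' h" using LIMSEQ_unique by simp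
  then show ?thesis by (metis inner2_cnj)
qed

end

section \<open>The circle and the Hardy space\<close>

text \<open>\<open>adjoint2\<close> is a choice, so its properties become available only once some
  adjoint \<open>T'\<close> has been exhibited.\<close>

lemma adjoint2_props:
  assumes "\<And>g. g \<in> W \<Longrightarrow> T' g \<in> V" "\<And>f g. f \<in> V \<Longrightarrow> g \<in> W \<Longrightarrow> inner2 N (T f) g = inner2 M f (T' g)"
  shows "g \<in> W \<Longrightarrow> adjoint2 M V N W T g \<in> V"
    "f \<in> V \<Longrightarrow> g \<in> W \<Longrightarrow> inner2 N (T f) g = inner2 M f (adjoint2 M V N W T g)"
proof -
  have "(\<forall>g\<in>W. adjoint2 M V N W T g \<in> V) \<and>
      (\<forall>f\<in>V. \<forall>g\<in>W. inner2 N (T f) g = inner2 M f (adjoint2 M V N W T g))"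
    unfolding adjoint2_def by (rule someI[of _ T']) (use assms in auto)
  then show "g \<in> W \<Longrightarrow> adjoint2 M V N W T g \<in> V"
    "f \<in> V \<Longrightarrow> g \<in> W \<Longrightarrow> inner2 N (T f) g = inner2 M f (adjoint2 M V N W T g)"
    by auto
qed

section \<open>Normalized arc length and Fourier coefficients\<close>

lemma uniform_measure_circle:
  "uniform_measure lborel {0..2*pi} = density lborel (\<lambda>t. ennreal (indicator {0..2*pi} t / (2*pi)))"
proof -
  have "indicator {0..2*pi} t / ennreal (2*pi) = ennreal (indicator {0..2*pi} t / (2*pi))" for t :: real
    by (auto simp: indicator_def divide_ennreal[symmetric] ennreal_1[symmetric] simp del: ennreal_1)
  then show ?thesis by (simp add: uniform_measure_def)
qed

lemma sets_circ [simp, measurable_cong]: "sets circ = sets borel"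
  by (simp add: circ_def)

lemma space_circ [simp]: "space circ = UNIV"
  by (simp add: circ_def)

lemma measurable_cis [measurable]: "cis \<in> borel_measurable borel"
  by (intro borel_measurable_continuous_onI continuous_intros)

lemma emeasure_circ_UNIV [simp]: "emeasure circ UNIV = 1"
proof -
  have "emeasure circ UNIV = emeasure (uniform_measure lborel {0..2*pi}) UNIV"
    unfolding circ_def by (subst emeasure_distr) auto
  also have "\<dots> = 1"
    by (subst emeasure_uniform_measure) (auto simp: divide_ennreal)
  finally show ?thesis .
qed

lemma finite_measure_circ [simp]: "finite_measure circ"
  by (intro finite_measureI) simp

lemma AE_circ: "AE z in circ. cmod z = 1"
  unfolding circ_def by (subst AE_distr_iff) auto

lemma AE_circI: "(\<And>z. cmod z = 1 \<Longrightarrow> P z) \<Longrightarrow> AE z in circ. P z"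
  using AE_circ by (rule AE_mp) auto

lemma integral_circ_cong:
  fixes f :: "complex \<Rightarrow> 'b::{banach, second_countable_topology}"
  assumes "f \<in> borel_measurable circ" "g \<in> borel_measurable circ" "\<And>z. cmod z = 1 \<Longrightarrow> f z = g z"
  shows "(\<integral>z. f z \<partial>circ) = (\<integral>z. g z \<partial>circ)"
  using assms by (intro integral_cong_AE AE_circI) auto

lemma integral_circ:
  fixes f :: "complex \<Rightarrow> complex"
  assumes [measurable]: "f \<in> borel_measurable borel"
  shows "(\<integral>z. f z \<partial>circ) = (\<integral>t. indicator {0..2*pi} t *\<^sub>R f (cis t) \<partial>lborel) / (2*pi)"
proof -
  have "(\<integral>z. f z \<partial>circ) = (\<integral>t. f (cis t) \<partial>uniform_measure lborel {0..2*pi})"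
    unfolding circ_def by (rule integral_distr) auto
  also have "\<dots> = (\<integral>t. (indicator {0..2*pi} t / (2*pi)) *\<^sub>R f (cis t) \<partial>lborel)"
    unfolding uniform_measure_circle by (rule integral_density) auto
  also have "\<dots> = (\<integral>t. (indicator {0..2*pi} t *\<^sub>R f (cis t)) / (2*pi) \<partial>lborel)"
    by (intro Bochner_Integration.integral_cong) (auto simp: scaleR_conv_of_real)
  finally show ?thesis by simp
qed

lemma measurable_powi [measurable]: "(\<lambda>z::complex. z powi n) \<in> borel_measurable borel"
  unfolding power_int_def by (cases "0 \<le> n") auto

lemma integral_circ_powi: "(\<integral>z. z powi n \<partial>circ) = (if n = 0 then 1 else 0)"
proof (cases "n = 0")
  case True
  have "measure circ UNIV = 1" by (simp add: measure_def)
  then show ?thesis using True by simp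
next
  case False
  define F where "F t = cis (real_of_int n * t) / (\<i> * of_int n)" for t
  have "(\<integral>t. indicator {0..2*pi} t *\<^sub>R (cis t powi n) \<partial>lborel) = F (2*pi) - F 0"
  proof (rule integral_FTC_atLeastAtMost)
    fix t :: real
    have "((\<lambda>t. cis (real_of_int n * t)) has_derivative
        (\<lambda>s. (real_of_int n * s) *\<^sub>R (\<i> * cis (real_of_int n * t)))) (at t within {0..2*pi})"
      by (intro has_derivative_cis has_derivative_mult_right has_derivative_ident)
    then have "((\<lambda>t. cis (real_of_int n * t)) has_vector_derivative
        (real_of_int n *\<^sub>R (\<i> * cis (real_of_int n * t)))) (at t within {0..2*pi})"
      by (simp add: has_vector_derivative_def mult.commute)
    then have "(F has_vector_derivative (real_of_int n *\<^sub>R (\<i> * cis (real_of_int n * t))) / (\<i> * of_int n))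
        (at t within {0..2*pi})"
      unfolding F_def by (rule has_vector_derivative_divide)
    then show "(F has_vector_derivative cis t powi n) (at t within {0..2*pi})"
      using False by (simp add: cis_power_int scaleR_conv_of_real)
  qed (auto simp: cis_power_int intro!: continuous_intros)
  moreover have "F (2*pi) = F 0"
    using cis_multiple_2pi[of "of_int n"] by (simp add: F_def mult_ac)
  ultimately show ?thesis
    using False by (simp add: integral_circ)
qed

lemma circ_L2_bounded:
  assumes [measurable]: "f \<in> borel_measurable borel" and "\<And>z. cmod z = 1 \<Longrightarrow> cmod (f z) \<le> C"
  shows "f \<in> L2 circ"
proof -
  interpret finite_measure circ by simp
  have "integrable circ (\<lambda>z. (cmod (f z))\<^sup>2)"
    using assms(2) by (intro integrable_const_bound[where B="C\<^sup>2"] AE_circI) (auto intro!: power_mono)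
  then show ?thesis by (simp add: L2_def)
qed

lemma circ_L2_mult:
  assumes [measurable]: "g \<in> borel_measurable borel" and g: "\<And>z. cmod z = 1 \<Longrightarrow> cmod (g z) \<le> C"
    and f: "f \<in> L2 circ"
  shows "(\<lambda>z. g z * f z) \<in> L2 circ"
proof -
  have [measurable]: "f \<in> borel_measurable borel" using L2_measurable[OF f] by simp
  have "integrable circ (\<lambda>z. C\<^sup>2 * (cmod (f z))\<^sup>2)" using L2_integrable[OF f] by simp
  then have "integrable circ (\<lambda>z. (cmod (g z * f z))\<^sup>2)"
  proof (rule Bochner_Integration.integrable_bound)
    show "AE z in circ. norm ((cmod (g z * f z))\<^sup>2) \<le> norm (C\<^sup>2 * (cmod (f z))\<^sup>2)"
      using g by (intro AE_circI) (auto simp: norm_mult power_mult_distrib intro!: mult_right_mono power_mono)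
  qed simp
  then show ?thesis by (simp add: L2_def)
qed

lemma powi_L2 [simp]: "(\<lambda>z. z powi n) \<in> L2 circ"
  by (rule circ_L2_bounded[where C=1]) (auto simp: norm_power_int)

lemma poly_L2 [simp]: "poly p \<in> L2 circ"
proof -
  have "bounded (poly p ` sphere 0 1)"
    by (intro compact_imp_bounded compact_continuous_image continuous_intros compact_sphere)
  then obtain C where "\<forall>z\<in>sphere 0 1. cmod (poly p z) \<le> C" by (auto simp: bounded_iff)
  then have "cmod z = 1 \<Longrightarrow> cmod (poly p z) \<le> C" for z by simp
  then show ?thesis
    by (intro circ_L2_bounded[where C=C] borel_measurable_continuous_onI continuous_intros)
qed

lemma power_L2 [simp]: "(\<lambda>z. z ^ n) \<in> L2 circ"
  by (rule circ_L2_bounded[where C=1]) (auto simp: norm_power)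

lemma one_L2 [simp]: "(\<lambda>z. 1) \<in> L2 circ"
  using power_L2[of 0] by simp

lemma fourier_power: "fourier f (int n) = inner2 circ f (\<lambda>z. z ^ n)"
  by (simp add: fourier_def)

lemma unit_powi: "cmod z = 1 \<Longrightarrow> z * cnj (z powi n) = cnj (z powi (n - 1))"
  "cmod z = 1 \<Longrightarrow> cnj z * cnj (z powi n) = cnj (z powi (n + 1))"
proof -
  assume z: "cmod z = 1"
  then have nz: "cnj z \<noteq> 0" by auto
  have inv: "z * cnj z = 1" using z complex_norm_square[of z] by simp
  show 2: "cnj z * cnj (z powi n) = cnj (z powi (n + 1))" for n
    using nz by (simp add: power_int_add mult.commute)
  have "z * cnj (z powi n) = (z * cnj z) * cnj (z powi (n - 1))"
    using 2[of "n - 1"] by (simp add: mult.assoc)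
  then show "z * cnj (z powi n) = cnj (z powi (n - 1))" by (simp add: inv)
qed

lemma fourier_mult_z: "f \<in> L2 circ \<Longrightarrow> fourier (\<lambda>z. z * f z) n = fourier f (n - 1)"
  unfolding fourier_def inner2_def
  using unit_powi(1)[of _ n] by (intro integral_circ_cong) (auto simp: L2_def mult_ac)

lemma fourier_mult_cnj: "f \<in> L2 circ \<Longrightarrow> fourier (\<lambda>z. cnj z * f z) n = fourier f (n + 1)"
  unfolding fourier_def inner2_def
  using unit_powi(2)[of _ n] by (intro integral_circ_cong) (auto simp: L2_def mult_ac)

lemma fourier_one: "fourier (\<lambda>z. 1) n = (if n = 0 then 1 else 0)"
proof -
  have "fourier (\<lambda>z. 1) n = cnj (\<integral>z. z powi n \<partial>circ)"
    unfolding fourier_def inner2_def by (subst Bochner_Integration.integral_cnj[symmetric]) simp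
  then show ?thesis by (simp add: integral_circ_powi)
qed

lemma fourier_diff: "f \<in> L2 circ \<Longrightarrow> g \<in> L2 circ \<Longrightarrow> fourier (\<lambda>z. f z - g z) n = fourier f n - fourier g n"
  by (simp add: fourier_def inner2_left)

lemma fourier_lincomb:
  "f \<in> L2 circ \<Longrightarrow> g \<in> L2 circ \<Longrightarrow> fourier (\<lambda>z. a * f z + b * g z) n = a * fourier f n + b * fourier g n"
  by (simp add: fourier_def inner2_left L2_intros)

text \<open>The functions with vanishing Fourier coefficients are preserved by multiplication with \<open>z\<close> and
  \<open>cnj z\<close>, hence with every polynomial in \<open>Re z\<close> and \<open>Im z\<close>; by the Stone-Weierstrass theorem
  they annihilate all continuous functions on the circle.\<close>

lemma fourier_zero_mult_polynomial:
  assumes "real_polynomial_function g" "f \<in> L2 circ" "\<And>n. fourier f n = 0"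
  shows "(\<lambda>z. of_real (g z) * f z) \<in> L2 circ \<and> (\<forall>n. fourier (\<lambda>z. of_real (g z) * f z) n = 0)"
  using assms
proof (induction arbitrary: f rule: real_polynomial_function.induct)
  case (linear g)
  \<comment> \<open>The coefficients come from writing \<open>Re z\<close> and \<open>Im z\<close>
    as combinations of \<open>z\<close> and \<open>cnj z\<close> in
    \<open>g z = Re z * g 1 + Im z * g \<i>\<close>.\<close>
  define a where "a = complex_of_real (g 1) / 2 + complex_of_real (g \<i>) / (2 * \<i>)"
  define b where "b = complex_of_real (g 1) / 2 - complex_of_real (g \<i>) / (2 * \<i>)"
  interpret g: bounded_linear g by fact
  have "complex_of_real (g z) = a * z + b * cnj z" for z
  proof -
    have "g z = g (Re z *\<^sub>R 1 + Im z *\<^sub>R \<i>)"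
      by (rule arg_cong[of _ _ g]) (simp add: complex_eq_iff)
    also have "\<dots> = Re z * g 1 + Im z * g \<i>" by (simp only: g.add g.scaleR real_scaleR_def)
    finally show ?thesis
      by (simp add: a_def b_def complex_eq_iff field_simps)
  qed
  then have eq: "(\<lambda>z. complex_of_real (g z) * f z) = (\<lambda>z. a * (z * f z) + b * (cnj z * f z))"
    by (auto simp: algebra_simps)
  have L: "(\<lambda>z. z * f z) \<in> L2 circ" "(\<lambda>z. cnj z * f z) \<in> L2 circ"
    using linear by (auto intro!: circ_L2_mult[where C=1] borel_measurable_cnj)
  show ?case
    unfolding eq using L linear by (simp add: L2_lincomb fourier_lincomb fourier_mult_z fourier_mult_cnj)
next
  case (const c)
  then show ?case using fourier_lincomb[of f f "of_real c" 0] by (simp add: L2_scale)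
next
  case (add g h)
  have "(\<lambda>z. of_real (g z + h z) * f z) = (\<lambda>z. 1 * (of_real (g z) * f z) + 1 * (of_real (h z) * f z))"
    by (auto simp: algebra_simps)
  then show ?case using add.IH[OF add.prems] by (simp only: L2_lincomb fourier_lincomb) simp
next
  case (mult g h)
  have "(\<lambda>z. of_real (g z * h z) * f z) = (\<lambda>z. of_real (g z) * (of_real (h z) * f z))"
    by (auto simp: algebra_simps)
  then show ?case using mult.IH(1)[of "\<lambda>z. of_real (h z) * f z"] mult.IH(2)[OF mult.prems] by simp
qed

lemma fourier_unique:
  assumes f: "f \<in> L2 circ" and zero: "\<And>n. fourier f n = 0"
  shows "eq_ae circ f (\<lambda>z. 0)"
proof -
  interpret finite_measure circ by simp
  have [measurable]: "f \<in> borel_measurable borel" using L2_measurable[OF f] by simp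
  have fint: "integrable circ f" using integrable_inner2[OF f one_L2] by simp
  have cont: "(\<integral>z. of_real (\<phi> z) * f z \<partial>circ) = 0"
    if \<phi>: "continuous_on UNIV \<phi>" and b: "\<And>z. \<bar>\<phi> z\<bar> \<le> 1" for \<phi> :: "complex \<Rightarrow> real"
  proof -
    have [measurable]: "\<phi> \<in> borel_measurable borel" using \<phi> by (rule borel_measurable_continuous_onI)
    have \<phi>f: "integrable circ (\<lambda>z. of_real (\<phi> z) * f z)"
      using b by (intro Bochner_Integration.integrable_bound[OF fint]) (auto simp: norm_mult mult_left_le_one_le)
    define I where "I = (\<integral>z. cmod (f z) \<partial>circ)"
    have "cmod (\<integral>z. of_real (\<phi> z) * f z \<partial>circ) \<le> e * I" if e: "e > 0" for e
    proof -
      obtain g where g: "real_polynomial_function g" "\<And>z. z \<in> sphere 0 1 \<Longrightarrow> \<bar>\<phi> z - g z\<bar> < e"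
        by (rule Stone_Weierstrass_real_polynomial_function
            [OF compact_sphere continuous_on_subset[OF \<phi> subset_UNIV] e], rule that)
      have gf: "(\<lambda>z. of_real (g z) * f z) \<in> L2 circ" "fourier (\<lambda>z. of_real (g z) * f z) 0 = 0"
        using fourier_zero_mult_polynomial[OF g(1) f zero] by auto
      have gint: "integrable circ (\<lambda>z. of_real (g z) * f z)" using integrable_inner2[OF gf(1) one_L2] by simp
      have "(\<integral>z. of_real (\<phi> z) * f z \<partial>circ) = (\<integral>z. of_real (\<phi> z) * f z - of_real (g z) * f z \<partial>circ)"
        using \<phi>f gint gf(2) by (simp add: Bochner_Integration.integral_diff fourier_def inner2_def)
      also have "cmod \<dots> \<le> (\<integral>z. cmod (of_real (\<phi> z) * f z - of_real (g z) * f z) \<partial>circ)"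
        by (rule integral_norm_bound)
      also have "\<dots> \<le> (\<integral>z. e * cmod (f z) \<partial>circ)"
      proof (rule integral_mono_AE)
        show "AE z in circ. cmod (of_real (\<phi> z) * f z - of_real (g z) * f z) \<le> e * cmod (f z)"
        proof (rule AE_circI)
          fix z :: complex assume "cmod z = 1"
          then have "\<bar>\<phi> z - g z\<bar> \<le> e" using g(2)[of z] by simp
          then have "\<bar>\<phi> z - g z\<bar> * cmod (f z) \<le> e * cmod (f z)" by (rule mult_right_mono) simp
          moreover have "of_real (\<phi> z) * f z - of_real (g z) * f z = of_real (\<phi> z - g z) * f z"
            by (simp add: algebra_simps)
          ultimately show "cmod (of_real (\<phi> z) * f z - of_real (g z) * f z) \<le> e * cmod (f z)"
            by (simp only: norm_mult norm_of_real)
        qed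
      qed (use \<phi>f gint fint in auto)
      finally show ?thesis by (simp add: I_def)
    qed
    note bd = this
    have "cmod (\<integral>z. of_real (\<phi> z) * f z \<partial>circ) \<le> 0"
    proof (rule field_le_epsilon)
      fix d :: real assume d: "d > 0"
      have I: "I \<ge> 0" by (simp add: I_def)
      have "cmod (\<integral>z. of_real (\<phi> z) * f z \<partial>circ) \<le> (d / (I + 1)) * I"
        using d I by (intro bd) auto
      also have "\<dots> \<le> d" using d I by (simp add: field_simps)
      finally show "cmod (\<integral>z. of_real (\<phi> z) * f z \<partial>circ) \<le> 0 + d" by simp
    qed
    then show ?thesis by simp
  qed
  have closed: "(\<integral>z. indicator C z * f z \<partial>circ) = 0" if C: "closed C" for C
  proof (cases "C = {}")
    case False
    \<comment> \<open>Continuous cutoffs that decrease to the indicator of the closed set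
      \<open>C\<close>.\<close>
    define \<phi> where "\<phi> n z = max 0 (1 - real n * infdist z C)" for n z
    have "(\<lambda>n. \<integral>z. of_real (\<phi> n z) * f z \<partial>circ) \<longlonglongrightarrow> (\<integral>z. indicator C z * f z \<partial>circ)"
    proof (rule integral_dominated_convergence[where w="\<lambda>z. cmod (f z)"])
      have "continuous_on UNIV (\<phi> n)" for n
        unfolding \<phi>_def by (intro continuous_intros)
      then have [measurable]: "\<phi> n \<in> borel_measurable borel" for n
        by (intro borel_measurable_continuous_onI)
      have [measurable]: "C \<in> sets borel" using C by simp
      show "(\<lambda>z. of_real (\<phi> n z) * f z) \<in> borel_measurable circ" "(\<lambda>z. indicator C z * f z) \<in> borel_measurable circ" for n
        by measurable
      show "AE z in circ. (\<lambda>n. of_real (\<phi> n z) * f z) \<longlonglongrightarrow> indicator C z * f z"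
      proof (rule AE_I2)
        fix z
        have "(\<lambda>n. \<phi> n z) \<longlonglongrightarrow> indicator C z"
        proof (cases "z \<in> C")
          case False
          then have pos: "infdist z C > 0" using C \<open>C \<noteq> {}\<close> by (simp add: infdist_pos_not_in_closed)
          obtain m :: nat where m: "1 / infdist z C < real m" using reals_Archimedean2 by blast
          have "\<phi> n z = 0" if "n \<ge> m" for n
          proof -
            have "1 / infdist z C < real n" using m that by linarith
            then show ?thesis using pos by (simp add: \<phi>_def field_simps)
          qed
          then show ?thesis using False by (intro tendsto_eventually) (auto simp: eventually_sequentially)
        qed (simp add: \<phi>_def)
        then have "(\<lambda>n. complex_of_real (\<phi> n z) * f z) \<longlonglongrightarrow> complex_of_real (indicator C z) * f z"
          by (intro tendsto_intros)
        then show "(\<lambda>n. of_real (\<phi> n z) * f z) \<longlonglongrightarrow> indicator C z * f z"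
          by (simp add: of_real_indicator)
      qed
      show "AE z in circ. norm (of_real (\<phi> n z) * f z) \<le> cmod (f z)" for n
        by (intro AE_I2) (auto simp: norm_mult \<phi>_def infdist_nonneg intro!: mult_left_le_one_le)
    qed (use fint in simp)
    moreover have "(\<integral>z. of_real (\<phi> n z) * f z \<partial>circ) = 0" for n
    proof (rule cont)
      show "continuous_on UNIV (\<phi> n)" unfolding \<phi>_def by (intro continuous_intros)
      show "\<bar>\<phi> n z\<bar> \<le> 1" for z by (auto simp: \<phi>_def infdist_nonneg)
    qed
    ultimately show ?thesis by (simp add: LIMSEQ_const_iff)
  qed simp
  have ind_int: "integrable circ (\<lambda>z. indicator B z * f z)" if "B \<in> sets borel" for B
    using that by (intro Bochner_Integration.integrable_bound[OF fint]) (auto simp: indicator_def)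
  have set0: "(\<integral>z. indicator B z * f z \<partial>circ) = 0" if B: "B \<in> sets borel" for B
  proof -
    \<comment> \<open>Closed sets form an intersection-stable generator of the Borel sets, so it
      suffices to pass to complements and disjoint countable unions.\<close>
    have "Int_stable (Collect closed :: complex set set)" by (auto simp: Int_stable_def)
    moreover have "Collect closed \<subseteq> Pow (UNIV :: complex set)" by simp
    moreover have "B \<in> sigma_sets UNIV (Collect closed)" using B by (simp add: borel_eq_closed)
    ultimately show ?thesis
    proof (induction rule: sigma_sets_induct_disjoint)
      case (basic C)
      then show ?case using closed by simp
    next
      case empty
      then show ?case by simp
    next
      case (compl C)
      then have C: "C \<in> sets borel" by (simp add: borel_eq_closed)
      have "(\<integral>z. indicator (UNIV - C) z * f z \<partial>circ) = (\<integral>z. f z - indicator C z * f z \<partial>circ)"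
        by (intro Bochner_Integration.integral_cong) (auto simp: indicator_def)
      also have "\<dots> = (\<integral>z. indicator UNIV z * f z \<partial>circ) - (\<integral>z. indicator C z * f z \<partial>circ)"
        using fint ind_int[OF C] by (simp add: Bochner_Integration.integral_diff)
      also have "\<dots> = 0" using compl closed[of UNIV] by simp
      finally show ?case .
    next
      case (union A)
      then have A: "A n \<in> sets borel" for n by (auto simp: borel_eq_closed)
      have "(\<lambda>n. \<integral>z. (\<Sum>i<n. indicator (A i) z * f z) \<partial>circ) \<longlonglongrightarrow> (\<integral>z. indicator (\<Union>i. A i) z * f z \<partial>circ)"
      proof (rule integral_dominated_convergence[where w="\<lambda>z. cmod (f z)"])
        show "(\<lambda>z. indicator (\<Union>i. A i) z * f z) \<in> borel_measurable circ"
          "(\<lambda>z. \<Sum>i<n. indicator (A i) z * f z) \<in> borel_measurable circ" for n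
          using A by (auto intro!: borel_measurable_times borel_measurable_sum)
        have sum: "(\<Sum>i<n. indicator (A i) z * f z) = indicator (\<Union>i<n. A i) z * f z" for n z
        proof -
          have "(\<Sum>i<n. indicator (A i) z :: complex) = indicator (\<Union>i<n. A i) z"
            using union(1) by (intro indicator_UN_disjoint[symmetric]) (auto simp: disjoint_family_on_def)
          then show ?thesis by (simp add: sum_distrib_right[symmetric])
        qed
        have "(\<lambda>n. indicator (\<Union>i<n. A i) z * f z) \<longlonglongrightarrow> indicator (\<Union>i. A i) z * f z" for z
          by (intro tendsto_intros LIMSEQ_indicator_UN)
        then show "AE z in circ. (\<lambda>n. \<Sum>i<n. indicator (A i) z * f z) \<longlonglongrightarrow> indicator (\<Union>i. A i) z * f z"
          by (simp add: sum)
        show "AE z in circ. norm (\<Sum>i<n. indicator (A i) z * f z) \<le> cmod (f z)" for n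
          by (simp add: sum) (auto simp: indicator_def)
      qed (use fint in simp)
      moreover have "(\<integral>z. (\<Sum>i<n. indicator (A i) z * f z) \<partial>circ) = 0" for n
        using ind_int[OF A] union(3) by (subst Bochner_Integration.integral_sum) auto
      ultimately show ?case by (simp add: LIMSEQ_const_iff)
    qed
  qed
  \<comment> \<open>Integrating \<open>f\<close> over the set where \<open>Re (c * f)\<close> is
    positive gives zero. The values \<open>1\<close>, \<open>-1\<close>, \<open>\<i>\<close>,
    \<open>-\<i>\<close> of \<open>c\<close> then bound the real and imaginary parts from both
    sides.\<close>
  have "AE z in circ. Re (c * f z) \<le> 0" for c
  proof -
    define B where "B = {z. Re (c * f z) > 0}"
    have B [measurable]: "B \<in> sets borel" unfolding B_def by measurable
    have int: "integrable circ (\<lambda>z. Re (c * (indicator B z * f z)))"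
      using ind_int[OF B] by (intro integrable_Re integrable_mult_right)
    have "(\<integral>z. Re (c * (indicator B z * f z)) \<partial>circ) = Re (\<integral>z. c * (indicator B z * f z) \<partial>circ)"
      using ind_int[OF B] by (intro integral_Re integrable_mult_right)
    also have "\<dots> = 0" using set0[OF B] by simp
    finally have "(\<integral>z. Re (c * (indicator B z * f z)) \<partial>circ) = 0" .
    moreover have nn: "0 \<le> Re (c * (indicator B z * f z))" for z by (auto simp: indicator_def B_def)
    ultimately have "AE z in circ. Re (c * (indicator B z * f z)) = 0"
      using integral_nonneg_eq_0_iff_AE[OF int] by simp
    then show ?thesis by (rule AE_mp) (auto simp: indicator_def B_def)
  qed
  from this[of 1] this[of "-1"] this[of "\<i>"] this[of "-\<i>"]
  show ?thesis unfolding eq_ae_def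
    by eventually_elim (auto simp: complex_eq_iff)
qed

section \<open>The Hardy space and the backward shift\<close>

lemma H2_L2: "f \<in> H2 \<Longrightarrow> f \<in> L2 circ"
  by (simp add: H2_def)

lemma subspace2_H2 [simp]: "subspace2 circ H2"
  by (auto simp: subspace2_def H2_def L2_lincomb fourier_lincomb) (simp add: fourier_def)

lemma H2_mult_z: "f \<in> H2 \<Longrightarrow> (\<lambda>z. z * f z) \<in> H2"
  by (auto simp: H2_def fourier_mult_z intro!: circ_L2_mult[where C=1])

lemma H2_one [simp]: "(\<lambda>z. 1) \<in> H2"
  by (auto simp: H2_def fourier_one)

lemma H2_power [simp]: "(\<lambda>z. z ^ n) \<in> H2"
  by (induction n) (auto dest: H2_mult_z)

lemma H2_poly [simp]: "poly p \<in> H2"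
  by (induction p)
     (use subspace2_lincomb[OF subspace2_H2 H2_one H2_mult_z, of _ _ 1] subspace2_zero[OF subspace2_H2]
       in \<open>auto simp: poly_pCons[abs_def]\<close>)

lemma H2_closed:
  assumes g: "g \<in> L2 circ" and appr: "\<And>e. e > 0 \<Longrightarrow> \<exists>s\<in>H2. norm2 circ (\<lambda>z. g z - s z) < e"
  shows "g \<in> H2"
proof -
  have "fourier g n = 0" if n: "n < 0" for n
  proof -
    have "cmod (fourier g n) \<le> 0"
    proof (rule field_le_epsilon)
      fix e :: real assume e: "e > 0"
      define N where "N = norm2 circ (\<lambda>z. z powi n)"
      have N: "N \<ge> 0" by (simp add: N_def)
      obtain s where s: "s \<in> H2" "norm2 circ (\<lambda>z. g z - s z) < e / (N + 1)"
        using appr[of "e / (N + 1)"] e N by auto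
      have "fourier g n = fourier (\<lambda>z. g z - s z) n"
        using s n by (simp add: fourier_diff g H2_L2) (simp add: H2_def)
      then have "fourier g n = inner2 circ (\<lambda>z. g z - s z) (\<lambda>z. z powi n)"
        by (simp add: fourier_def)
      then have "cmod (fourier g n) \<le> norm2 circ (\<lambda>z. g z - s z) * N"
        unfolding N_def by (simp only:) (intro cauchy_schwarz2 L2_diff g H2_L2[OF s(1)] powi_L2)
      also have "\<dots> \<le> e / (N + 1) * N" using s N by (intro mult_right_mono) auto
      also have "\<dots> \<le> e" using e N by (simp add: field_simps)
      finally show "cmod (fourier g n) \<le> 0 + e" by simp
    qed
    then show ?thesis by simp
  qed
  then show ?thesis using g by (simp add: H2_def)
qed

text \<open>The component of \<open>f\<close> orthogonal to the polynomials has no Fourier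
  coefficients at all: the negative ones vanish because it lies in \<open>H2\<close>, the others
  because monomials are polynomials.\<close>

lemma H2_poly_dense:
  assumes f: "f \<in> H2" and e: "e > 0"
  obtains p where "norm2 circ (\<lambda>z. f z - poly p z) < e"
proof -
  have S: "subspace2 circ (range poly)"
    unfolding subspace2_def
  proof (intro conjI ballI allI)
    show "(\<lambda>x. 0) \<in> range (poly :: complex poly \<Rightarrow> _)" by (rule range_eqI[of _ _ 0]) auto
    fix f g :: "complex \<Rightarrow> complex" and a b
    assume "f \<in> range poly" "g \<in> range poly"
    then obtain p q where "f = poly p" "g = poly q" by auto
    then show "(\<lambda>x. a * f x + b * g x) \<in> range poly"
      by (intro range_eqI[of _ _ "smult a p + smult b q"]) auto
  qed auto
  obtain g where g: "g \<in> L2 circ" "\<And>e. e > 0 \<Longrightarrow> \<exists>s\<in>range poly. norm2 circ (\<lambda>x. g x - s x) < e"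
    "\<And>s. s \<in> range poly \<Longrightarrow> inner2 circ (\<lambda>x. f x - g x) s = 0"
    using projection2[OF S H2_L2[OF f]] by blast
  have gH: "g \<in> H2" using g by (intro H2_closed) (auto, metis H2_poly)
  have d: "(\<lambda>x. f x - g x) \<in> H2" by (intro subspace2_diff[OF subspace2_H2] f gH)
  have "fourier (\<lambda>x. f x - g x) n = 0" for n
  proof (cases "n < 0")
    case True
    then show ?thesis using d by (simp add: H2_def)
  next
    case False
    then obtain m where "n = int m" by (metis nonneg_int_cases not_less)
    moreover have "poly (monom 1 m) = (\<lambda>z::complex. z ^ m)" by (auto simp: poly_monom)
    ultimately show ?thesis using g(3)[OF rangeI, of "monom 1 m"] by (simp add: fourier_power)
  qed
  then have "eq_ae circ (\<lambda>x. f x - g x) (\<lambda>x. 0)" using d by (intro fourier_unique H2_L2)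
  then have fg: "norm2 circ (\<lambda>x. f x - g x) = 0" using norm2_eq_0[OF H2_L2[OF d]] by simp
  obtain p where "norm2 circ (\<lambda>x. g x - poly p x) < e" using g(2)[OF e] by auto
  then have "norm2 circ (\<lambda>z. f z - poly p z) < e"
    using norm2_diff_triangle[OF H2_L2[OF f] g(1) poly_L2[of p]] fg by simp
  then show thesis by (rule that)
qed

text \<open>The witness that \<open>shift\<close> has an adjoint. Subtracting the mean of
  \<open>g\<close> keeps the product with \<open>cnj z\<close> in \<open>H2\<close>, and it does not
  affect the inner product since \<open>shift f\<close> is orthogonal to constants.\<close>

lemma shift_star_explicit:
  assumes g: "g \<in> H2"
  shows "(\<lambda>z. cnj z * (g z - fourier g 0)) \<in> H2"
    "f \<in> H2 \<Longrightarrow> inner2 circ (shift f) g = inner2 circ f (\<lambda>z. cnj z * (g z - fourier g 0))"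
proof -
  have c: "(\<lambda>z. fourier g 0 * 1) \<in> L2 circ" by (intro L2_scale) simp
  have L: "(\<lambda>z. g z - fourier g 0) \<in> L2 circ" using L2_diff[OF H2_L2[OF g] c] by simp
  have L': "(\<lambda>z. cnj z * (g z - fourier g 0)) \<in> L2 circ"
    using L by (intro circ_L2_mult[where C=1] borel_measurable_cnj) auto
  have fc: "fourier (\<lambda>z. fourier g 0) n = (if n = 0 then fourier g 0 else 0)" for n
    using fourier_lincomb[OF one_L2 one_L2, of "fourier g 0" 0 n] by (simp add: fourier_one)
  show H: "(\<lambda>z. cnj z * (g z - fourier g 0)) \<in> H2"
    using L' L g c by (auto simp: H2_def fourier_mult_cnj fourier_diff fc)
  assume f: "f \<in> H2"
  have [measurable]: "f \<in> borel_measurable borel" "g \<in> borel_measurable borel"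
    using L2_measurable[OF H2_L2[OF f]] L2_measurable[OF H2_L2[OF g]] by auto
  have "inner2 circ (shift f) (\<lambda>z. fourier g 0 * 1) = cnj (fourier g 0) * fourier (\<lambda>z. z * f z) 0"
    unfolding inner2_scale_right shift_def by (simp add: fourier_def)
  also have "\<dots> = 0" using f H2_L2[OF f] by (simp add: fourier_mult_z) (simp add: H2_def)
  finally have "inner2 circ (shift f) g = inner2 circ (shift f) (\<lambda>z. g z - fourier g 0 * 1)"
    using c H2_L2[OF g] H2_L2[OF H2_mult_z[OF f]] by (simp add: inner2_diff_right shift_def)
  also have "\<dots> = inner2 circ f (\<lambda>z. cnj z * (g z - fourier g 0))"
    unfolding inner2_def shift_def by (intro Bochner_Integration.integral_cong) (auto simp: mult_ac)
  finally show "inner2 circ (shift f) g = inner2 circ f (\<lambda>z. cnj z * (g z - fourier g 0))" .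
qed

lemma shift_in: "f \<in> H2 \<Longrightarrow> shift f \<in> H2"
  by (simp add: shift_def H2_mult_z)

lemma shift_star_in: "g \<in> H2 \<Longrightarrow> shift_star g \<in> H2"
  and shift_star_adj: "f \<in> H2 \<Longrightarrow> g \<in> H2 \<Longrightarrow> inner2 circ (shift f) g = inner2 circ f (shift_star g)"
  unfolding shift_star_def
  by (rule adjoint2_props[where T'="\<lambda>g z. cnj z * (g z - fourier g 0)"], auto intro: shift_star_explicit)+

lemma shift_star_adj': "f \<in> H2 \<Longrightarrow> g \<in> H2 \<Longrightarrow> inner2 circ (shift_star g) f = inner2 circ g (shift f)"
  using shift_star_adj by (metis inner2_cnj)

lemma norm_shift: "f \<in> H2 \<Longrightarrow> norm2 circ (shift f) = norm2 circ f"
proof -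
  assume "f \<in> H2"
  then have [measurable]: "f \<in> borel_measurable circ" by (intro L2_measurable H2_L2)
  show ?thesis
    unfolding norm2_def shift_def
    by (intro arg_cong[of _ _ sqrt] integral_circ_cong) (auto simp: norm_mult)
qed

lemma norm_shift_star:
  assumes g: "g \<in> H2"
  shows "norm2 circ (shift_star g) \<le> norm2 circ g"
proof -
  note s = shift_star_in[OF g]
  have "(norm2 circ (shift_star g))\<^sup>2 = Re (inner2 circ (shift (shift_star g)) g)"
    using shift_star_adj[OF s g] by (simp add: norm2_eq_inner2)
  also have "\<dots> \<le> norm2 circ (shift_star g) * norm2 circ g"
    using cauchy_schwarz2[OF H2_L2[OF shift_in[OF s]] H2_L2[OF g]] complex_Re_le_cmod norm_shift[OF s]
    by (metis order_trans)
  finally show ?thesis by (cases "norm2 circ (shift_star g) = 0") (auto simp: power2_eq_square less_le)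
qed

lemma shift_shift_star:
  assumes g: "g \<in> H2"
  shows "eq_ae circ (shift (shift_star g)) (\<lambda>z. g z - fourier g 0)"
proof -
  have "eq_ae circ (shift_star g) (\<lambda>z. cnj z * (g z - fourier g 0))"
  proof (rule eq_ae_by_inner2[OF subspace2_H2])
    fix k assume k: "k \<in> H2"
    have "inner2 circ k (shift_star g) = inner2 circ k (\<lambda>z. cnj z * (g z - fourier g 0))"
      using shift_star_adj[OF k g] shift_star_explicit(2)[OF g k] by simp
    then show "inner2 circ (shift_star g) k = inner2 circ (\<lambda>z. cnj z * (g z - fourier g 0)) k"
      by (metis inner2_cnj)
  qed (use g shift_star_in shift_star_explicit in auto)
  then show ?thesis
    unfolding eq_ae_def using AE_circ
  proof eventually_elim
    case (elim z)
    then have "z * cnj z = 1" using complex_norm_square[of z] by simp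
    then show ?case using elim(1) by (simp add: shift_def flip: mult.assoc)
  qed
qed

text \<open>The defect of \<open>shift_star\<close> from being isometric is the projection onto the
  constants; this is the source of the rank one term in \<open>Ht_square\<close>.\<close>

lemma inner2_shift_star:
  assumes f: "f \<in> H2" and g: "g \<in> H2"
  shows "inner2 circ (shift_star f) (shift_star g) = inner2 circ f g - inner2 circ f (\<lambda>z. 1) * cnj (inner2 circ g (\<lambda>z. 1))"
proof -
  have c: "(\<lambda>z. fourier g 0 * 1) \<in> L2 circ" by (intro L2_scale) simp
  have "inner2 circ (shift_star f) (shift_star g) = inner2 circ f (shift (shift_star g))"
    using f g by (intro shift_star_adj' shift_star_in)
  also have "\<dots> = inner2 circ f (\<lambda>z. g z - fourier g 0 * 1)"
    using shift_shift_star[OF g] L2_diff[OF H2_L2[OF g] c] f g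
    by (intro inner2_cong) (auto intro: H2_L2 shift_in shift_star_in)
  also have "\<dots> = inner2 circ f g - cnj (fourier g 0) * inner2 circ f (\<lambda>z. 1)"
    using f g c by (simp add: inner2_diff_right H2_L2 inner2_scale_right del: mult_1_right)
  also have "fourier g 0 = inner2 circ g (\<lambda>z. 1)" using fourier_power[of g 0] by simp
  finally show ?thesis by (simp add: mult.commute)
qed

text \<open>The quantifier over \<open>j\<close> carries the induction: each further backward shift
  in \<open>k\<close> is paid for by one more factor \<open>z\<close>. The coefficient formula for
  \<open>u\<close> takes \<open>j = 0\<close>.\<close>

lemma fourier_shift_star:
  assumes f: "f \<in> H2"
  shows "(shift_star ^^ k) f \<in> H2 \<and> (\<forall>j. inner2 circ ((shift_star ^^ k) f) (\<lambda>z. z ^ j) = fourier f (int (k + j)))"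
proof (induction k)
  case 0
  then show ?case using f by (simp add: fourier_power)
next
  case (Suc k)
  have "inner2 circ (shift_star ((shift_star ^^ k) f)) (\<lambda>z. z ^ j) = fourier f (int (Suc k + j))" for j
  proof -
    have "inner2 circ (shift_star ((shift_star ^^ k) f)) (\<lambda>z. z ^ j)
        = inner2 circ ((shift_star ^^ k) f) (shift (\<lambda>z. z ^ j))"
      using Suc by (intro shift_star_adj') auto
    also have "shift (\<lambda>z. z ^ j) = (\<lambda>z. z ^ Suc j)" by (simp add: shift_def)
    finally show ?thesis using Suc by (simp only: add_Suc_right add_Suc)
  qed
  then show ?case using Suc by (simp add: shift_star_in)
qed

section \<open>Bounded operators\<close>

lemma zero_by_eps:
  fixes a :: complex
  assumes "\<And>e. e > 0 \<Longrightarrow> cmod a \<le> e * c"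
  shows "a = 0"
proof -
  have "cmod a \<le> 0"
  proof (rule field_le_epsilon)
    fix d :: real assume d: "d > 0"
    have "cmod a \<le> (d / (\<bar>c\<bar> + 1)) * c" using d by (intro assms divide_pos_pos) auto
    also have "\<dots> \<le> (d / (\<bar>c\<bar> + 1)) * (\<bar>c\<bar> + 1)" using d by (intro mult_left_mono) auto
    finally show "cmod a \<le> 0 + d" by (simp split: if_splits)
  qed
  then show ?thesis by simp
qed

lemma eq_ae_sum:
  assumes "\<And>i. i \<in> I \<Longrightarrow> eq_ae M (f i) (g i)" "finite I"
  shows "eq_ae M (\<lambda>x. \<Sum>i\<in>I. f i x) (\<lambda>x. \<Sum>i\<in>I. g i x)"
proof -
  have "AE x in M. \<forall>i\<in>I. f i x = g i x" using assms by (simp add: eq_ae_def AE_finite_all)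
  then show ?thesis unfolding eq_ae_def by (rule AE_mp) (auto intro!: sum.cong)
qed

lemma bounded_linear_on_in: "bounded_linear_on M V T \<Longrightarrow> f \<in> V \<Longrightarrow> T f \<in> V"
  by (auto simp: bounded_linear_on_def)

lemma bounded_linear_on_lincomb:
  "bounded_linear_on M V T \<Longrightarrow> f \<in> V \<Longrightarrow> g \<in> V \<Longrightarrow>
     eq_ae M (T (\<lambda>x. a * f x + b * g x)) (\<lambda>x. a * T f x + b * T g x)"
  by (auto simp: bounded_linear_on_def)

lemma bounded_antilinear_on_in: "bounded_antilinear_on M V T \<Longrightarrow> f \<in> V \<Longrightarrow> T f \<in> V"
  by (auto simp: bounded_antilinear_on_def)

lemma bounded_antilinear_on_lincomb:
  "bounded_antilinear_on M V T \<Longrightarrow> f \<in> V \<Longrightarrow> g \<in> V \<Longrightarrow>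
     eq_ae M (T (\<lambda>x. a * f x + b * g x)) (\<lambda>x. cnj a * T f x + cnj b * T g x)"
  by (auto simp: bounded_antilinear_on_def)

lemma norm_bound_nonneg:
  assumes "\<exists>C. \<forall>f\<in>V. norm2 M (T f) \<le> C * norm2 M f"
  obtains C where "C \<ge> 0" "\<And>f. f \<in> V \<Longrightarrow> norm2 M (T f) \<le> C * norm2 M f"
proof -
  obtain C where C: "\<And>f. f \<in> V \<Longrightarrow> norm2 M (T f) \<le> C * norm2 M f" using assms by auto
  have "norm2 M (T f) \<le> \<bar>C\<bar> * norm2 M f" if "f \<in> V" for f
    using C[OF that] mult_right_mono[OF abs_ge_self[of C] norm2_nonneg[of M f]] by linarith
  then show thesis by (intro that[of "\<bar>C\<bar>"]) auto
qed

lemma bounded_linear_on_bound: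
  assumes "bounded_linear_on M V T"
  obtains C where "C \<ge> 0" "\<And>f. f \<in> V \<Longrightarrow> norm2 M (T f) \<le> C * norm2 M f"
proof -
  have "\<exists>C. \<forall>f\<in>V. norm2 M (T f) \<le> C * norm2 M f" using assms by (simp add: bounded_linear_on_def)
  then show thesis using that by (rule norm_bound_nonneg)
qed

lemma bounded_antilinear_on_bound:
  assumes "bounded_antilinear_on M V T"
  obtains C where "C \<ge> 0" "\<And>f. f \<in> V \<Longrightarrow> norm2 M (T f) \<le> C * norm2 M f"
proof -
  have "\<exists>C. \<forall>f\<in>V. norm2 M (T f) \<le> C * norm2 M f" using assms by (simp add: bounded_antilinear_on_def)
  then show thesis using that by (rule norm_bound_nonneg)
qed

lemma bounded_linear_on_diff:
  assumes V: "subspace2 M V" and T: "bounded_linear_on M V T" and f: "f \<in> V" and g: "g \<in> V"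
  shows "norm2 M (\<lambda>x. T f x - T g x) = norm2 M (T (\<lambda>x. f x - g x))"
proof -
  have "eq_ae M (T (\<lambda>x. f x - g x)) (\<lambda>x. T f x - T g x)"
    using bounded_linear_on_lincomb[OF T f g, of 1 "-1"] by simp
  moreover have "T (\<lambda>x. f x - g x) \<in> L2 M" "T f \<in> L2 M" "T g \<in> L2 M"
    by (intro subspace2D[OF V] bounded_linear_on_in[OF T] subspace2_diff[OF V] f g)+
  ultimately show ?thesis by (intro norm2_cong[OF eq_ae_sym] L2_diff)
qed

lemma bounded_antilinear_on_diff:
  assumes V: "subspace2 M V" and T: "bounded_antilinear_on M V T" and f: "f \<in> V" and g: "g \<in> V"
  shows "norm2 M (\<lambda>x. T f x - T g x) = norm2 M (T (\<lambda>x. f x - g x))"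
proof -
  have "eq_ae M (T (\<lambda>x. f x - g x)) (\<lambda>x. T f x - T g x)"
    using bounded_antilinear_on_lincomb[OF T f g, of 1 "-1"] by simp
  moreover have "T (\<lambda>x. f x - g x) \<in> L2 M" "T f \<in> L2 M" "T g \<in> L2 M"
    by (intro subspace2D[OF V] bounded_antilinear_on_in[OF T] subspace2_diff[OF V] f g)+
  ultimately show ?thesis by (intro norm2_cong[OF eq_ae_sym] L2_diff)
qed

text \<open>Operators act on representatives, and nothing in their definition says that they respect
  null sets. Boundedness supplies it: a difference of norm zero has an image of norm zero.\<close>

lemma bounded_linear_on_cong:
  assumes V: "subspace2 M V" and T: "bounded_linear_on M V T" and f: "f \<in> V" and g: "g \<in> V"
    and eq: "eq_ae M f g"
  shows "eq_ae M (T f) (T g)"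
proof -
  obtain C where C: "\<And>f. f \<in> V \<Longrightarrow> norm2 M (T f) \<le> C * norm2 M f"
    by (rule bounded_linear_on_bound[OF T], rule that)
  have "norm2 M (\<lambda>x. f x - g x) = 0"
    using eq eq_ae_iff_norm2_diff[OF subspace2D[OF V f] subspace2D[OF V g]] by simp
  then have "norm2 M (T (\<lambda>x. f x - g x)) = 0"
    using C[OF subspace2_diff[OF V f g]] norm2_nonneg[of M "T (\<lambda>x. f x - g x)"] by simp
  then show ?thesis
    using bounded_linear_on_diff[OF V T f g]
      eq_ae_iff_norm2_diff[OF subspace2D[OF V bounded_linear_on_in[OF T f]]
        subspace2D[OF V bounded_linear_on_in[OF T g]]] by simp
qed

lemma bounded_antilinear_on_cong:
  assumes V: "subspace2 M V" and T: "bounded_antilinear_on M V T" and f: "f \<in> V" and g: "g \<in> V"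
    and eq: "eq_ae M f g"
  shows "eq_ae M (T f) (T g)"
proof -
  obtain C where C: "\<And>f. f \<in> V \<Longrightarrow> norm2 M (T f) \<le> C * norm2 M f"
    by (rule bounded_antilinear_on_bound[OF T], rule that)
  have "norm2 M (\<lambda>x. f x - g x) = 0"
    using eq eq_ae_iff_norm2_diff[OF subspace2D[OF V f] subspace2D[OF V g]] by simp
  then have "norm2 M (T (\<lambda>x. f x - g x)) = 0"
    using C[OF subspace2_diff[OF V f g]] norm2_nonneg[of M "T (\<lambda>x. f x - g x)"] by simp
  then show ?thesis
    using bounded_antilinear_on_diff[OF V T f g]
      eq_ae_iff_norm2_diff[OF subspace2D[OF V bounded_antilinear_on_in[OF T f]]
        subspace2D[OF V bounded_antilinear_on_in[OF T g]]] by simp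
qed

lemma funpow_in: "(\<And>f. f \<in> X \<Longrightarrow> T f \<in> X) \<Longrightarrow> f \<in> X \<Longrightarrow> (T ^^ i) f \<in> X"
  by (induction i) auto

lemma funpow_lincomb:
  assumes V: "subspace2 M V" and T: "bounded_linear_on M V T" and f: "f \<in> V" and g: "g \<in> V"
  shows "eq_ae M ((T ^^ i) (\<lambda>x. a * f x + b * g x)) (\<lambda>x. a * (T ^^ i) f x + b * (T ^^ i) g x)"
proof (induction i)
  case (Suc i)
  have V': "(T ^^ i) h \<in> V" if "h \<in> V" for h
    using that T bounded_linear_on_in by (intro funpow_in) blast+
  have "eq_ae M ((T ^^ Suc i) (\<lambda>x. a * f x + b * g x)) (T (\<lambda>x. a * (T ^^ i) f x + b * (T ^^ i) g x))"
    using bounded_linear_on_cong[OF V T _ _ Suc] V' f g by (simp add: subspace2_lincomb[OF V])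
  also have "eq_ae M \<dots> (\<lambda>x. a * (T ^^ Suc i) f x + b * (T ^^ Suc i) g x)"
    using bounded_linear_on_lincomb[OF T V' V'] f g by simp
  finally show ?case .
qed simp

lemma funpow_cong:
  assumes V: "subspace2 M V" and T: "bounded_linear_on M V T" and f: "f \<in> V" and g: "g \<in> V"
    and eq: "eq_ae M f g"
  shows "eq_ae M ((T ^^ i) f) ((T ^^ i) g)"
proof (induction i)
  case (Suc i)
  have V': "(T ^^ i) h \<in> V" if "h \<in> V" for h
    using that T bounded_linear_on_in by (intro funpow_in) blast+
  show ?case using bounded_linear_on_cong[OF V T V'[OF f] V'[OF g] Suc] by simp
qed (use eq in simp)

lemma inner2_antilinear_sum:
  assumes V: "subspace2 M V" and K: "bounded_antilinear_on M V K" and y: "y \<in> L2 M"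
    and x: "\<And>i. i \<in> I \<Longrightarrow> x i \<in> V" and I: "finite I"
  shows "inner2 M (K (\<lambda>s. \<Sum>i\<in>I. a i * x i s)) y = (\<Sum>i\<in>I. cnj (a i) * inner2 M (K (x i)) y)"
  using I x
proof (induction I)
  case empty
  have z: "(\<lambda>x. 0) \<in> V" by (rule subspace2_zero[OF V])
  have "eq_ae M (K (\<lambda>x. 0)) (\<lambda>x. 0)"
    using bounded_antilinear_on_lincomb[OF K z z, of 0 0] by simp
  then have "inner2 M (K (\<lambda>x. 0)) y = inner2 M (\<lambda>x. 0) y"
    using bounded_antilinear_on_in[OF K z] subspace2D[OF V] y by (intro inner2_cong) auto
  then show ?case by simp
next
  case (insert i I)
  have s: "(\<lambda>s. \<Sum>i\<in>I. a i * x i s) \<in> V"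
    using insert by (intro subspace2_sum[OF V] subspace2_scale[OF V]) auto
  have xi: "x i \<in> V" using insert by simp
  have KV: "K f \<in> L2 M" if "f \<in> V" for f using bounded_antilinear_on_in[OF K that] subspace2D[OF V] by blast
  have "eq_ae M (K (\<lambda>s. a i * x i s + 1 * (\<Sum>i\<in>I. a i * x i s)))
      (\<lambda>s. cnj (a i) * K (x i) s + cnj 1 * K (\<lambda>s. \<Sum>i\<in>I. a i * x i s) s)"
    by (rule bounded_antilinear_on_lincomb[OF K xi s])
  then have "inner2 M (K (\<lambda>s. a i * x i s + (\<Sum>i\<in>I. a i * x i s))) y
      = inner2 M (\<lambda>s. cnj (a i) * K (x i) s + K (\<lambda>s. \<Sum>i\<in>I. a i * x i s) s) y"
    using y xi s by (intro inner2_cong) (auto intro!: KV L2_add L2_scale subspace2_add[OF V] subspace2_scale[OF V])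
  also have "\<dots> = cnj (a i) * inner2 M (K (x i)) y + inner2 M (K (\<lambda>s. \<Sum>i\<in>I. a i * x i s)) y"
    using y xi s by (simp add: inner2_left L2_scale KV)
  finally show ?case using insert by simp
qed

text \<open>The form \<open>F x y = \<langle>K x, y\<rangle>\<close> satisfies \<open>F (p(T) x) y = F x (p(T) y)\<close> for every polynomial \<open>p\<close>.
  If \<open>p(T) v\<close> is close to the component \<open>n0\<close> of \<open>v\<close>, then \<open>p(T) n0\<close> is close to \<open>n0\<close> and
  \<open>p(T) w0\<close> is close to \<open>0\<close>, so that \<open>F n0 (T\<^sup>k w0) \<approx> F (p(T) n0) (T\<^sup>k w0) = F (T\<^sup>k n0) (p(T) w0) \<approx> 0\<close>.\<close>

lemma cyclic_antilinear_reducing: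
  assumes V: "subspace2 M V" and T: "bounded_linear_on M V T" and K: "bounded_antilinear_on M V K"
    and KT: "\<And>x y. x \<in> V \<Longrightarrow> y \<in> V \<Longrightarrow> inner2 M (K (T x)) y = inner2 M (K x) (T y)"
    and cyc: "cyclic_vector M V T v"
    and N: "subspace2 M N" "N \<subseteq> V" "\<And>x. x \<in> N \<Longrightarrow> T x \<in> N"
    and W: "subspace2 M W" "W \<subseteq> V" "\<And>x. x \<in> W \<Longrightarrow> T x \<in> W"
    and orth: "\<And>x y. x \<in> N \<Longrightarrow> y \<in> W \<Longrightarrow> inner2 M x y = 0"
    and v: "n0 \<in> N" "w0 \<in> W" "eq_ae M v (\<lambda>x. n0 x + w0 x)"
    and n: "n \<in> N" and w: "w \<in> W"
  shows "inner2 M (K n) w = 0"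
proof -
  have vV: "v \<in> V" using cyc by (simp add: cyclic_vector_def)
  have TV: "x \<in> V \<Longrightarrow> T x \<in> V" for x using bounded_linear_on_in[OF T] by blast
  have KV: "x \<in> V \<Longrightarrow> K x \<in> V" for x using bounded_antilinear_on_in[OF K] by blast
  have VL: "x \<in> V \<Longrightarrow> x \<in> L2 M" for x using subspace2D[OF V] .
  have TiV: "x \<in> V \<Longrightarrow> (T ^^ i) x \<in> V" for x i by (rule funpow_in[OF TV])
  have TiN: "x \<in> N \<Longrightarrow> (T ^^ i) x \<in> N" for x i by (rule funpow_in[OF N(3)])
  have TiW: "x \<in> W \<Longrightarrow> (T ^^ i) x \<in> W" for x i by (rule funpow_in[OF W(3)])
  have pN: "x \<in> N \<Longrightarrow> poly_op p T x \<in> N" for p x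
    unfolding poly_op_def by (intro subspace2_sum[OF N(1)] subspace2_scale[OF N(1)] TiN)
  have pW: "x \<in> W \<Longrightarrow> poly_op p T x \<in> W" for p x
    unfolding poly_op_def by (intro subspace2_sum[OF W(1)] subspace2_scale[OF W(1)] TiW)
  have pV: "x \<in> V \<Longrightarrow> poly_op p T x \<in> V" for p x
    unfolding poly_op_def by (intro subspace2_sum[OF V] subspace2_scale[OF V] TiV)
  have n0V: "n0 \<in> V" "w0 \<in> V" using v N W by auto
  have psplit: "eq_ae M (poly_op p T v) (\<lambda>x. poly_op p T n0 x + poly_op p T w0 x)" for p
  proof -
    have "eq_ae M ((T ^^ i) v) (\<lambda>x. (T ^^ i) n0 x + (T ^^ i) w0 x)" for i
    proof -
      have "eq_ae M ((T ^^ i) v) ((T ^^ i) (\<lambda>x. n0 x + w0 x))"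
        using v(3) n0V vV by (intro funpow_cong[OF V T] subspace2_add[OF V])
      also have "eq_ae M \<dots> (\<lambda>x. (T ^^ i) n0 x + (T ^^ i) w0 x)"
        using funpow_lincomb[OF V T n0V, of i 1 1] by simp
      finally show ?thesis .
    qed
    then have "eq_ae M (poly_op p T v) (\<lambda>x. \<Sum>i\<le>degree p. coeff p i * ((T ^^ i) n0 x + (T ^^ i) w0 x))"
      unfolding poly_op_def by (intro eq_ae_sum) (auto simp: eq_ae_def elim: AE_mp)
    then show ?thesis by (simp add: poly_op_def distrib_left sum.distrib)
  qed
  \<comment> \<open>The difference splits into \<open>x - p(T) n0\<close> in \<open>N\<close> and
    \<open>- p(T) w0\<close> in \<open>W\<close>; as these are orthogonal, each is no longer than
    their sum.\<close>
  have apprN: "norm2 M (\<lambda>s. x s - poly_op p T n0 s) \<le> norm2 M (\<lambda>s. x s - poly_op p T v s) \<and>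
      norm2 M (poly_op p T w0) \<le> norm2 M (\<lambda>s. x s - poly_op p T v s)" if x: "x \<in> N" for x p
  proof -
    define a where "a = (\<lambda>s. x s - poly_op p T n0 s)"
    define b where "b = (\<lambda>s. (-1) * poly_op p T w0 s)"
    have a: "a \<in> N" unfolding a_def by (intro subspace2_diff[OF N(1)] x pN v)
    have b: "b \<in> W" unfolding b_def by (intro subspace2_scale[OF W(1)] pW v)
    have ab: "a \<in> L2 M" "b \<in> L2 M" using a b N W VL by auto
    have "eq_ae M (\<lambda>s. x s - poly_op p T v s) (\<lambda>s. a s + b s)"
      using eq_ae_diff[OF eq_ae_refl[of M x] psplit[of p]] by (simp add: a_def b_def algebra_simps)
    then have "norm2 M (\<lambda>s. x s - poly_op p T v s) = norm2 M (\<lambda>s. a s + b s)"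
      using L2_diff[OF VL[of x] VL[OF pV[OF vV]]] x N by (intro norm2_cong L2_add ab) auto
    moreover have "(norm2 M (\<lambda>s. a s + b s))\<^sup>2 = (norm2 M a)\<^sup>2 + (norm2 M b)\<^sup>2"
      using a b by (intro pythagoras2 ab orth)
    moreover have "norm2 M b = norm2 M (poly_op p T w0)" unfolding b_def norm2_scale by simp
    ultimately have "(norm2 M a)\<^sup>2 \<le> (norm2 M (\<lambda>s. x s - poly_op p T v s))\<^sup>2"
      "(norm2 M (poly_op p T w0))\<^sup>2 \<le> (norm2 M (\<lambda>s. x s - poly_op p T v s))\<^sup>2"
      by simp_all
    then show ?thesis
      unfolding a_def[symmetric] by (intro conjI power2_le_imp_le[OF _ norm2_nonneg])
  qed
  have apprW: "norm2 M (\<lambda>s. x s - poly_op p T w0 s) \<le> norm2 M (\<lambda>s. x s - poly_op p T v s)"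
    if x: "x \<in> W" for x p
  proof -
    define a where "a = (\<lambda>s. x s - poly_op p T w0 s)"
    define b where "b = (\<lambda>s. (-1) * poly_op p T n0 s)"
    have a: "a \<in> W" unfolding a_def by (intro subspace2_diff[OF W(1)] x pW v)
    have b: "b \<in> N" unfolding b_def by (intro subspace2_scale[OF N(1)] pN v)
    have ab: "a \<in> L2 M" "b \<in> L2 M" using a b N W VL by auto
    have "eq_ae M (\<lambda>s. x s - poly_op p T v s) (\<lambda>s. b s + a s)"
      using eq_ae_diff[OF eq_ae_refl[of M x] psplit[of p]] by (simp add: a_def b_def algebra_simps)
    then have "norm2 M (\<lambda>s. x s - poly_op p T v s) = norm2 M (\<lambda>s. b s + a s)"
      using L2_diff[OF VL[of x] VL[OF pV[OF vV]]] x W by (intro norm2_cong L2_add ab) auto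
    moreover have "(norm2 M (\<lambda>s. b s + a s))\<^sup>2 = (norm2 M b)\<^sup>2 + (norm2 M a)\<^sup>2"
      using a b by (intro pythagoras2 ab orth)
    ultimately have "(norm2 M a)\<^sup>2 \<le> (norm2 M (\<lambda>s. x s - poly_op p T v s))\<^sup>2"
      by simp
    then show ?thesis
      unfolding a_def[symmetric] by (intro power2_le_imp_le[OF _ norm2_nonneg])
  qed
  obtain C where C: "C \<ge> 0" "\<And>x. x \<in> V \<Longrightarrow> norm2 M (K x) \<le> C * norm2 M x"
    by (rule bounded_antilinear_on_bound[OF K], rule that)
  have Fbd: "cmod (inner2 M (K x) y) \<le> C * norm2 M x * norm2 M y" if "x \<in> V" "y \<in> V" for x y
  proof -
    have "cmod (inner2 M (K x) y) \<le> norm2 M (K x) * norm2 M y"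
      using that by (intro cauchy_schwarz2 VL KV)
    also have "\<dots> \<le> C * norm2 M x * norm2 M y" using C(2)[OF that(1)] by (rule mult_right_mono) simp
    finally show ?thesis .
  qed
  have Fdiff: "inner2 M (K x) y - inner2 M (K x') y = inner2 M (K (\<lambda>s. x s - x' s)) y"
    if "x \<in> V" "x' \<in> V" "y \<in> V" for x x' y
  proof -
    have "eq_ae M (K (\<lambda>s. x s - x' s)) (\<lambda>s. K x s - K x' s)"
      using bounded_antilinear_on_lincomb[OF K that(1,2), of 1 "-1"] by simp
    then have "inner2 M (K (\<lambda>s. x s - x' s)) y = inner2 M (\<lambda>s. K x s - K x' s) y"
      using that by (intro inner2_cong) (auto intro!: L2_diff VL KV subspace2_diff[OF V])
    then show ?thesis using that by (simp add: inner2_left VL KV)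
  qed
  have Fi: "inner2 M (K ((T ^^ i) x)) y = inner2 M (K x) ((T ^^ i) y)" if "x \<in> V" "y \<in> V" for x y i
    using that
  proof (induction i arbitrary: x)
    case (Suc i)
    have "inner2 M (K ((T ^^ Suc i) x)) y = inner2 M (K ((T ^^ i) (T x))) y"
      by (simp add: funpow_swap1)
    also have "\<dots> = inner2 M (K x) (T ((T ^^ i) y))"
      using Suc by (simp add: TV KT TiV)
    finally show ?case by simp
  qed simp
  have Fij: "inner2 M (K ((T ^^ i) x)) ((T ^^ j) y) = inner2 M (K x) ((T ^^ (i + j)) y)"
    if "x \<in> V" "y \<in> V" for x y i j
    using Fi[OF that(1) TiV[OF that(2)]] by (simp add: funpow_add)
  \<comment> \<open>The coefficients come out conjugated from either argument, here by antilinearity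
    of \<open>K\<close>, in \<open>Fp'\<close> by conjugate linearity of the inner product. Hence
    the same polynomial, not its conjugate, changes sides.\<close>
  have Fp: "inner2 M (K (poly_op p T x)) y = (\<Sum>i\<le>degree p. cnj (coeff p i) * inner2 M (K ((T ^^ i) x)) y)"
    if "x \<in> V" "y \<in> V" for p x y
    unfolding poly_op_def using that by (intro inner2_antilinear_sum[OF V K] VL TiV) auto
  have Fp': "inner2 M (K x) (poly_op p T y) = (\<Sum>i\<le>degree p. cnj (coeff p i) * inner2 M (K x) ((T ^^ i) y))"
    if "x \<in> V" "y \<in> V" for p x y
    unfolding poly_op_def using that by (simp add: inner2_right L2_scale VL TiV KV)
  have A: "inner2 M (K n0) ((T ^^ k) w0) = 0" for k
  proof (rule zero_by_eps[where c="C * norm2 M ((T ^^ k) w0) + norm2 M (K ((T ^^ k) n0))"])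
    fix e :: real assume e: "e > 0"
    obtain p where "norm2 M (\<lambda>x. n0 x - poly_op p T v x) < e"
      using cyc n0V e unfolding cyclic_vector_def by blast
    then have p: "norm2 M (\<lambda>s. n0 s - poly_op p T n0 s) \<le> e" "norm2 M (poly_op p T w0) \<le> e"
      using apprN[OF v(1), of p] by auto
    have "inner2 M (K (poly_op p T n0)) ((T ^^ k) w0)
        = (\<Sum>i\<le>degree p. cnj (coeff p i) * inner2 M (K ((T ^^ i) n0)) ((T ^^ k) w0))"
      by (intro Fp TiV n0V)
    \<comment> \<open>By \<open>Fij\<close> the form depends on the two exponents only through their
      sum, so they may be exchanged.\<close>
    also have "\<dots> = (\<Sum>i\<le>degree p. cnj (coeff p i) * inner2 M (K ((T ^^ k) n0)) ((T ^^ i) w0))"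
      using Fij[OF n0V] Fij[OF n0V, of k] by (intro sum.cong refl) (simp add: add.commute)
    also have "\<dots> = inner2 M (K ((T ^^ k) n0)) (poly_op p T w0)"
      by (intro Fp'[symmetric] TiV n0V)
    finally have eq: "inner2 M (K (poly_op p T n0)) ((T ^^ k) w0) = inner2 M (K ((T ^^ k) n0)) (poly_op p T w0)" .
    have "inner2 M (K n0) ((T ^^ k) w0) = inner2 M (K (\<lambda>s. n0 s - poly_op p T n0 s)) ((T ^^ k) w0)
        + inner2 M (K ((T ^^ k) n0)) (poly_op p T w0)"
      using Fdiff[of n0 "poly_op p T n0" "(T ^^ k) w0"] n0V
      by (simp add: pV TiV diff_eq_eq flip: eq)
    then have "cmod (inner2 M (K n0) ((T ^^ k) w0))
        \<le> cmod (inner2 M (K (\<lambda>s. n0 s - poly_op p T n0 s)) ((T ^^ k) w0))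
        + cmod (inner2 M (K ((T ^^ k) n0)) (poly_op p T w0))" by (simp only: norm_triangle_ineq)
    also have "\<dots> \<le> C * norm2 M (\<lambda>s. n0 s - poly_op p T n0 s) * norm2 M ((T ^^ k) w0)
        + norm2 M (K ((T ^^ k) n0)) * norm2 M (poly_op p T w0)"
      using n0V by (intro add_mono Fbd cauchy_schwarz2 VL KV TiV pV subspace2_diff[OF V])
    also have "\<dots> \<le> C * e * norm2 M ((T ^^ k) w0) + norm2 M (K ((T ^^ k) n0)) * e"
      using p C by (intro add_mono mult_mono mult_left_mono mult_right_mono) auto
    finally show "cmod (inner2 M (K n0) ((T ^^ k) w0)) \<le> e * (C * norm2 M ((T ^^ k) w0) + norm2 M (K ((T ^^ k) n0)))"
      by (simp add: algebra_simps)
  qed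
  have B: "inner2 M (K (poly_op p T n0)) (poly_op q T w0) = 0" for p q
  proof -
    have "inner2 M (K ((T ^^ i) n0)) ((T ^^ j) w0) = 0" for i j
      using Fij[OF n0V] A by simp
    then have "inner2 M (K ((T ^^ i) n0)) (poly_op q T w0) = 0" for i
      using n0V by (simp add: Fp' TiV)
    then show ?thesis using n0V by (simp add: Fp pV)
  qed
  \<comment> \<open>Splitting the orbit of the cyclic vector shows that the vectors
    \<open>p(T) n0\<close> are dense in \<open>N\<close> and the vectors \<open>q(T) w0\<close>
    dense in \<open>W\<close>. The second argument is extended to all of \<open>W\<close> here, the
    first to all of \<open>N\<close> below.\<close>
  have B': "inner2 M (K (poly_op p T n0)) w = 0" for p
  proof (rule zero_by_eps)
    fix e :: real assume e: "e > 0"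
    have wV: "w \<in> V" using w W by auto
    obtain q where "norm2 M (\<lambda>x. w x - poly_op q T v x) < e"
      using cyc wV e unfolding cyclic_vector_def by blast
    then have q: "norm2 M (\<lambda>s. w s - poly_op q T w0 s) \<le> e" using apprW[OF w, of q] by auto
    have "inner2 M (K (poly_op p T n0)) w = inner2 M (K (poly_op p T n0)) (\<lambda>s. w s - poly_op q T w0 s)"
      using n0V wV B[of p q] by (simp add: inner2_right VL KV pV)
    also have "cmod \<dots> \<le> norm2 M (K (poly_op p T n0)) * norm2 M (\<lambda>s. w s - poly_op q T w0 s)"
      using n0V wV by (intro cauchy_schwarz2 L2_diff VL KV pV)
    also have "\<dots> \<le> norm2 M (K (poly_op p T n0)) * e" using q by (rule mult_left_mono) simp
    finally show "cmod (inner2 M (K (poly_op p T n0)) w) \<le> e * norm2 M (K (poly_op p T n0))"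
      by (simp add: mult.commute)
  qed
  show ?thesis
  proof (rule zero_by_eps)
    fix e :: real assume e: "e > 0"
    have wV: "w \<in> V" and nV: "n \<in> V" using w W n N by auto
    obtain p where "norm2 M (\<lambda>x. n x - poly_op p T v x) < e"
      using cyc nV e unfolding cyclic_vector_def by blast
    then have p: "norm2 M (\<lambda>s. n s - poly_op p T n0 s) \<le> e" using apprN[OF n, of p] by auto
    have "inner2 M (K n) w = inner2 M (K (\<lambda>s. n s - poly_op p T n0 s)) w"
      using Fdiff[of n "poly_op p T n0" w] n0V nV wV B'[of p] by (simp add: pV)
    also have "cmod \<dots> \<le> C * norm2 M (\<lambda>s. n s - poly_op p T n0 s) * norm2 M w"
      using n0V nV wV by (intro Fbd subspace2_diff[OF V] pV)
    also have "\<dots> \<le> C * e * norm2 M w" using p C by (intro mult_left_mono mult_right_mono) auto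
    finally show "cmod (inner2 M (K n) w) \<le> e * (C * norm2 M w)" by (simp add: mult_ac)
  qed
qed

text \<open>The partial sums converge in norm, but \<open>T\<close> is merely a choice of a limit
  for each vector. Its linearity and both inverse identities are therefore checked weakly, by
  comparing the series of inner products with an arbitrary \<open>q\<close>, and then turned into
  almost everywhere identities.\<close>

lemma neumann_series:
  assumes S: "contraction_on M (L2 M) S" and z: "cmod z < 1"
  obtains T where "inverse_on M (L2 M) (\<lambda>f s. f s - z * S f s) T"
    "\<And>f q. f \<in> L2 M \<Longrightarrow> q \<in> L2 M \<Longrightarrow> (\<lambda>j. z ^ j * inner2 M ((S ^^ j) f) q) sums inner2 M (T f) q"
proof -
  note V = subspace2_L2[of M]
  have bl: "bounded_linear_on M (L2 M) S" and Sn: "\<And>f. f \<in> L2 M \<Longrightarrow> norm2 M (S f) \<le> norm2 M f"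
    using S by (auto simp: contraction_on_def)
  have SL: "f \<in> L2 M \<Longrightarrow> S f \<in> L2 M" for f using bounded_linear_on_in[OF bl] by blast
  have SjL: "f \<in> L2 M \<Longrightarrow> (S ^^ j) f \<in> L2 M" for f j by (rule funpow_in[OF SL])
  have Sjn: "norm2 M ((S ^^ j) f) \<le> norm2 M f" if "f \<in> L2 M" for f j
    using that Sn[OF SjL] by (induction j) (auto intro: order_trans)
  define P where "P n f = (\<lambda>x. \<Sum>j<n. z ^ j * (S ^^ j) f x)" for n :: nat and f
  have PL: "f \<in> L2 M \<Longrightarrow> P n f \<in> L2 M" for n f
    unfolding P_def by (intro L2_sum L2_scale SjL)
  define s where "s n = (\<Sum>j<n. cmod z ^ j)" for n :: nat
  have s_lim: "s \<longlonglongrightarrow> 1 / (1 - cmod z)"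
    using geometric_sums[of "cmod z"] z unfolding s_def[abs_def] sums_def by simp
  have s_le: "s n \<le> 1 / (1 - cmod z)" for n
    using s_lim by (rule incseq_le[rotated]) (auto simp: s_def incseq_def intro!: sum_mono2)
  have Pdiff: "norm2 M (\<lambda>x. P n f x - P m f x) \<le> (s n - s m) * norm2 M f" if f: "f \<in> L2 M" and mn: "m \<le> n" for m n f
  proof -
    have eq: "(\<Sum>j<n. g j) - (\<Sum>j<m. g j) = (\<Sum>j=m..<n. g j)" for g :: "nat \<Rightarrow> 'b::ab_group_add"
      using mn sum_diff_nat_ivl[of 0 m n g] by (simp add: lessThan_atLeast0)
    have "norm2 M (\<lambda>x. P n f x - P m f x) = norm2 M (\<lambda>x. \<Sum>j=m..<n. z ^ j * (S ^^ j) f x)"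
      by (simp add: P_def eq)
    also have "\<dots> \<le> (\<Sum>j=m..<n. norm2 M (\<lambda>x. z ^ j * (S ^^ j) f x))"
      by (intro norm2_sum L2_scale SjL f)
    also have "\<dots> \<le> (\<Sum>j=m..<n. cmod z ^ j * norm2 M f)"
      unfolding norm2_scale norm_power by (intro sum_mono mult_left_mono Sjn f) auto
    finally show ?thesis by (simp add: s_def eq sum_distrib_right)
  qed
  have "\<exists>g. g \<in> L2 M \<and> (\<lambda>n. norm2 M (\<lambda>x. P n f x - g x)) \<longlonglongrightarrow> 0" if f: "f \<in> L2 M" for f
  proof -
    have "\<exists>N. \<forall>m\<ge>N. \<forall>n\<ge>N. norm2 M (\<lambda>x. P m f x - P n f x) < e" if e: "e > 0" for e
    proof -
      define c where "c = norm2 M f + 1"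
      have c: "c > 0" by (simp add: c_def add_nonneg_pos)
      have "Cauchy s" using s_lim by (rule LIMSEQ_imp_Cauchy)
      then obtain N where N: "\<And>m n. m \<ge> N \<Longrightarrow> n \<ge> N \<Longrightarrow> \<bar>s m - s n\<bar> < e / c"
        unfolding Cauchy_def dist_real_def using e c by (meson divide_pos_pos)
      have le: "norm2 M (\<lambda>x. P n f x - P m f x) < e" if "m \<ge> N" "n \<ge> m" for m n
      proof -
        have "norm2 M (\<lambda>x. P n f x - P m f x) \<le> \<bar>s n - s m\<bar> * norm2 M f"
          using Pdiff[OF f that(2)] mult_right_mono[OF abs_ge_self[of "s n - s m"] norm2_nonneg[of M f]] by linarith
        also have "\<dots> \<le> \<bar>s n - s m\<bar> * c" by (intro mult_left_mono) (auto simp: c_def)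
        also have "\<dots> < e / c * c" using N[of n m] that c by (intro mult_strict_right_mono) auto
        finally show ?thesis using c by simp
      qed
      have "norm2 M (\<lambda>x. P m f x - P n f x) < e" if "m \<ge> N" "n \<ge> N" for m n
        using le[of m n] le[of n m] that norm2_minus_commute[of M "P m f" "P n f"] by (cases "m \<le> n") auto
      then show ?thesis by blast
    qed
    from L2_complete[of "\<lambda>n. P n f" M, OF PL[OF f] this] obtain g
      where "g \<in> L2 M" "(\<lambda>n. norm2 M (\<lambda>x. P n f x - g x)) \<longlonglongrightarrow> 0" .
    then show ?thesis by blast
  qed
  then obtain T where TL: "\<And>f. f \<in> L2 M \<Longrightarrow> T f \<in> L2 M"
    and Tlim: "\<And>f. f \<in> L2 M \<Longrightarrow> (\<lambda>n. norm2 M (\<lambda>x. P n f x - T f x)) \<longlonglongrightarrow> 0"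
    by metis
  have sums: "(\<lambda>j. z ^ j * inner2 M ((S ^^ j) f) q) sums inner2 M (T f) q" if f: "f \<in> L2 M" and q: "q \<in> L2 M" for f q
  proof -
    have "(\<lambda>n. inner2 M (P n f) q) \<longlonglongrightarrow> inner2 M (T f) q"
      by (rule tendsto_inner2[OF PL[OF f] TL[OF f] q Tlim[OF f]])
    then show ?thesis
      unfolding sums_def P_def using f q by (simp add: inner2_left L2_scale SjL)
  qed
  have sums': "(\<lambda>j. z ^ j * inner2 M ((S ^^ j) (S f)) q) sums ((inner2 M (T f) q - inner2 M f q) / z)"
    if f: "f \<in> L2 M" and q: "q \<in> L2 M" and z0: "z \<noteq> 0" for f q
  proof -
    have "(\<lambda>j. z ^ Suc j * inner2 M ((S ^^ Suc j) f) q) sums (inner2 M (T f) q - inner2 M f q)"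
      using sums[OF f q] by (subst sums_Suc_iff) simp
    then have "(\<lambda>j. z ^ Suc j * inner2 M ((S ^^ Suc j) f) q / z) sums ((inner2 M (T f) q - inner2 M f q) / z)"
      by (rule sums_divide)
    then show ?thesis using z0 by (simp add: funpow_swap1)
  qed
  \<comment> \<open>Without its first term the series for \<open>T f\<close> is \<open>z\<close>
    times the series for \<open>T (S f)\<close>. The fact \<open>sums'\<close> divides by
    \<open>z\<close>; for \<open>z = 0\<close> only the first term is left.\<close>
  have TS: "z * inner2 M (T (S f)) q = inner2 M (T f) q - inner2 M f q" if f: "f \<in> L2 M" and q: "q \<in> L2 M" for f q
  proof (cases "z = 0")
    case True
    then have "(\<lambda>j. z ^ j * inner2 M ((S ^^ j) f) q) = (\<lambda>j. if j = 0 then inner2 M ((S ^^ j) f) q else 0)"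
      by (auto simp: fun_eq_iff power_0_left)
    then have "(\<lambda>j. z ^ j * inner2 M ((S ^^ j) f) q) sums inner2 M f q"
      using sums_single[of 0 "\<lambda>j. inner2 M ((S ^^ j) f) q"] by simp
    then show ?thesis using sums[OF f q] sums_unique2 True by fastforce
  next
    case False
    then show ?thesis using sums_unique2[OF sums'[OF f q] sums[OF SL[OF f] q]] by (simp add: field_simps)
  qed
  have Tlin: "inner2 M (T (\<lambda>x. a * f x + b * g x)) q = a * inner2 M (T f) q + b * inner2 M (T g) q"
    if f: "f \<in> L2 M" and g: "g \<in> L2 M" and q: "q \<in> L2 M" for f g q a b
  proof -
    have "inner2 M ((S ^^ j) (\<lambda>x. a * f x + b * g x)) q
        = a * inner2 M ((S ^^ j) f) q + b * inner2 M ((S ^^ j) g) q" for j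
    proof -
      have "inner2 M ((S ^^ j) (\<lambda>x. a * f x + b * g x)) q = inner2 M (\<lambda>x. a * (S ^^ j) f x + b * (S ^^ j) g x) q"
        using f g q by (intro inner2_cong funpow_lincomb[OF V bl] SjL L2_lincomb) auto
      then show ?thesis using f g q by (simp add: inner2_left L2_scale SjL)
    qed
    then have "(\<lambda>j. z ^ j * inner2 M ((S ^^ j) (\<lambda>x. a * f x + b * g x)) q)
        = (\<lambda>j. a * (z ^ j * inner2 M ((S ^^ j) f) q) + b * (z ^ j * inner2 M ((S ^^ j) g) q))"
      by (auto simp: algebra_simps)
    moreover have "(\<lambda>j. a * (z ^ j * inner2 M ((S ^^ j) f) q) + b * (z ^ j * inner2 M ((S ^^ j) g) q))
        sums (a * inner2 M (T f) q + b * inner2 M (T g) q)"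
      by (intro sums_add sums_mult sums f g q)
    ultimately show ?thesis using sums_unique2[OF sums[OF L2_lincomb[OF f g] q, of a b]] by simp
  qed
  \<comment> \<open>\<open>S\<close> passes to the limit because it does not increase norms, and it
    commutes with each partial sum by linearity.\<close>
  have ST: "inner2 M (S (T f)) q = inner2 M (T (S f)) q" if f: "f \<in> L2 M" and q: "q \<in> L2 M" for f q
  proof (rule LIMSEQ_unique)
    show "(\<lambda>n. inner2 M (S (P n f)) q) \<longlonglongrightarrow> inner2 M (S (T f)) q"
    proof (rule tendsto_inner2)
      show "(\<lambda>n. norm2 M (\<lambda>x. S (P n f) x - S (T f) x)) \<longlonglongrightarrow> 0"
      proof (rule Lim_null_comparison[OF _ Tlim[OF f]], intro always_eventually allI)
        fix n
        show "norm (norm2 M (\<lambda>x. S (P n f) x - S (T f) x)) \<le> norm2 M (\<lambda>x. P n f x - T f x)"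
          using bounded_linear_on_diff[OF V bl PL[OF f] TL[OF f]] Sn[OF L2_diff[OF PL[OF f] TL[OF f]]] by simp
      qed
    qed (intro SL PL TL f q)+
    have "inner2 M (S (P n f)) q = inner2 M (P n (S f)) q" for n
    proof (induction n)
      case 0
      have "eq_ae M (S (\<lambda>x. 0)) (\<lambda>x. 0)"
        using bounded_linear_on_lincomb[OF bl zero_in_L2 zero_in_L2, of 0 0] by simp
      then show ?case using q by (simp add: P_def) (subst inner2_cong[where f'="\<lambda>x. 0" and g'=q], auto intro: SL)
    next
      case (Suc n)
      have "eq_ae M (S (\<lambda>x. 1 * P n f x + z ^ n * (S ^^ n) f x)) (\<lambda>x. 1 * S (P n f) x + z ^ n * S ((S ^^ n) f) x)"
        by (intro bounded_linear_on_lincomb[OF bl] PL SjL f)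
      then have "inner2 M (S (P (Suc n) f)) q = inner2 M (\<lambda>x. S (P n f) x + z ^ n * S ((S ^^ n) f) x) q"
        using f q unfolding P_def by (intro inner2_cong) (auto intro!: SL SjL L2_add L2_scale L2_sum)
      also have "\<dots> = inner2 M (P n (S f)) q + z ^ n * inner2 M ((S ^^ n) (S f)) q"
        using f q Suc by (simp add: inner2_left L2_scale SL SjL PL funpow_swap1)
      also have "\<dots> = inner2 M (P (Suc n) (S f)) q"
        using f q by (simp add: P_def inner2_left L2_scale SL SjL L2_sum)
      finally show ?case .
    qed
    then show "(\<lambda>n. inner2 M (S (P n f)) q) \<longlonglongrightarrow> inner2 M (T (S f)) q"
      using tendsto_inner2[OF PL[OF SL[OF f]] TL[OF SL[OF f]] q Tlim[OF SL[OF f]]] by simp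
  qed
  have Tn: "norm2 M (T f) \<le> 1 / (1 - cmod z) * norm2 M f" if f: "f \<in> L2 M" for f
  proof (rule LIMSEQ_le_const)
    show "(\<lambda>n. 1 / (1 - cmod z) * norm2 M f + norm2 M (\<lambda>x. P n f x - T f x)) \<longlonglongrightarrow> 1 / (1 - cmod z) * norm2 M f"
      using tendsto_add[OF tendsto_const Tlim[OF f]] by simp
    have "norm2 M (T f) \<le> 1 / (1 - cmod z) * norm2 M f + norm2 M (\<lambda>x. P n f x - T f x)" for n
    proof -
      have "norm2 M (P n f) \<le> s n * norm2 M f" using Pdiff[OF f, of 0 n] by (simp add: P_def s_def)
      also have "\<dots> \<le> 1 / (1 - cmod z) * norm2 M f" using s_le by (rule mult_right_mono) simp
      finally show ?thesis
        using norm2_diff_le[OF TL[OF f] PL[OF f], of n] norm2_minus_commute[of M "P n f" "T f"] by linarith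
    qed
    then show "\<exists>N. \<forall>n\<ge>N. norm2 M (T f) \<le> 1 / (1 - cmod z) * norm2 M f + norm2 M (\<lambda>x. P n f x - T f x)"
      by blast
  qed
  have "inverse_on M (L2 M) (\<lambda>f s. f s - z * S f s) T"
    unfolding inverse_on_def bounded_linear_on_def
  proof (intro conjI ballI allI)
    fix f g a b assume fg: "f \<in> L2 M" "g \<in> L2 M"
    show "eq_ae M (T (\<lambda>x. a * f x + b * g x)) (\<lambda>x. a * T f x + b * T g x)"
      using fg by (intro eq_ae_by_inner2[OF V]) (auto simp: Tlin inner2_left L2_scale TL intro: TL L2_lincomb)
  next
    show "\<exists>C. \<forall>f\<in>L2 M. norm2 M (T f) \<le> C * norm2 M f" using Tn by blast
  next
    fix f assume f: "f \<in> L2 M"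
    show "eq_ae M (\<lambda>s. T f s - z * S (T f) s) f"
      using f by (intro eq_ae_by_inner2[OF V])
        (auto simp: inner2_left L2_scale TL SL ST TS intro!: L2_diff)
    have "inner2 M (T (\<lambda>s. f s - z * S f s)) q = inner2 M f q" if q: "q \<in> L2 M" for q
      using Tlin[OF f SL[OF f] q, of 1 "- z"] TS[OF f q] by simp
    then show "eq_ae M (T (\<lambda>s. f s - z * S f s)) f"
      using f by (intro eq_ae_by_inner2[OF V]) (auto intro!: TL L2_diff L2_scale SL)
  qed (rule TL)
  with sums show thesis by (intro that) auto
qed

section \<open>Hankel operators\<close>

lemma bounded_linear_comp_antilinear:
  assumes V: "subspace2 M V" and S: "bounded_linear_on M V S" and K: "bounded_antilinear_on M V K"
  shows "bounded_antilinear_on M V (S \<circ> K)"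
proof -
  obtain C where C: "C \<ge> 0" "\<And>f. f \<in> V \<Longrightarrow> norm2 M (S f) \<le> C * norm2 M f"
    by (rule bounded_linear_on_bound[OF S], rule that)
  obtain D where D: "D \<ge> 0" "\<And>f. f \<in> V \<Longrightarrow> norm2 M (K f) \<le> D * norm2 M f"
    by (rule bounded_antilinear_on_bound[OF K], rule that)
  show ?thesis
    unfolding bounded_antilinear_on_def comp_def
  proof (intro conjI ballI allI exI)
    fix f g a b assume fg: "f \<in> V" "g \<in> V"
    note Kfg = bounded_antilinear_on_in[OF K fg(1)] bounded_antilinear_on_in[OF K fg(2)]
    have "eq_ae M (S (K (\<lambda>x. a * f x + b * g x))) (S (\<lambda>x. cnj a * K f x + cnj b * K g x))"
      by (intro bounded_linear_on_cong[OF V S] bounded_antilinear_on_in[OF K] subspace2_lincomb[OF V]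
          bounded_antilinear_on_lincomb[OF K] fg)
    also have "eq_ae M \<dots> (\<lambda>x. cnj a * S (K f) x + cnj b * S (K g) x)"
      by (rule bounded_linear_on_lincomb[OF S Kfg])
    finally show "eq_ae M (S (K (\<lambda>x. a * f x + b * g x))) (\<lambda>x. cnj a * S (K f) x + cnj b * S (K g) x)" .
  next
    fix f assume f: "f \<in> V"
    note Kf = bounded_antilinear_on_in[OF K f]
    show "S (K f) \<in> V" by (rule bounded_linear_on_in[OF S Kf])
    show "norm2 M (S (K f)) \<le> (C * D) * norm2 M f"
      using C(2)[OF Kf] mult_left_mono[OF D(2)[OF f] C(1)] by (simp add: mult.assoc)
  qed
qed

lemma bounded_antilinear_comp:
  assumes V: "subspace2 M V" and S: "bounded_antilinear_on M V S" and K: "bounded_antilinear_on M V K"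
  shows "bounded_linear_on M V (S \<circ> K)"
proof -
  obtain C where C: "C \<ge> 0" "\<And>f. f \<in> V \<Longrightarrow> norm2 M (S f) \<le> C * norm2 M f"
    by (rule bounded_antilinear_on_bound[OF S], rule that)
  obtain D where D: "D \<ge> 0" "\<And>f. f \<in> V \<Longrightarrow> norm2 M (K f) \<le> D * norm2 M f"
    by (rule bounded_antilinear_on_bound[OF K], rule that)
  show ?thesis
    unfolding bounded_linear_on_def comp_def
  proof (intro conjI ballI allI exI)
    fix f g a b assume fg: "f \<in> V" "g \<in> V"
    note Kfg = bounded_antilinear_on_in[OF K fg(1)] bounded_antilinear_on_in[OF K fg(2)]
    have "eq_ae M (S (K (\<lambda>x. a * f x + b * g x))) (S (\<lambda>x. cnj a * K f x + cnj b * K g x))"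
      by (intro bounded_antilinear_on_cong[OF V S] bounded_antilinear_on_in[OF K] subspace2_lincomb[OF V]
          bounded_antilinear_on_lincomb[OF K] fg)
    also have "eq_ae M \<dots> (\<lambda>x. a * S (K f) x + b * S (K g) x)"
      using bounded_antilinear_on_lincomb[OF S Kfg, of "cnj a" "cnj b"] by simp
    finally show "eq_ae M (S (K (\<lambda>x. a * f x + b * g x))) (\<lambda>x. a * S (K f) x + b * S (K g) x)" .
  next
    fix f assume f: "f \<in> V"
    note Kf = bounded_antilinear_on_in[OF K f]
    show "S (K f) \<in> V" by (rule bounded_antilinear_on_in[OF S Kf])
    show "norm2 M (S (K f)) \<le> (C * D) * norm2 M f"
      using C(2)[OF Kf] mult_left_mono[OF D(2)[OF f] C(1)] by (simp add: mult.assoc)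
  qed
qed

lemma bounded_antilinear_on_restrict:
  assumes "bounded_antilinear_on M V K" "W \<subseteq> V" "\<And>f. f \<in> W \<Longrightarrow> K f \<in> W"
  shows "bounded_antilinear_on M W K"
  using assms unfolding bounded_antilinear_on_def by (meson subsetD)

lemma bounded_linear_shift_star: "bounded_linear_on circ H2 shift_star"
  unfolding bounded_linear_on_def
proof (intro conjI ballI allI exI)
  fix f g a b assume fg: "f \<in> H2" "g \<in> H2"
  show "eq_ae circ (shift_star (\<lambda>x. a * f x + b * g x)) (\<lambda>x. a * shift_star f x + b * shift_star g x)"
  proof (rule eq_ae_by_inner2[OF subspace2_H2])
    fix k assume k: "k \<in> H2"
    note L = H2_L2[OF fg(1)] H2_L2[OF fg(2)] H2_L2[OF shift_in[OF k]] H2_L2[OF k]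
      H2_L2[OF shift_star_in[OF fg(1)]] H2_L2[OF shift_star_in[OF fg(2)]]
    show "inner2 circ (shift_star (\<lambda>x. a * f x + b * g x)) k
        = inner2 circ (\<lambda>x. a * shift_star f x + b * shift_star g x) k"
      using fg k L by (simp add: shift_star_adj' subspace2_lincomb[OF subspace2_H2] inner2_left L2_scale)
  qed (intro shift_star_in subspace2_lincomb[OF subspace2_H2] fg)+
next
  fix f assume "f \<in> H2"
  then show "shift_star f \<in> H2" "norm2 circ (shift_star f) \<le> 1 * norm2 circ f"
    using shift_star_in norm_shift_star by auto
qed

text \<open>The formula for \<open>H\<close> can be evaluated directly on polynomials; this carries
  identities from there to \<open>H2\<close> by density. \<open>G\<close> is asked only to respect
  differences, so that forms conjugate linear in both arguments are covered.\<close>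

lemma H2_form_eq_0:
  assumes bound: "\<And>x y. x \<in> H2 \<Longrightarrow> y \<in> H2 \<Longrightarrow> cmod (G x y) \<le> C * norm2 circ x * norm2 circ y"
    and left: "\<And>x x' y. x \<in> H2 \<Longrightarrow> x' \<in> H2 \<Longrightarrow> y \<in> H2 \<Longrightarrow> G (\<lambda>z. x z - x' z) y = G x y - G x' y"
    and right: "\<And>x y y'. x \<in> H2 \<Longrightarrow> y \<in> H2 \<Longrightarrow> y' \<in> H2 \<Longrightarrow> G x (\<lambda>z. y z - y' z) = G x y - G x y'"
    and poly: "\<And>p q. G (poly p) (poly q) = 0"
    and C: "C \<ge> 0" and x: "x \<in> H2" and y: "y \<in> H2"
  shows "G x y = 0"
proof -
  note D = subspace2_diff[OF subspace2_H2]
  have 1: "G (poly p) y = 0" for p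
  proof (rule zero_by_eps)
    fix e :: real assume e: "e > 0"
    obtain q where q: "norm2 circ (\<lambda>z. y z - poly q z) < e" using H2_poly_dense[OF y e] by blast
    have "cmod (G (poly p) y) = cmod (G (poly p) (\<lambda>z. y z - poly q z))"
      using right[OF H2_poly y H2_poly, of p q] poly by simp
    also have "\<dots> \<le> C * norm2 circ (poly p) * norm2 circ (\<lambda>z. y z - poly q z)"
      by (intro bound D y H2_poly)
    also have "\<dots> \<le> C * norm2 circ (poly p) * e" using q C by (intro mult_left_mono) auto
    finally show "cmod (G (poly p) y) \<le> e * (C * norm2 circ (poly p))" by (simp add: mult_ac)
  qed
  show ?thesis
  proof (rule zero_by_eps)
    fix e :: real assume e: "e > 0"
    obtain p where p: "norm2 circ (\<lambda>z. x z - poly p z) < e" using H2_poly_dense[OF x e] by blast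
    have "cmod (G x y) = cmod (G (\<lambda>z. x z - poly p z) y)"
      using left[OF x H2_poly y, of p] 1 by simp
    also have "\<dots> \<le> C * norm2 circ (\<lambda>z. x z - poly p z) * norm2 circ y"
      by (intro bound D x y H2_poly)
    also have "\<dots> \<le> C * e * norm2 circ y" using p C by (intro mult_left_mono mult_right_mono) auto
    finally show "cmod (G x y) \<le> e * (C * norm2 circ y)" by (simp add: mult_ac)
  qed
qed

section \<open>Symmetry, shift relation and uniqueness of the Hankel operator\<close>

locale hankel_op =
  fixes u and H
  assumes u: "u \<in> H2" and H: "is_hankel u H"
begin

lemma anti: "bounded_antilinear_on circ H2 H"
  using H by (simp add: is_hankel_def)

lemma H_in: "f \<in> H2 \<Longrightarrow> H f \<in> H2"
  by (rule bounded_antilinear_on_in[OF anti])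

lemma H_L2: "f \<in> H2 \<Longrightarrow> H f \<in> L2 circ"
  by (intro H2_L2 H_in)

lemma H_bound:
  obtains C where "C \<ge> 0" "\<And>f. f \<in> H2 \<Longrightarrow> norm2 circ (H f) \<le> C * norm2 circ f"
    "\<And>f g. f \<in> H2 \<Longrightarrow> g \<in> H2 \<Longrightarrow> cmod (inner2 circ (H f) g) \<le> C * norm2 circ f * norm2 circ g"
proof -
  obtain C where C: "C \<ge> 0" "\<And>f. f \<in> H2 \<Longrightarrow> norm2 circ (H f) \<le> C * norm2 circ f"
    by (rule bounded_antilinear_on_bound[OF anti], rule that)
  have "cmod (inner2 circ (H f) g) \<le> C * norm2 circ f * norm2 circ g" if "f \<in> H2" "g \<in> H2" for f g
  proof -
    have "cmod (inner2 circ (H f) g) \<le> norm2 circ (H f) * norm2 circ g"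
      using that by (intro cauchy_schwarz2 H_L2 H2_L2)
    also have "\<dots> \<le> C * norm2 circ f * norm2 circ g" using C(2)[OF that(1)] by (rule mult_right_mono) simp
    finally show ?thesis .
  qed
  with C show thesis by (rule that)
qed

lemma H_diff:
  assumes "f \<in> H2" "g \<in> H2" "k \<in> L2 circ"
  shows "inner2 circ (H (\<lambda>z. f z - g z)) k = inner2 circ (H f) k - inner2 circ (H g) k"
proof -
  have "eq_ae circ (H (\<lambda>z. f z - g z)) (\<lambda>z. H f z - H g z)"
    using bounded_antilinear_on_lincomb[OF anti assms(1,2), of 1 "-1"] by simp
  then have "inner2 circ (H (\<lambda>z. f z - g z)) k = inner2 circ (\<lambda>z. H f z - H g z) k"
    using assms by (intro inner2_cong L2_diff H_L2 subspace2_diff[OF subspace2_H2]) auto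
  then show ?thesis using assms by (simp add: inner2_left H_L2)
qed

text \<open>A polynomial is bounded on the circle, so \<open>u * cnj p\<close> is square integrable
  and the defining formula applies; testing with \<open>k\<close> in \<open>H2\<close> removes the
  projection.\<close>

lemma H_poly:
  assumes k: "k \<in> H2"
  shows "inner2 circ (H (poly p)) k = (\<integral>z. u z * cnj (poly p z) * cnj (k z) \<partial>circ)"
proof -
  have [measurable]: "poly p \<in> borel_measurable borel" using L2_measurable[OF poly_L2[of p]] by simp
  have "bounded (poly p ` sphere 0 1)"
    by (intro compact_imp_bounded compact_continuous_image continuous_intros compact_sphere)
  then obtain C where "\<forall>z\<in>sphere 0 1. cmod (poly p z) \<le> C" by (auto simp: bounded_iff)
  then have "(\<lambda>z. cnj (poly p z) * u z) \<in> L2 circ"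
    by (intro circ_L2_mult[where C=C] H2_L2[OF u] borel_measurable_cnj) auto
  then have L: "(\<lambda>z. u z * cnj (poly p z)) \<in> L2 circ" by (simp add: mult.commute)
  then have "szego_projection (\<lambda>z. u z * cnj (poly p z)) (H (poly p))"
    using H H2_poly[of p] by (simp add: is_hankel_def)
  then have "inner2 circ (\<lambda>z. u z * cnj (poly p z) - H (poly p) z) k = 0"
    using k by (simp add: szego_projection_def)
  then have "inner2 circ (H (poly p)) k = inner2 circ (\<lambda>z. u z * cnj (poly p z)) k"
    using L k H2_L2 H_L2[OF H2_poly] by (simp add: inner2_left)
  then show ?thesis by (simp add: inner2_def)
qed

lemma H_one: "eq_ae circ (H (\<lambda>z. 1)) u"
proof (rule eq_ae_by_inner2[OF subspace2_H2])
  have one: "poly 1 = (\<lambda>z::complex. 1)" by auto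
  fix k assume "k \<in> H2"
  then show "inner2 circ (H (\<lambda>z. 1)) k = inner2 circ u k"
    using H_poly[of k 1] unfolding one by (simp add: inner2_def)
qed (use u H_in in auto)

text \<open>On polynomials both sides are the integral of \<open>u * cnj p * cnj q\<close>.\<close>

lemma H_sym:
  assumes "f \<in> H2" "g \<in> H2"
  shows "inner2 circ (H f) g = inner2 circ (H g) f"
proof -
  obtain C where C: "C \<ge> 0"
    "\<And>f g. f \<in> H2 \<Longrightarrow> g \<in> H2 \<Longrightarrow> cmod (inner2 circ (H f) g) \<le> C * norm2 circ f * norm2 circ g"
    by (rule H_bound, rule that)
  have "inner2 circ (H f) g - inner2 circ (H g) f = 0"
  proof (rule H2_form_eq_0[where C="2*C" and G="\<lambda>f g. inner2 circ (H f) g - inner2 circ (H g) f"])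
    fix x y assume xy: "x \<in> H2" "y \<in> H2"
    have "cmod (inner2 circ (H x) y - inner2 circ (H y) x)
        \<le> cmod (inner2 circ (H x) y) + cmod (inner2 circ (H y) x)" by (rule norm_triangle_ineq4)
    also have "\<dots> \<le> C * norm2 circ x * norm2 circ y + C * norm2 circ y * norm2 circ x"
      by (intro add_mono C xy)
    finally show "cmod (inner2 circ (H x) y - inner2 circ (H y) x) \<le> 2 * C * norm2 circ x * norm2 circ y"
      by (simp add: mult_ac)
  next
    fix p q :: "complex poly"
    show "inner2 circ (H (poly p)) (poly q) - inner2 circ (H (poly q)) (poly p) = 0"
      by (simp add: H_poly mult_ac)
  qed (use assms C in \<open>auto simp: H_diff H2_L2 inner2_right H_L2\<close>)
  then show ?thesis by simp
qed

text \<open>Under the integral of \<open>H_poly\<close> the factor \<open>cnj z\<close> may be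
  attached to either polynomial.\<close>

lemma H_shift:
  assumes "f \<in> H2" "g \<in> H2"
  shows "inner2 circ (H (shift f)) g = inner2 circ (H f) (shift g)"
proof -
  obtain C where C: "C \<ge> 0"
    "\<And>f g. f \<in> H2 \<Longrightarrow> g \<in> H2 \<Longrightarrow> cmod (inner2 circ (H f) g) \<le> C * norm2 circ f * norm2 circ g"
    by (rule H_bound, rule that)
  have sd: "shift (\<lambda>z. x z - y z) = (\<lambda>z. shift x z - shift y z)" for x y
    by (simp add: shift_def algebra_simps)
  have sp: "shift (poly p) = poly (pCons 0 p)" for p by (auto simp: shift_def)
  have "inner2 circ (H (shift f)) g - inner2 circ (H f) (shift g) = 0"
  proof (rule H2_form_eq_0[where C="2*C" and G="\<lambda>f g. inner2 circ (H (shift f)) g - inner2 circ (H f) (shift g)"])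
    fix x y assume xy: "x \<in> H2" "y \<in> H2"
    have "cmod (inner2 circ (H (shift x)) y - inner2 circ (H x) (shift y))
        \<le> cmod (inner2 circ (H (shift x)) y) + cmod (inner2 circ (H x) (shift y))" by (rule norm_triangle_ineq4)
    also have "\<dots> \<le> C * norm2 circ (shift x) * norm2 circ y + C * norm2 circ x * norm2 circ (shift y)"
      by (intro add_mono C xy shift_in)
    finally show "cmod (inner2 circ (H (shift x)) y - inner2 circ (H x) (shift y)) \<le> 2 * C * norm2 circ x * norm2 circ y"
      using xy by (simp add: mult_ac norm_shift)
  next
    fix p q :: "complex poly"
    show "inner2 circ (H (shift (poly p))) (poly q) - inner2 circ (H (poly p)) (shift (poly q)) = 0"
      by (simp add: sp H_poly mult_ac)
  qed (use assms C in \<open>auto simp: sd H_diff H2_L2 inner2_right H_L2 shift_in\<close>)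
  then show ?thesis by simp
qed

lemma shift_star_H:
  assumes "f \<in> H2"
  shows "eq_ae circ (shift_star (H f)) (H (shift f))"
  using assms
  by (intro eq_ae_by_inner2[OF subspace2_H2]) (simp_all add: H_in shift_in shift_star_in H_shift shift_star_adj')

text \<open>\<open>BMOA_simp\<close> speaks of some Hankel operator of \<open>u\<close>; this
  connects that one with the given \<open>H\<close>.\<close>

lemma hankel_unique:
  assumes H': "hankel_op u H'" and f: "f \<in> H2"
  shows "eq_ae circ (H f) (H' f)"
proof (rule eq_ae_by_inner2[OF subspace2_H2])
  interpret H': hankel_op u H' by fact
  show "H f \<in> H2" "H' f \<in> H2" using f by (auto intro: H_in H'.H_in)
  fix k assume k: "k \<in> H2"
  obtain C where C: "C \<ge> 0"
    "\<And>f g. f \<in> H2 \<Longrightarrow> g \<in> H2 \<Longrightarrow> cmod (inner2 circ (H f) g) \<le> C * norm2 circ f * norm2 circ g"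
    by (rule H_bound, rule that)
  obtain C' where C': "C' \<ge> 0"
    "\<And>f g. f \<in> H2 \<Longrightarrow> g \<in> H2 \<Longrightarrow> cmod (inner2 circ (H' f) g) \<le> C' * norm2 circ f * norm2 circ g"
    by (rule H'.H_bound, rule that)
  have "inner2 circ (H f) k - inner2 circ (H' f) k = 0"
  proof (rule H2_form_eq_0[where C="C+C'" and G="\<lambda>f k. inner2 circ (H f) k - inner2 circ (H' f) k"])
    fix x y assume xy: "x \<in> H2" "y \<in> H2"
    have "cmod (inner2 circ (H x) y - inner2 circ (H' x) y)
        \<le> cmod (inner2 circ (H x) y) + cmod (inner2 circ (H' x) y)" by (rule norm_triangle_ineq4)
    also have "\<dots> \<le> C * norm2 circ x * norm2 circ y + C' * norm2 circ x * norm2 circ y"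
      by (intro add_mono C C' xy)
    finally show "cmod (inner2 circ (H x) y - inner2 circ (H' x) y) \<le> (C + C') * norm2 circ x * norm2 circ y"
      by (simp add: algebra_simps)
  qed (use f k C C' in \<open>auto simp: H_diff H'.H_diff H2_L2 inner2_right H_L2 H'.H_L2 H_poly H'.H_poly\<close>)
  then show "inner2 circ (H f) k = inner2 circ (H' f) k" by simp
qed

section \<open>The closed range of the Hankel operator and its kernel\<close>

abbreviation "R \<equiv> closure_range circ H2 H"

lemma R_H2: "f \<in> R \<Longrightarrow> f \<in> H2"
  by (simp add: closure_range_def)

lemma R_L2: "f \<in> R \<Longrightarrow> f \<in> L2 circ"
  by (intro H2_L2 R_H2)

lemma R_closed:
  assumes g: "g \<in> L2 circ" and appr: "\<And>e. e > 0 \<Longrightarrow> \<exists>s\<in>R. norm2 circ (\<lambda>z. g z - s z) < e"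
  shows "g \<in> R"
proof -
  have gH: "g \<in> H2" using appr R_H2 by (intro H2_closed[OF g]) blast
  have "\<exists>f\<in>H2. norm2 circ (\<lambda>z. g z - H f z) < e" if e: "e > 0" for e
  proof -
    obtain s where s: "s \<in> R" "norm2 circ (\<lambda>z. g z - s z) < e/2" using appr[of "e/2"] e by auto
    obtain f where f: "f \<in> H2" "norm2 circ (\<lambda>z. s z - H f z) < e/2"
      using s(1) e by (auto simp: closure_range_def dest: spec[of _ "e/2"])
    show ?thesis
      using norm2_diff_triangle[OF g R_L2[OF s(1)] H_L2[OF f(1)]] s f by (intro bexI[of _ f]) auto
  qed
  then show ?thesis using gH by (auto simp: closure_range_def)
qed

lemma H_in_R: "f \<in> H2 \<Longrightarrow> H f \<in> R"
  unfolding closure_range_def using H_in by (auto intro!: bexI[of _ f])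

lemma R_eq_ae: "g \<in> R \<Longrightarrow> f \<in> L2 circ \<Longrightarrow> eq_ae circ f g \<Longrightarrow> f \<in> R"
  using eq_ae_iff_norm2_diff[of f circ g] R_L2 by (intro R_closed) (auto intro!: bexI[of _ g])

lemma R_approx:
  assumes "g \<in> R" "e > 0"
  obtains f where "f \<in> H2" "norm2 circ (\<lambda>z. g z - H f z) < e"
  using assms by (auto simp: closure_range_def)

lemma R_perp:
  assumes x: "x \<in> H2" and perp: "\<And>f. f \<in> H2 \<Longrightarrow> inner2 circ x (H f) = 0" and r: "r \<in> R"
  shows "inner2 circ x r = 0"
proof (rule zero_by_eps)
  fix e :: real assume e: "e > 0"
  obtain f where f: "f \<in> H2" "norm2 circ (\<lambda>z. r z - H f z) < e" by (rule R_approx[OF r e])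
  have "inner2 circ x r = inner2 circ x (\<lambda>z. r z - H f z)"
    using f r x perp by (simp add: inner2_right R_L2 H2_L2 H_L2)
  also have "cmod \<dots> \<le> norm2 circ x * norm2 circ (\<lambda>z. r z - H f z)"
    using f r x by (intro cauchy_schwarz2 L2_diff R_L2 H2_L2 H_L2)
  also have "\<dots> \<le> norm2 circ x * e" using f by (intro mult_left_mono) auto
  finally show "cmod (inner2 circ x r) \<le> e * norm2 circ x" by (simp add: mult.commute)
qed

lemma subspace2_R [simp]: "subspace2 circ R"
  unfolding subspace2_def
proof (intro conjI ballI allI subsetI R_L2)
  note z = subspace2_zero[OF subspace2_H2]
  have "eq_ae circ (H (\<lambda>z. 0)) (\<lambda>z. 0)"
    using bounded_antilinear_on_lincomb[OF anti z z, of 0 0] by simp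
  then show "(\<lambda>z. 0) \<in> R" using R_eq_ae[OF H_in_R[OF z]] by (simp add: eq_ae_sym)
  fix f g a b assume fg: "f \<in> R" "g \<in> R"
  have fgL: "f \<in> L2 circ" "g \<in> L2 circ" using fg R_L2 by auto
  show "(\<lambda>x. a * f x + b * g x) \<in> R"
  proof (rule R_closed)
    show "(\<lambda>x. a * f x + b * g x) \<in> L2 circ" by (intro L2_lincomb fgL)
    fix e :: real assume e: "e > 0"
    \<comment> \<open>The added \<open>1\<close> keeps the divisor positive and makes the final
      inequality strict.\<close>
    define c where "c = cmod a + cmod b + 1"
    have c: "c > 0" by (simp add: c_def add_nonneg_pos)
    obtain f' where f': "f' \<in> H2" "norm2 circ (\<lambda>z. f z - H f' z) < e / c"
      using R_approx[OF fg(1), of "e / c"] e c by auto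
    obtain g' where g': "g' \<in> H2" "norm2 circ (\<lambda>z. g z - H g' z) < e / c"
      using R_approx[OF fg(2), of "e / c"] e c by auto
    define s where "s = H (\<lambda>z. cnj a * f' z + cnj b * g' z)"
    have sH: "s \<in> R" unfolding s_def by (intro H_in_R subspace2_lincomb[OF subspace2_H2] f' g')
    have "eq_ae circ s (\<lambda>z. a * H f' z + b * H g' z)"
      unfolding s_def using bounded_antilinear_on_lincomb[OF anti f'(1) g'(1), of "cnj a" "cnj b"] by simp
    then have "eq_ae circ (\<lambda>x. (a * f x + b * g x) - s x) (\<lambda>x. (a * f x + b * g x) - (a * H f' x + b * H g' x))"
      by (intro eq_ae_diff eq_ae_refl)
    then have "eq_ae circ (\<lambda>x. (a * f x + b * g x) - s x) (\<lambda>x. a * (f x - H f' x) + b * (g x - H g' x))"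
      by (simp add: algebra_simps)
    then have "norm2 circ (\<lambda>x. (a * f x + b * g x) - s x) = norm2 circ (\<lambda>x. a * (f x - H f' x) + b * (g x - H g' x))"
      using fgL f' g' R_L2[OF sH] by (intro norm2_cong L2_diff L2_lincomb H_L2)
    also have "\<dots> \<le> norm2 circ (\<lambda>x. a * (f x - H f' x)) + norm2 circ (\<lambda>x. b * (g x - H g' x))"
      using fgL f' g' by (intro norm2_triangle L2_scale L2_diff H_L2)
    also have "\<dots> \<le> cmod a * (e / c) + cmod b * (e / c)"
      unfolding norm2_scale using f' g' by (intro add_mono mult_left_mono) auto
    also have "\<dots> < c * (e / c)"
    proof -
      define d where "d = e / c"
      have "d > 0" using e c by (simp add: d_def)
      then show ?thesis unfolding d_def[symmetric] by (simp add: c_def distrib_right)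
    qed
    finally show "\<exists>s\<in>R. norm2 circ (\<lambda>x. (a * f x + b * g x) - s x) < e"
      using sH c by auto
  qed
qed

lemma R_projection:
  assumes f: "f \<in> H2"
  obtains r where "r \<in> R" "\<And>s. s \<in> R \<Longrightarrow> inner2 circ (\<lambda>z. f z - r z) s = 0"
proof -
  obtain r where r: "r \<in> L2 circ" "\<And>e. e > 0 \<Longrightarrow> \<exists>s\<in>R. norm2 circ (\<lambda>z. r z - s z) < e"
    "\<And>s. s \<in> R \<Longrightarrow> inner2 circ (\<lambda>z. f z - r z) s = 0"
    using projection2[OF subspace2_R H2_L2[OF f]] by blast
  with R_closed show thesis by (intro that[of r]) auto
qed

text \<open>By symmetry the squared norm of \<open>H x\<close> is the inner product of
  \<open>H (H x)\<close> with \<open>x\<close>, and \<open>H (H x)\<close> lies in \<open>R\<close>.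
  Together with \<open>ker_perp_R\<close> this makes \<open>R\<close> and the kernel of
  \<open>H\<close> orthogonal complements.\<close>

lemma norm_H_perp_R:
  assumes x: "x \<in> H2" and perp: "\<And>s. s \<in> R \<Longrightarrow> inner2 circ x s = 0"
  shows "norm2 circ (H x) = 0"
proof -
  have "inner2 circ (H x) (H x) = inner2 circ (H (H x)) x" using x by (intro H_sym H_in)
  also have "\<dots> = cnj (inner2 circ x (H (H x)))" by (rule inner2_cnj[symmetric])
  also have "\<dots> = 0" using x perp by (simp add: H_in H_in_R)
  finally show ?thesis by (simp add: inner2_self)
qed

lemma ker_perp_R:
  assumes x: "x \<in> H2" and H0: "norm2 circ (H x) = 0" and r: "r \<in> R"
  shows "inner2 circ x r = 0"
proof (rule R_perp[OF x _ r])
  fix f assume f: "f \<in> H2"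
  have "cmod (inner2 circ (H x) f) \<le> norm2 circ (H x) * norm2 circ f"
    using x f by (intro cauchy_schwarz2 H_L2 H2_L2)
  then have "inner2 circ (H f) x = 0" using H0 H_sym[OF x f] by simp
  then show "inner2 circ x (H f) = 0" by (metis inner2_cnj complex_cnj_zero)
qed

text \<open>\<open>x\<close> minus its projection onto \<open>R\<close> lies in the kernel of
  \<open>H\<close>; being orthogonal both to \<open>x\<close> and to the projection, it has norm
  zero.\<close>

lemma in_R_by_ker:
  assumes x: "x \<in> H2" and perp: "\<And>k. k \<in> H2 \<Longrightarrow> norm2 circ (H k) = 0 \<Longrightarrow> inner2 circ x k = 0"
  shows "x \<in> R"
proof -
  obtain r where r: "r \<in> R" "\<And>s. s \<in> R \<Longrightarrow> inner2 circ (\<lambda>z. x z - r z) s = 0"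
    by (rule R_projection[OF x], rule that)
  define k where "k = (\<lambda>z. x z - r z)"
  have k: "k \<in> H2" unfolding k_def by (intro subspace2_diff[OF subspace2_H2] x R_H2 r)
  have kR: "inner2 circ k s = 0" if "s \<in> R" for s using r(2)[OF that] by (simp add: k_def)
  have "inner2 circ x k = 0" by (intro perp k norm_H_perp_R kR)
  moreover have "inner2 circ r k = 0" using kR[OF r(1)] by (metis inner2_cnj complex_cnj_zero)
  moreover have "inner2 circ k k = inner2 circ x k - inner2 circ r k"
    using k x r(1) by (simp add: k_def inner2_left H2_L2 R_L2)
  ultimately have "norm2 circ k = 0" by (simp add: inner2_self)
  then have "eq_ae circ x r"
    using eq_ae_iff_norm2_diff[OF H2_L2[OF x] R_L2[OF r(1)]] by (simp add: k_def)
  then show ?thesis using R_eq_ae[OF r(1) H2_L2[OF x]] by simp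
qed

lemma u_in_R: "u \<in> R"
  using R_eq_ae[OF H_in_R[OF H2_one] H2_L2[OF u] eq_ae_sym[OF H_one]] .

lemma shift_star_in_R:
  assumes x: "x \<in> R"
  shows "shift_star x \<in> R"
proof (rule R_closed)
  show "shift_star x \<in> L2 circ" by (intro H2_L2 shift_star_in R_H2 x)
  fix e :: real assume e: "e > 0"
  obtain f where f: "f \<in> H2" "norm2 circ (\<lambda>z. x z - H f z) < e" by (rule R_approx[OF x e])
  note L = H2_L2[OF shift_star_in[OF R_H2[OF x]]] H2_L2[OF shift_star_in[OF H_in[OF f(1)]]] H_L2[OF shift_in[OF f(1)]]
  have "norm2 circ (\<lambda>z. shift_star (H f) z - H (shift f) z) = 0"
    using shift_star_H[OF f(1)] eq_ae_iff_norm2_diff[OF L(2,3)] by simp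
  moreover have "norm2 circ (\<lambda>z. shift_star x z - shift_star (H f) z) < e"
    using bounded_linear_on_diff[OF subspace2_H2 bounded_linear_shift_star R_H2[OF x] H_in[OF f(1)]]
      norm_shift_star[OF subspace2_diff[OF subspace2_H2 R_H2[OF x] H_in[OF f(1)]]] f(2) by simp
  ultimately have "norm2 circ (\<lambda>z. shift_star x z - H (shift f) z) < e"
    using norm2_diff_triangle[OF L] by simp
  then show "\<exists>s\<in>R. norm2 circ (\<lambda>z. shift_star x z - s z) < e" using H_in_R[OF shift_in[OF f(1)]] by blast
qed

section \<open>The operator \<open>Ht\<close> and its square\<close>

abbreviation "Ht \<equiv> hankel_tilde H"

lemma anti_Ht: "bounded_antilinear_on circ H2 Ht"
  unfolding hankel_tilde_def
  by (rule bounded_linear_comp_antilinear[OF subspace2_H2 bounded_linear_shift_star anti])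

lemma Ht_in_R: "f \<in> H2 \<Longrightarrow> Ht f \<in> R"
  by (simp add: hankel_tilde_def shift_star_in_R H_in_R)

lemma Ht_sym:
  assumes "f \<in> H2" "g \<in> H2"
  shows "inner2 circ (Ht f) g = inner2 circ (Ht g) f"
proof -
  have "inner2 circ (Ht f) g = inner2 circ (H f) (shift g)"
    using assms by (simp add: hankel_tilde_def shift_star_adj' H_in)
  also have "\<dots> = inner2 circ (H (shift g)) f" using assms by (intro H_sym shift_in)
  also have "\<dots> = inner2 circ (Ht g) f" using assms by (simp add: H_shift hankel_tilde_def shift_star_adj' H_in)
  finally show ?thesis .
qed

lemma H2_sym:
  assumes "f \<in> H2" "g \<in> H2"
  shows "inner2 circ (H (H f)) g = inner2 circ (H g) (H f)"
  using assms by (intro H_sym H_in)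

text \<open>By symmetry the left side is the inner product of \<open>Ht g\<close> with
  \<open>Ht f\<close>, to which \<open>inner2_shift_star\<close> applies; its constant terms are
  \<open><H x, 1> = <H 1, x> = <u, x>\<close>.\<close>

lemma Ht_square:
  assumes f: "f \<in> H2" and g: "g \<in> H2"
  shows "inner2 circ (Ht (Ht f)) g = inner2 circ (H (H f)) g - inner2 circ f u * inner2 circ u g"
proof -
  have one: "inner2 circ (H x) (\<lambda>z. 1) = inner2 circ u x" if x: "x \<in> H2" for x
  proof -
    have "inner2 circ (H x) (\<lambda>z. 1) = inner2 circ (H (\<lambda>z. 1)) x" using x by (intro H_sym) auto
    also have "\<dots> = inner2 circ u x" using x u by (intro inner2_cong H_one H_L2 H2_L2) auto
    finally show ?thesis .
  qed
  have "inner2 circ (Ht (Ht f)) g = inner2 circ (Ht g) (Ht f)"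
    using f g R_H2[OF Ht_in_R[OF f]] by (intro Ht_sym)
  also have "\<dots> = inner2 circ (H g) (H f) - inner2 circ (H g) (\<lambda>z. 1) * cnj (inner2 circ (H f) (\<lambda>z. 1))"
    unfolding hankel_tilde_def comp_def using f g by (intro inner2_shift_star H_in)
  also have "\<dots> = inner2 circ (H (H f)) g - inner2 circ u g * inner2 circ f u"
    using f g by (simp add: one H2_sym inner2_cnj)
  finally show ?thesis by (simp add: mult.commute)
qed

end

section \<open>The spectral map of a Hankel operator\<close>

lemma eq_ae_funpow:
  assumes V: "subspace2 M V" and T: "bounded_linear_on M V T"
    and T': "\<And>f. f \<in> V \<Longrightarrow> T' f \<in> V" and eq: "\<And>f. f \<in> V \<Longrightarrow> eq_ae M (T f) (T' f)" and f: "f \<in> V"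
  shows "eq_ae M ((T ^^ i) f) ((T' ^^ i) f)"
proof (induction i)
  case (Suc i)
  have V': "(T ^^ i) f \<in> V" "(T' ^^ i) f \<in> V"
    using funpow_in[of V T, OF bounded_linear_on_in[OF T] f] funpow_in[of V T', OF T' f] by auto
  have "eq_ae M (T ((T ^^ i) f)) (T ((T' ^^ i) f))" by (rule bounded_linear_on_cong[OF V T V' Suc])
  also have "eq_ae M \<dots> (T' ((T' ^^ i) f))" by (rule eq[OF V'(2)])
  finally show ?case by simp
qed simp

lemma simple_spectrum_cong:
  assumes V: "subspace2 M V" and T: "bounded_linear_on M V T"
    and T': "\<And>f. f \<in> V \<Longrightarrow> T' f \<in> V" and eq: "\<And>f. f \<in> V \<Longrightarrow> eq_ae M (T f) (T' f)"
    and s: "simple_spectrum M V T'"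
  shows "simple_spectrum M V T"
proof -
  obtain v where v: "v \<in> V" "\<And>f e. f \<in> V \<Longrightarrow> e > 0 \<Longrightarrow> \<exists>p. norm2 M (\<lambda>x. f x - poly_op p T' v x) < e"
    using s unfolding simple_spectrum_def cyclic_vector_def by blast
  have "\<exists>p. norm2 M (\<lambda>x. f x - poly_op p T v x) < e" if f: "f \<in> V" and e: "e > 0" for f e
  proof -
    obtain p where p: "norm2 M (\<lambda>x. f x - poly_op p T' v x) < e" using v(2)[OF f e] by blast
    have L: "poly_op p T v \<in> L2 M" "poly_op p T' v \<in> L2 M"
      unfolding poly_op_def
      using funpow_in[of V T, OF bounded_linear_on_in[OF T] v(1)] funpow_in[of V T', OF T' v(1)] subspace2D[OF V]
      by (auto intro!: L2_sum L2_scale)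
    have "eq_ae M (poly_op p T v) (poly_op p T' v)"
      unfolding poly_op_def
    proof (rule eq_ae_sum)
      fix i
      show "eq_ae M (\<lambda>x. coeff p i * (T ^^ i) v x) (\<lambda>x. coeff p i * (T' ^^ i) v x)"
        using eq_ae_funpow[OF V T T' eq v(1), of i] by (auto simp: eq_ae_def elim: AE_mp)
    qed simp
    then have "norm2 M (\<lambda>x. f x - poly_op p T v x) = norm2 M (\<lambda>x. f x - poly_op p T' v x)"
      using subspace2D[OF V f] L by (intro norm2_cong eq_ae_diff eq_ae_refl L2_diff)
    with p show ?thesis by (intro exI[of _ p]) simp
  qed
  then show ?thesis using v(1) unfolding simple_spectrum_def cyclic_vector_def by blast
qed

context spectral_space
begin

lemma E_norm_le:
  assumes B: "B \<in> sets borel" and f: "f \<in> V"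
  shows "norm2 M (E B f) \<le> norm2 M f"
proof -
  have "emeasure (mu f) B \<le> emeasure (mu f) UNIV" by (rule emeasure_mono) auto
  then have "(norm2 M (E B f))\<^sup>2 \<le> (norm2 M (E UNIV f))\<^sup>2" using B f by (simp add: emeasure_mu)
  moreover have "norm2 M (E UNIV f) = norm2 M f" using f by (intro norm2_cong[OF E_UNIV] E_L2 VL2) auto
  ultimately have "(norm2 M (E B f))\<^sup>2 \<le> (norm2 M f)\<^sup>2" by simp
  then show ?thesis by (rule power2_le_imp_le) simp
qed

lemma E_comp_norm:
  assumes "B \<in> sets borel" "C \<in> sets borel" "f \<in> V"
  shows "norm2 M (E B (E C f)) = norm2 M (E (B \<inter> C) f)"
  using assms by (intro norm2_cong[OF eq_ae_sym[OF E_Int]] E_L2 E_in) auto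

lemma E_empty_norm: "f \<in> V \<Longrightarrow> norm2 M (E {} f) = 0"
  using emeasure_mu[of f "{}"] by simp

lemma cal_indicator:
  assumes f: "f \<in> V" and B: "B \<in> sets borel"
  shows "cal (indicator B) f (E B f)"
proof -
  have "inner2 M (E B f) (E C f) = (\<integral>s. indicator B s * indicator C s \<partial>mu f)" if C: "C \<in> sets borel" for C
  proof -
    have "(\<lambda>s. indicator B s * indicator C s :: complex) = indicator (B \<inter> C)"
      by (auto simp: indicator_def)
    then show ?thesis using f B C by (simp add: E_inner_E integral_indicator_mu)
  qed
  moreover have "integrable (mu f) (indicator B :: real \<Rightarrow> complex)"
    using B by (intro integrable_mu_bounded[OF f, where C=1]) (auto simp: indicator_def)
  ultimately show ?thesis using f B by (auto simp: cal_def intro: E_in)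
qed

end

section \<open>The modulus, its spectral resolution and the measure of \<open>u\<close>\<close>

locale hankel_spectral = hankel_op u H for u H +
  fixes A E \<rho>
  assumes A: "is_modulus H A" and E: "spectral_resolution circ H2 A E"
    and rho: "is_spectral_measure E u \<rho>"
begin

lemma blA: "bounded_linear_on circ H2 A"
  and A_pos: "f \<in> H2 \<Longrightarrow> Im (inner2 circ (A f) f) = 0"
  and AA: "f \<in> H2 \<Longrightarrow> eq_ae circ (A (A f)) (H (H f))"
  using A by (auto simp: is_modulus_def)

lemma A_in: "f \<in> H2 \<Longrightarrow> A f \<in> H2"
  by (rule bounded_linear_on_in[OF blA])

lemma A_L2: "f \<in> H2 \<Longrightarrow> A f \<in> L2 circ"
  by (intro H2_L2 A_in)

text \<open>Polarization: the quadratic form of \<open>A\<close> is real.\<close>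

lemma A_sym:
  assumes f: "f \<in> H2" and g: "g \<in> H2"
  shows "inner2 circ (A f) g = inner2 circ f (A g)"
proof -
  have "Im (cnj c * inner2 circ (A f) g + c * inner2 circ (A g) f) = 0" for c
  proof -
    have fg: "(\<lambda>x. f x + c * g x) \<in> H2"
      using subspace2_lincomb[OF subspace2_H2 f g, of 1 c] by simp
    have "eq_ae circ (A (\<lambda>x. f x + c * g x)) (\<lambda>x. A f x + c * A g x)"
      using bounded_linear_on_lincomb[OF blA f g, of 1 c] by simp
    then have "inner2 circ (A (\<lambda>x. f x + c * g x)) (\<lambda>x. f x + c * g x)
        = inner2 circ (\<lambda>x. A f x + c * A g x) (\<lambda>x. f x + c * g x)"
      using f g fg by (intro inner2_cong eq_ae_refl L2_add L2_scale A_L2 H2_L2)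
    also have "\<dots> = inner2 circ (A f) f + cnj c * inner2 circ (A f) g + c * inner2 circ (A g) f
        + (c * cnj c) * inner2 circ (A g) g"
      using f g by (simp add: inner2_left inner2_right L2_add L2_scale A_L2 H2_L2 algebra_simps)
    finally have "Im (inner2 circ (A f) f + cnj c * inner2 circ (A f) g + c * inner2 circ (A g) f
        + (c * cnj c) * inner2 circ (A g) g) = 0"
      using A_pos[OF fg] by simp
    then show ?thesis using A_pos[OF f] A_pos[OF g] by simp
  qed
  from this[of 1] this[of \<i>] have "inner2 circ (A f) g = cnj (inner2 circ (A g) f)"
    by (simp add: complex_eq_iff)
  then show ?thesis by (simp add: inner2_cnj)
qed

lemma norm_H_A:
  assumes f: "f \<in> H2"
  shows "norm2 circ (H f) = norm2 circ (A f)"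
proof -
  have "inner2 circ (H f) (H f) = inner2 circ (H (H f)) f" using f by (intro H_sym H_in)
  also have "\<dots> = inner2 circ (A (A f)) f"
    using f by (intro inner2_cong eq_ae_sym[OF AA] eq_ae_refl H_L2 H_in A_L2 A_in H2_L2)
  also have "\<dots> = inner2 circ (A f) (A f)" using f by (intro A_sym A_in)
  finally show ?thesis by (metis norm2_eq_inner2 norm2_nonneg power2_eq_iff_nonneg)
qed

sublocale sp: spectral_space circ H2 E
  using E by unfold_locales (auto simp: spectral_resolution_def)

lemma fun_calc_A: "f \<in> H2 \<Longrightarrow> fun_calc circ H2 E complex_of_real f (A f)"
  using E by (auto simp: spectral_resolution_def)

text \<open>\<open>H k\<close> has the same norm as \<open>A k\<close>, and by the isometry of the
  calculus this is the norm of the identity function in \<open>L2 (sp.mu k)\<close>; it vanishes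
  exactly when \<open>sp.mu k\<close> is carried by \<open>{0}\<close>.\<close>

lemma ker_iff:
  assumes k: "k \<in> H2"
  shows "norm2 circ (H k) = 0 \<longleftrightarrow> norm2 circ (E (- {0}) k) = 0"
proof -
  have L: "complex_of_real \<in> L2 (sp.mu k)" by (rule sp.fun_calc_L2[OF fun_calc_A[OF k]])
  have "(norm2 circ (A k))\<^sup>2 = (norm2 (sp.mu k) complex_of_real)\<^sup>2"
    using sp.fun_calc_isometry[OF fun_calc_A[OF k] fun_calc_A[OF k]] by (simp add: norm2_eq_inner2)
  then have "norm2 circ (H k) = 0 \<longleftrightarrow> norm2 (sp.mu k) complex_of_real = 0"
    by (simp add: norm_H_A[OF k])
  also have "\<dots> \<longleftrightarrow> (AE s in sp.mu k. s = 0)" using norm2_eq_0[OF L] by (simp add: eq_ae_def)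
  also have "\<dots> \<longleftrightarrow> emeasure (sp.mu k) (- {0}) = 0"
    by (subst AE_iff_measurable[of "- {0}"]) auto
  also have "\<dots> \<longleftrightarrow> norm2 circ (E (- {0}) k) = 0"
    using k by (simp add: sp.emeasure_mu)
  finally show ?thesis .
qed

lemma E_ker:
  assumes k: "k \<in> H2" "norm2 circ (H k) = 0" and B: "B \<in> sets borel"
  shows "norm2 circ (H (E B k)) = 0"
proof -
  have "norm2 circ (E (- {0}) (E B k)) = norm2 circ (E (B \<inter> - {0}) k)"
    using sp.E_comp_norm[of "- {0}" B k] k B by (simp add: Int_commute)
  also have "\<dots> = norm2 circ (E B (E (- {0}) k))" using k B by (intro sp.E_comp_norm[symmetric]) auto
  also have "\<dots> \<le> norm2 circ (E (- {0}) k)" using k B by (intro sp.E_norm_le sp.E_in) auto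
  finally have "norm2 circ (E (- {0}) (E B k)) = 0"
    using k ker_iff[OF k(1)] by (intro antisym norm2_nonneg) simp
  then show ?thesis using ker_iff[OF sp.E_in[OF B k(1)]] by simp
qed

text \<open>The spectral projections preserve the kernel of \<open>H\<close>; being symmetric, they
  preserve its orthogonal complement too.\<close>

lemma E_in_R:
  assumes x: "x \<in> R" and B: "B \<in> sets borel"
  shows "E B x \<in> R"
proof (rule in_R_by_ker)
  show "E B x \<in> H2" by (intro sp.E_in B R_H2 x)
  fix k assume k: "k \<in> H2" "norm2 circ (H k) = 0"
  have "inner2 circ (E B x) k = inner2 circ x (E B k)" by (intro sp.E_adj B R_H2 x k)
  also have "\<dots> = cnj (inner2 circ (E B k) x)" by (rule inner2_cnj[symmetric])
  also have "\<dots> = 0" using ker_perp_R[OF sp.E_in[OF B k(1)] E_ker[OF k B] x] by simp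
  finally show "inner2 circ (E B x) k = 0" .
qed

sublocale Rsp: spectral_space circ R E
proof unfold_locales
  show "projection_valued_measure circ R E"
    unfolding projection_valued_measure_def bounded_linear_on_def
  proof (intro conjI ballI allI impI)
    fix B :: "real set" assume B: "B \<in> sets borel"
    show "\<exists>C. \<forall>f\<in>R. norm2 circ (E B f) \<le> C * norm2 circ f"
      using sp.E_norm_le[OF B] R_H2 by (intro exI[of _ 1]) auto
  qed (use sp.pvm R_H2 in \<open>auto intro: E_in_R sp.E_lincomb sp.E_adj sp.E_Int sp.E_UNIV
      simp: projection_valued_measure_def\<close>)
qed simp

text \<open>\<open>U\<close> and \<open>\<Psi>\<close> refer to the calculus in \<open>R\<close>,
  while \<open>A\<close> is resolved in \<open>H2\<close>; to apply \<open>A\<close> to such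
  vectors, the relation has to be moved. A test vector from \<open>H2\<close> may be replaced by its
  projection onto \<open>R\<close>, since \<open>g\<close> and all \<open>E B f\<close> lie in
  \<open>R\<close>.\<close>

lemma cal_R_H2:
  assumes c: "Rsp.cal h f g"
  shows "sp.cal h f g"
proof -
  have f: "f \<in> R" and g: "g \<in> R"
    and c2: "\<And>k. k \<in> R \<Longrightarrow> (\<And>B. B \<in> sets borel \<Longrightarrow> inner2 circ k (E B f) = 0) \<Longrightarrow> inner2 circ k g = 0"
    using c by (auto simp: Rsp.cal_def)
  have "inner2 circ k g = 0" if k: "k \<in> H2" "\<forall>B\<in>sets borel. inner2 circ k (E B f) = 0" for k
  proof -
    obtain r where r: "r \<in> R" "\<And>s. s \<in> R \<Longrightarrow> inner2 circ (\<lambda>z. k z - r z) s = 0"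
      by (rule R_projection[OF k(1)], rule that)
    have eq: "inner2 circ k s = inner2 circ r s" if "s \<in> R" for s
      using r(2)[OF that] k(1) r(1) that by (simp add: inner2_left H2_L2 R_L2)
    have "inner2 circ r g = 0" using k(2) f by (intro c2 r) (simp add: E_in_R flip: eq)
    then show ?thesis using eq[OF g] by simp
  qed
  then show ?thesis using c R_H2 by (auto simp: sp.cal_def Rsp.cal_def)
qed

lemma sets_rho [simp, measurable_cong]: "sets \<rho> = sets borel"
  and finite_rho: "finite_measure \<rho>"
  using rho by (auto simp: is_spectral_measure_def)

text \<open>For continuous functions both integrals are the same inner product with
  \<open>u\<close>, and these integrals determine a finite Borel measure.\<close>

lemma rho_eq: "\<rho> = sp.mu u"
proof (rule finite_borel_measure_eqI)
  fix f :: "real \<Rightarrow> real" assume f: "continuous_on UNIV f"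
  have "continuous_on UNIV (\<lambda>s. complex_of_real (f s))" using f by (intro continuous_intros)
  then obtain g where g: "fun_calc circ H2 E (\<lambda>s. complex_of_real (f s)) u g"
    "(\<integral>s. complex_of_real (f s) \<partial>\<rho>) = inner2 circ g u"
    using rho unfolding is_spectral_measure_def by meson
  have "inner2 circ g u = (\<integral>s. complex_of_real (f s) \<partial>sp.mu u)"
    by (rule sp.cal_inner[OF sp.fun_calc_cal[OF g(1)]])
  then have "complex_of_real (\<integral>s. f s \<partial>\<rho>) = complex_of_real (\<integral>s. f s \<partial>sp.mu u)"
    using g(2) by (simp only: integral_complex_of_real)
  then show "(\<integral>s. f s \<partial>\<rho>) = (\<integral>s. f s \<partial>sp.mu u)" by simp
qed (use finite_rho sp.finite_mu u in auto)

text \<open>\<open>E {0} u\<close> lies in the kernel of \<open>H\<close> and also in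
  \<open>R\<close>, so it is orthogonal to itself.\<close>

lemma rho_0: "AE s in \<rho>. s \<noteq> 0"
proof -
  define x where "x = E {0} u"
  have xR: "x \<in> R" unfolding x_def by (intro E_in_R u_in_R) auto
  have "norm2 circ (E (- {0}) x) = norm2 circ (E {} u)"
    unfolding x_def using sp.E_comp_norm[of "- {0}" "{0}" u] u by simp
  then have "norm2 circ (H x) = 0" using ker_iff[OF R_H2[OF xR]] sp.E_empty_norm[OF u] by simp
  then have "inner2 circ x x = 0" using ker_perp_R R_H2 xR by blast
  then have "norm2 circ x = 0" by (simp add: inner2_self)
  then have "emeasure \<rho> {0} = 0" unfolding rho_eq using u by (simp add: sp.emeasure_mu x_def)
  then show ?thesis by (intro AE_I[of _ _ "{0}"]) auto
qed

end

section \<open>The spectral map and the splitting of the closed range\<close>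

locale hankel_spectral_map = hankel_spectral u H A E \<rho> for u H A E \<rho> +
  fixes U
  assumes U: "is_spectral_map R E u \<rho> U"
begin

lemma fun_calc_U: "f \<in> L2 \<rho> \<Longrightarrow> fun_calc circ R E f u (U f)"
  using U by (simp add: is_spectral_map_def)

lemma cal_U: "f \<in> L2 \<rho> \<Longrightarrow> Rsp.cal f u (U f)"
  by (rule Rsp.fun_calc_cal[OF fun_calc_U])

lemma U_in: "f \<in> L2 \<rho> \<Longrightarrow> U f \<in> R"
  using fun_calc_U by (simp add: fun_calc_def)

lemma U_L2: "f \<in> L2 \<rho> \<Longrightarrow> U f \<in> L2 circ"
  by (intro R_L2 U_in)

lemma U_H2: "f \<in> L2 \<rho> \<Longrightarrow> U f \<in> H2"
  by (intro R_H2 U_in)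

lemma U_inner: "f \<in> L2 \<rho> \<Longrightarrow> g \<in> L2 \<rho> \<Longrightarrow> inner2 circ (U f) (U g) = inner2 \<rho> f g"
  unfolding rho_eq by (intro Rsp.fun_calc_isometry fun_calc_U[unfolded rho_eq])

lemma norm_U: "f \<in> L2 \<rho> \<Longrightarrow> norm2 circ (U f) = norm2 \<rho> f"
  using U_inner[of f f] by (metis norm2_eq_inner2 norm2_nonneg power2_eq_iff_nonneg)

text \<open>Each value of \<open>U\<close> is specified separately, so linearity has to be derived.
  It follows from preservation of inner products: the defect \<open>d\<close> is orthogonal to every
  value of \<open>U\<close> and is itself a combination of three of them.\<close>

lemma U_lincomb:
  assumes f: "f \<in> L2 \<rho>" and g: "g \<in> L2 \<rho>"
  shows "eq_ae circ (U (\<lambda>s. a * f s + b * g s)) (\<lambda>z. a * U f z + b * U g z)"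
proof -
  define h where "h = (\<lambda>s. a * f s + b * g s)"
  have h: "h \<in> L2 \<rho>" unfolding h_def by (intro L2_lincomb f g)
  define d where "d = (\<lambda>z. U h z - (a * U f z + b * U g z))"
  have L: "(\<lambda>z. a * U f z + b * U g z) \<in> L2 circ" by (intro L2_lincomb U_L2 f g)
  have d: "d \<in> L2 circ" unfolding d_def by (intro L2_diff U_L2 L h)
  have perp: "inner2 circ d (U k) = 0" if k: "k \<in> L2 \<rho>" for k
  proof -
    have "inner2 circ d (U k) = inner2 \<rho> h k - (a * inner2 \<rho> f k + b * inner2 \<rho> g k)"
      unfolding d_def using f g h k L by (simp add: inner2_left L2_scale U_L2 U_inner)
    also have "\<dots> = 0" unfolding h_def using f g k by (simp add: inner2_left L2_scale)
    finally show ?thesis .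
  qed
  have "inner2 circ d d = inner2 circ d (U h) - (cnj a * inner2 circ d (U f) + cnj b * inner2 circ d (U g))"
    using f g h L d by (subst (2) d_def) (simp add: inner2_right L2_scale U_L2)
  then have "norm2 circ d = 0" using perp f g h by (simp add: inner2_self)
  then show ?thesis using eq_ae_iff_norm2_diff[OF U_L2[OF h] L] by (simp add: d_def h_def)
qed

lemma norm_U_diff:
  assumes f: "f \<in> L2 \<rho>" and g: "g \<in> L2 \<rho>"
  shows "norm2 circ (\<lambda>z. U f z - U g z) = norm2 \<rho> (\<lambda>s. f s - g s)"
proof -
  have "eq_ae circ (U (\<lambda>s. f s - g s)) (\<lambda>z. U f z - U g z)"
    using U_lincomb[OF f g, of 1 "-1"] by simp
  then have "norm2 circ (\<lambda>z. U f z - U g z) = norm2 circ (U (\<lambda>s. f s - g s))"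
    using f g by (intro norm2_cong[OF eq_ae_sym]) (auto intro: U_L2 L2_diff)
  then show ?thesis using norm_U[OF L2_diff[OF f g]] by simp
qed

lemma one_rho [simp]: "(\<lambda>s. 1) \<in> L2 \<rho>"
  by (rule L2_bounded[OF finite_rho]) auto

lemma U_one: "eq_ae circ (U (\<lambda>s. 1)) u"
  by (rule Rsp.cal_unique[OF cal_U[OF one_rho] Rsp.cal_one[OF u_in_R]]) simp

lemma indicator_rho: "B \<in> sets borel \<Longrightarrow> indicator B \<in> L2 \<rho>"
  by (rule L2_bounded[OF finite_rho, where C=1]) (auto simp: indicator_def)

lemma U_indicator: "B \<in> sets borel \<Longrightarrow> eq_ae circ (U (indicator B)) (E B u)"
  by (rule Rsp.cal_unique[OF cal_U[OF indicator_rho] Rsp.cal_indicator[OF u_in_R]]) auto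

text \<open>The orthogonal complement in \<open>R\<close> of the cyclic subspace that the spectral
  projections generate from \<open>u\<close>. Taking \<open>W\<close> as the complement of
  \<open>N\<close> in turn makes it closed, linear and insensitive to null sets, which the literal
  set of values of \<open>U\<close> need not be; \<open>W_eq_U\<close> relates the two.\<close>

definition "N = {n \<in> R. \<forall>B\<in>sets borel. inner2 circ n (E B u) = 0}"

definition "W = {w \<in> R. \<forall>n\<in>N. inner2 circ n w = 0}"

lemma U_in_W: "f \<in> L2 \<rho> \<Longrightarrow> U f \<in> W"
  using cal_U[of f] by (auto simp: W_def N_def Rsp.cal_def U_in)

lemma E_u_in_W: "B \<in> sets borel \<Longrightarrow> E B u \<in> W"
  by (auto simp: W_def N_def E_in_R u_in_R)

lemma N_perp_u: "n \<in> N \<Longrightarrow> inner2 circ n u = 0"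
proof -
  assume n: "n \<in> N"
  then have nR: "n \<in> R" by (simp add: N_def)
  have "inner2 circ n u = inner2 circ n (E UNIV u)"
    using nR u by (intro inner2_cong eq_ae_sym[OF sp.E_UNIV] eq_ae_refl R_L2 H2_L2 sp.E_L2) auto
  then show ?thesis using n by (simp add: N_def)
qed

lemma W_R: "w \<in> W \<Longrightarrow> w \<in> R" and N_R: "n \<in> N \<Longrightarrow> n \<in> R"
  by (auto simp: W_def N_def)

lemma N_W_perp: "n \<in> N \<Longrightarrow> w \<in> W \<Longrightarrow> inner2 circ n w = 0"
  by (auto simp: W_def)

lemma W_N_perp: "n \<in> N \<Longrightarrow> w \<in> W \<Longrightarrow> inner2 circ w n = 0"
  using N_W_perp by (metis inner2_cnj complex_cnj_zero)

lemma subspace2_N: "subspace2 circ N"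
  using u by (auto simp: subspace2_def N_def R_L2 subspace2_zero[OF subspace2_R]
      subspace2_lincomb[OF subspace2_R] inner2_left L2_scale sp.E_L2)

lemma subspace2_W: "subspace2 circ W"
  by (auto simp: subspace2_def W_def R_L2 N_R subspace2_zero[OF subspace2_R]
      subspace2_lincomb[OF subspace2_R] inner2_right L2_scale)

text \<open>The foot \<open>g0\<close> of the projection is only a limit of values
  \<open>U (F n)\<close>. As \<open>U\<close> is isometric, the \<open>F n\<close> form a Cauchy
  sequence, and completeness of \<open>L2 \<rho>\<close> yields \<open>f\<close> with
  \<open>U f\<close> equal to \<open>g0\<close>. In \<open>S\<close> the values of \<open>U\<close>
  are taken up to null sets, which makes it a linear subspace.\<close>

lemma decomposition:
  assumes g: "g \<in> R"
  obtains f where "f \<in> L2 \<rho>" "(\<lambda>z. g z - U f z) \<in> N"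
proof -
  define S where "S = {h \<in> R. \<exists>f\<in>L2 \<rho>. eq_ae circ h (U f)}"
  have S: "subspace2 circ S"
    unfolding subspace2_def
  proof (intro conjI ballI allI subsetI)
    have "eq_ae circ (U (\<lambda>s. 0)) (\<lambda>z. 0)" using U_lincomb[OF zero_in_L2 zero_in_L2, of 0 0] by simp
    then show "(\<lambda>z. 0) \<in> S"
      using subspace2_zero[OF subspace2_R] by (auto simp: S_def intro!: bexI[of _ "\<lambda>s. 0"] intro: eq_ae_sym)
    fix h k a b assume "h \<in> S" "k \<in> S"
    then obtain f1 f2 where f: "f1 \<in> L2 \<rho>" "f2 \<in> L2 \<rho>" "eq_ae circ h (U f1)" "eq_ae circ k (U f2)"
      and hk: "h \<in> R" "k \<in> R" by (auto simp: S_def)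
    have "eq_ae circ (\<lambda>z. a * h z + b * k z) (\<lambda>z. a * U f1 z + b * U f2 z)"
      by (intro eq_ae_lincomb f)
    also have "eq_ae circ \<dots> (U (\<lambda>s. a * f1 s + b * f2 s))" by (intro eq_ae_sym[OF U_lincomb] f)
    finally show "(\<lambda>z. a * h z + b * k z) \<in> S"
      using hk f by (auto simp: S_def intro!: subspace2_lincomb[OF subspace2_R] bexI[of _ "\<lambda>s. a * f1 s + b * f2 s"] L2_lincomb)
  qed (auto simp: S_def R_L2)
  obtain g0 where g0: "g0 \<in> L2 circ" "\<And>e. e > 0 \<Longrightarrow> \<exists>s\<in>S. norm2 circ (\<lambda>z. g0 z - s z) < e"
    "\<And>s. s \<in> S \<Longrightarrow> inner2 circ (\<lambda>z. g z - g0 z) s = 0"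
    by (rule projection2[OF S R_L2[OF g]], rule that)
  have "\<exists>f\<in>L2 \<rho>. norm2 circ (\<lambda>z. g0 z - U f z) < e" if e: "e > 0" for e
  proof -
    obtain s f where s: "s \<in> R" "norm2 circ (\<lambda>z. g0 z - s z) < e" and f: "f \<in> L2 \<rho>" "eq_ae circ s (U f)"
      using g0(2)[OF e] by (auto simp: S_def)
    have "norm2 circ (\<lambda>z. g0 z - U f z) = norm2 circ (\<lambda>z. g0 z - s z)"
      by (intro norm2_cong eq_ae_diff eq_ae_refl eq_ae_sym[OF f(2)] L2_diff U_L2 R_L2 f g0 s)
    then show ?thesis using s f by (intro bexI[of _ f]) simp_all
  qed
  then have "\<exists>f\<in>L2 \<rho>. norm2 circ (\<lambda>z. g0 z - U f z) < 1 / real (Suc n)" for n by simp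
  then obtain F where F: "\<And>n. F n \<in> L2 \<rho>" "\<And>n. norm2 circ (\<lambda>z. g0 z - U (F n) z) < 1 / real (Suc n)"
    by metis
  have Flim: "(\<lambda>n. norm2 circ (\<lambda>z. g0 z - U (F n) z)) \<longlonglongrightarrow> 0"
  proof (rule Lim_null_comparison)
    show "(\<lambda>n. 1 / real (Suc n)) \<longlonglongrightarrow> 0" by (rule LIMSEQ_Suc[OF lim_1_over_n])
    show "\<forall>\<^sub>F n in sequentially. norm (norm2 circ (\<lambda>z. g0 z - U (F n) z)) \<le> 1 / real (Suc n)"
      using F(2) by (intro always_eventually allI) (simp add: less_imp_le)
  qed
  have "\<exists>N. \<forall>m\<ge>N. \<forall>n\<ge>N. norm2 \<rho> (\<lambda>s. F m s - F n s) < e" if e: "e > 0" for e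
  proof -
    have "\<forall>\<^sub>F n in sequentially. norm2 circ (\<lambda>z. g0 z - U (F n) z) < e/2"
      using e by (intro order_tendstoD(2)[OF Flim]) simp
    then obtain N where N: "\<And>n. n \<ge> N \<Longrightarrow> norm2 circ (\<lambda>z. g0 z - U (F n) z) < e/2"
      by (auto simp: eventually_sequentially)
    have "norm2 \<rho> (\<lambda>s. F m s - F n s) < e" if "m \<ge> N" "n \<ge> N" for m n
    proof -
      have "norm2 \<rho> (\<lambda>s. F m s - F n s) = norm2 circ (\<lambda>z. U (F m) z - U (F n) z)"
        using norm_U_diff F(1) by simp
      also have "\<dots> \<le> norm2 circ (\<lambda>z. U (F m) z - g0 z) + norm2 circ (\<lambda>z. g0 z - U (F n) z)"
        by (intro norm2_diff_triangle U_L2 F g0)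
      finally show ?thesis using N[OF that(1)] N[OF that(2)] norm2_minus_commute[of circ g0 "U (F m)"] by simp
    qed
    then show ?thesis by blast
  qed
  from L2_complete[of F \<rho>, OF F(1) this] obtain f
    where f: "f \<in> L2 \<rho>" "(\<lambda>n. norm2 \<rho> (\<lambda>s. F n s - f s)) \<longlonglongrightarrow> 0" .
  have "norm2 circ (\<lambda>z. g0 z - U f z) \<le> 0"
  proof (rule LIMSEQ_le_const)
    show "(\<lambda>n. norm2 circ (\<lambda>z. g0 z - U (F n) z) + norm2 \<rho> (\<lambda>s. F n s - f s)) \<longlonglongrightarrow> 0"
      using tendsto_add[OF Flim f(2)] by simp
    have "norm2 circ (\<lambda>z. g0 z - U f z) \<le> norm2 circ (\<lambda>z. g0 z - U (F n) z) + norm2 \<rho> (\<lambda>s. F n s - f s)" for n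
      using norm2_diff_triangle[OF g0(1) U_L2[OF F(1)] U_L2[OF f(1)], of n] norm_U_diff[OF F(1) f(1), of n] by simp
    then show "\<exists>N. \<forall>n\<ge>N. norm2 circ (\<lambda>z. g0 z - U f z)
        \<le> norm2 circ (\<lambda>z. g0 z - U (F n) z) + norm2 \<rho> (\<lambda>s. F n s - f s)" by blast
  qed
  then have "norm2 circ (\<lambda>z. g0 z - U f z) = 0" using norm2_nonneg[of circ "\<lambda>z. g0 z - U f z"] by linarith
  then have eq: "eq_ae circ g0 (U f)" using eq_ae_iff_norm2_diff[OF g0(1) U_L2[OF f(1)]] by simp
  have "inner2 circ (\<lambda>z. g z - U f z) (E B u) = 0" if B: "B \<in> sets borel" for B
  proof -
    have EB: "E B u \<in> S"
      using U_indicator[OF B] indicator_rho[OF B] E_in_R[OF u_in_R B] by (auto simp: S_def intro: eq_ae_sym)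
    have "inner2 circ (\<lambda>z. g z - U f z) (E B u) = inner2 circ (\<lambda>z. g z - g0 z) (E B u)"
      using B by (intro inner2_cong eq_ae_diff eq_ae_refl eq_ae_sym[OF eq] L2_diff R_L2[OF g] U_L2 f g0 sp.E_L2 u)
    then show ?thesis using g0(3)[OF EB] by simp
  qed
  then have "(\<lambda>z. g z - U f z) \<in> N"
    using g f by (auto simp: N_def intro!: subspace2_diff[OF subspace2_R] U_in)
  with f(1) show thesis by (rule that)
qed

lemma W_eq_U:
  assumes w: "w \<in> W"
  obtains f where "f \<in> L2 \<rho>" "eq_ae circ w (U f)"
proof -
  obtain f where f: "f \<in> L2 \<rho>" "(\<lambda>z. w z - U f z) \<in> N" by (rule decomposition[OF W_R[OF w]], rule that)
  have "(\<lambda>z. w z - U f z) \<in> W" by (intro subspace2_diff[OF subspace2_W] w U_in_W f)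
  then have "inner2 circ (\<lambda>z. w z - U f z) (\<lambda>z. w z - U f z) = 0" using f(2) by (intro N_W_perp)
  then have "norm2 circ (\<lambda>z. w z - U f z) = 0" by (simp add: inner2_self)
  then have "eq_ae circ w (U f)" using eq_ae_iff_norm2_diff[OF R_L2[OF W_R[OF w]] U_L2[OF f(1)]] by simp
  with f(1) show thesis by (rule that)
qed

text \<open>\<open>A x\<close> lies in the closed cyclic subspace generated by \<open>x\<close>.
  Hence it is orthogonal to whatever is orthogonal to all \<open>E C x\<close>: to the kernel of
  \<open>H\<close>, which puts it in \<open>R\<close>, and to all \<open>E B u\<close>, which puts
  it in \<open>N\<close>.\<close>

lemma A_N:
  assumes x: "x \<in> N"
  shows "A x \<in> N"
proof -
  have xR: "x \<in> R" and xH: "x \<in> H2" using x N_R R_H2 by auto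
  have c: "inner2 circ k (A x) = 0" if "k \<in> H2" "\<And>B. B \<in> sets borel \<Longrightarrow> inner2 circ k (E B x) = 0" for k
    using sp.fun_calc_cal[OF fun_calc_A[OF xH]] that by (auto simp: sp.cal_def)
  have "A x \<in> R"
  proof (rule in_R_by_ker)
    fix k assume k: "k \<in> H2" "norm2 circ (H k) = 0"
    have "inner2 circ k (A x) = 0"
      using ker_perp_R[OF k E_in_R[OF xR]] by (intro c k)
    then show "inner2 circ (A x) k = 0" by (metis inner2_cnj complex_cnj_zero)
  qed (intro A_in xH)
  moreover have "inner2 circ (A x) (E B u) = 0" if B: "B \<in> sets borel" for B
  proof -
    have "inner2 circ (E B u) (A x) = 0"
    proof (rule c)
      fix C :: "real set" assume C: "C \<in> sets borel"
      have "inner2 circ (E B u) (E C x) = inner2 circ (E (B \<inter> C) u) x"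
        by (intro sp.E_inner_E B C u xH)
      also have "\<dots> = cnj (inner2 circ x (E (B \<inter> C) u))" by (rule inner2_cnj[symmetric])
      also have "\<dots> = 0" using x B C by (simp add: N_def)
      finally show "inner2 circ (E B u) (E C x) = 0" .
    qed (intro sp.E_in B u)
    then show ?thesis by (metis inner2_cnj complex_cnj_zero)
  qed
  ultimately show ?thesis by (simp add: N_def)
qed

lemma HH_N:
  assumes x: "x \<in> N"
  shows "H (H x) \<in> N"
proof -
  have xH: "x \<in> H2" using x N_R R_H2 by auto
  have "inner2 circ (H (H x)) (E B u) = inner2 circ (A (A x)) (E B u)" if "B \<in> sets borel" for B
    using xH that u by (intro inner2_cong eq_ae_sym[OF AA] eq_ae_refl H_L2 H_in A_L2 A_in sp.E_L2)
  then show ?thesis using A_N[OF A_N[OF x]] xH by (simp add: N_def H_in_R H_in)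
qed

lemma HH_sym:
  assumes "f \<in> H2" "g \<in> H2"
  shows "inner2 circ (H (H f)) g = inner2 circ f (H (H g))"
  using H2_sym[OF assms] H2_sym[OF assms(2,1)] inner2_cnj by metis

lemma HH_W:
  assumes w: "w \<in> W"
  shows "H (H w) \<in> W"
proof -
  have wH: "w \<in> H2" using w W_R R_H2 by auto
  have "inner2 circ n (H (H w)) = 0" if n: "n \<in> N" for n
    using N_W_perp[OF HH_N[OF n] w] HH_sym[OF R_H2[OF N_R[OF n]] wH] by simp
  then show ?thesis using wH by (simp add: W_def H_in_R H_in)
qed

text \<open>Elements of \<open>N\<close> are orthogonal to \<open>u\<close>, so the rank one term of
  \<open>Ht_square\<close> disappears; in \<open>HtHt_W\<close> the same happens when testing
  against \<open>N\<close>.\<close>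

lemma HtHt_N:
  assumes x: "x \<in> N"
  shows "Ht (Ht x) \<in> N"
proof -
  have xH: "x \<in> H2" using x N_R R_H2 by auto
  have "inner2 circ (Ht (Ht x)) (E B u) = 0" if "B \<in> sets borel" for B
    using Ht_square[OF xH sp.E_in[OF that u]] N_perp_u[OF x] HH_N[OF x] that by (simp add: N_def)
  then show ?thesis using xH R_H2[OF Ht_in_R[OF xH]] by (simp add: N_def Ht_in_R)
qed

lemma HtHt_W:
  assumes w: "w \<in> W"
  shows "Ht (Ht w) \<in> W"
proof -
  have wH: "w \<in> H2" using w W_R R_H2 by auto
  have "inner2 circ n (Ht (Ht w)) = 0" if n: "n \<in> N" for n
  proof -
    have "inner2 circ u n = 0" using N_perp_u[OF n] by (metis inner2_cnj complex_cnj_zero)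
    then have "inner2 circ (Ht (Ht w)) n = 0"
      using Ht_square[OF wH R_H2[OF N_R[OF n]]] W_N_perp[OF n HH_W[OF w]] by simp
    then show ?thesis by (metis inner2_cnj complex_cnj_zero)
  qed
  then show ?thesis using wH R_H2[OF Ht_in_R[OF wH]] by (simp add: W_def Ht_in_R)
qed

text \<open>The case \<open>T = K \<circ> K\<close> of the cyclic lemma, stated for a general
  \<open>K\<close> so as to serve both \<open>H\<close> and \<open>Ht\<close>. Its commutation
  condition amounts to two applications of the symmetry of \<open>K\<close>; the components of the
  cyclic vector come from \<open>decomposition\<close>.\<close>

lemma antilinear_square_reducing:
  assumes K: "bounded_antilinear_on circ H2 K" and KR: "\<And>f. f \<in> R \<Longrightarrow> K f \<in> R"
    and sym: "\<And>f g. f \<in> H2 \<Longrightarrow> g \<in> H2 \<Longrightarrow> inner2 circ (K f) g = inner2 circ (K g) f"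
    and s: "simple_spectrum circ R (K \<circ> K)"
    and KN: "\<And>x. x \<in> N \<Longrightarrow> K (K x) \<in> N" and KW: "\<And>x. x \<in> W \<Longrightarrow> K (K x) \<in> W"
    and n: "n \<in> N" and w: "w \<in> W"
  shows "inner2 circ (K n) w = 0" "inner2 circ n (K w) = 0"
proof -
  have bK: "bounded_antilinear_on circ R K"
    using K R_H2 KR by (intro bounded_antilinear_on_restrict[OF K]) auto
  obtain v where v: "cyclic_vector circ R (K \<circ> K) v" using s by (auto simp: simple_spectrum_def)
  then have vR: "v \<in> R" by (simp add: cyclic_vector_def)
  obtain f where f: "f \<in> L2 \<rho>" "(\<lambda>z. v z - U f z) \<in> N" by (rule decomposition[OF vR], rule that)
  show 1: "inner2 circ (K n) w = 0"
  proof (rule cyclic_antilinear_reducing[OF subspace2_R bounded_antilinear_comp[OF subspace2_R bK bK] bK _ v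
        subspace2_N _ _ subspace2_W _ _ N_W_perp f(2) U_in_W[OF f(1)] _ n w])
    fix x y assume "x \<in> R" "y \<in> R"
    then have x: "x \<in> H2" "K x \<in> H2" "K (K x) \<in> H2" and y: "y \<in> H2" "K y \<in> H2" using KR R_H2 by auto
    have "inner2 circ (K (K (K x))) y = inner2 circ (K y) (K (K x))" by (intro sym x y)
    also have "\<dots> = cnj (inner2 circ (K (K x)) (K y))" by (rule inner2_cnj[symmetric])
    also have "\<dots> = cnj (inner2 circ (K (K y)) (K x))" using sym[OF x(2) y(2)] by simp
    also have "\<dots> = inner2 circ (K x) (K (K y))" by (rule inner2_cnj)
    finally show "inner2 circ (K ((K \<circ> K) x)) y = inner2 circ (K x) ((K \<circ> K) y)" by simp
  qed (use KN KW N_R W_R in auto)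
  then have "inner2 circ (K w) n = 0" using sym R_H2 N_R W_R n w by metis
  then show "inner2 circ n (K w) = 0" by (metis inner2_cnj complex_cnj_zero)
qed

end

section \<open>Transfer of simple spectra to the given Hankel operator\<close>

lemma closure_range_cong:
  assumes V: "subspace2 M V" and T: "\<And>f. f \<in> V \<Longrightarrow> T f \<in> V" and T': "\<And>f. f \<in> V \<Longrightarrow> T' f \<in> V"
    and eq: "\<And>f. f \<in> V \<Longrightarrow> eq_ae M (T f) (T' f)"
  shows "closure_range M V T = closure_range M V T'"
proof -
  have "norm2 M (\<lambda>x. g x - T f x) = norm2 M (\<lambda>x. g x - T' f x)" if "g \<in> V" "f \<in> V" for f g
    using that by (intro norm2_cong eq_ae_diff eq_ae_refl eq L2_diff subspace2D[OF V] T T')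
  then show ?thesis by (auto simp: closure_range_def)
qed

text \<open>The operator \<open>H'\<close> provided by \<open>BMOA_simp\<close> agrees with
  \<open>H\<close> up to null sets. So the closed ranges coincide, and a cyclic vector for one
  square is cyclic for the other.\<close>

lemma (in hankel_op) simple_spectra:
  assumes "u \<in> BMOA_simp"
  shows "simple_spectrum circ R (H \<circ> H)" "simple_spectrum circ R (Ht \<circ> Ht)"
proof -
  obtain H' where H': "is_hankel u H'"
    and s: "simple_spectrum circ (closure_range circ H2 H') (H' \<circ> H')"
      "simple_spectrum circ (closure_range circ H2 H') (hankel_tilde H' \<circ> hankel_tilde H')"
    using assms by (auto simp: BMOA_simp_def)
  interpret H': hankel_op u H' by (rule hankel_op.intro[OF u H'])
  note eq = hankel_unique[OF H'.hankel_op_axioms]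
  have R: "H'.R = R"
    by (rule closure_range_cong[OF subspace2_H2 H'.H_in H_in eq_ae_sym[OF eq]])
  have sq: "simple_spectrum circ R (K \<circ> K)"
    if K: "bounded_antilinear_on circ H2 K" "\<And>f. f \<in> H2 \<Longrightarrow> K f \<in> R" "\<And>f. f \<in> H2 \<Longrightarrow> K' f \<in> R"
      and KK': "\<And>f. f \<in> H2 \<Longrightarrow> eq_ae circ (K f) (K' f)" and s: "simple_spectrum circ R (K' \<circ> K')" for K K'
  proof (rule simple_spectrum_cong[OF subspace2_R _ _ _ s])
    have "bounded_antilinear_on circ R K"
      using K R_H2 by (intro bounded_antilinear_on_restrict[OF K(1)]) auto
    then show "bounded_linear_on circ R (K \<circ> K)" by (intro bounded_antilinear_comp subspace2_R)
    fix f assume f: "f \<in> R"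
    then have fH: "f \<in> H2" and KH: "K f \<in> H2" "K' f \<in> H2" using K R_H2 by auto
    show "(K' \<circ> K') f \<in> R" using K(3) KH by simp
    have "eq_ae circ (K (K f)) (K (K' f))" by (rule bounded_antilinear_on_cong[OF subspace2_H2 K(1) KH KK'[OF fH]])
    also have "eq_ae circ \<dots> (K' (K' f))" by (rule KK'[OF KH(2)])
    finally show "eq_ae circ ((K \<circ> K) f) ((K' \<circ> K') f)" by simp
  qed
  show "simple_spectrum circ R (H \<circ> H)"
    using s(1) unfolding R by (intro sq[OF anti H_in_R _ eq]) (simp_all add: H'.H_in_R flip: R)
  have "eq_ae circ (Ht f) (hankel_tilde H' f)" if "f \<in> H2" for f
    unfolding hankel_tilde_def comp_def using that
    by (intro bounded_linear_on_cong[OF subspace2_H2 bounded_linear_shift_star] eq H_in H'.H_in)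
  then show "simple_spectrum circ R (Ht \<circ> Ht)"
    using s(2) unfolding R by (intro sq[OF anti_Ht Ht_in_R]) (simp_all add: H'.Ht_in_R flip: R)
qed

section \<open>Invariance of \<open>W\<close> under the Hankel operators and the backward
  shift\<close>

locale hankel_simple = hankel_spectral_map u H A E \<rho> U for u H A E \<rho> U +
  assumes u_simp: "u \<in> BMOA_simp"
begin

lemma H_reducing:
  assumes n: "n \<in> N" and w: "w \<in> W"
  shows "inner2 circ (H n) w = 0" "inner2 circ n (H w) = 0" "inner2 circ n (Ht w) = 0"
proof -
  note H_args = anti H_in_R[OF R_H2] H_sym simple_spectra(1)[OF u_simp] HH_N HH_W n w
  show "inner2 circ (H n) w = 0" by (rule antilinear_square_reducing(1)[OF H_args])
  show "inner2 circ n (H w) = 0" by (rule antilinear_square_reducing(2)[OF H_args])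
  show "inner2 circ n (Ht w) = 0"
    by (rule antilinear_square_reducing(2)
        [OF anti_Ht Ht_in_R[OF R_H2] Ht_sym simple_spectra(2)[OF u_simp] HtHt_N HtHt_W n w])
qed

lemma H_W: "w \<in> W \<Longrightarrow> H w \<in> W"
  and Ht_W: "w \<in> W \<Longrightarrow> Ht w \<in> W"
  using H_reducing(2,3) H_in_R[OF R_H2[OF W_R]] Ht_in_R[OF R_H2[OF W_R]] by (simp_all add: W_def)

lemma H_N: "n \<in> N \<Longrightarrow> H n \<in> N"
  using H_reducing(1)[OF _ E_u_in_W] H_in_R[OF R_H2[OF N_R]] by (simp add: N_def)

text \<open>\<open>H\<close> maps \<open>W\<close> onto a dense subspace of \<open>W\<close>, on which \<open>S\<^sup>*\<close> acts as \<open>S\<^sup>* H w = Ht w\<close>.\<close>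

lemma shift_star_W:
  assumes x: "x \<in> W"
  shows "shift_star x \<in> W"
proof -
  have xR: "x \<in> R" and xH: "x \<in> H2" using x W_R R_H2 by auto
  have "inner2 circ n (shift_star x) = 0" if n: "n \<in> N" for n
  proof (rule zero_by_eps)
    fix e :: real assume e: "e > 0"
    have nL: "n \<in> L2 circ" using n N_R R_L2 by auto
    obtain f where f: "f \<in> H2" "norm2 circ (\<lambda>z. x z - H f z) < e" by (rule R_approx[OF xR e])
    \<comment> \<open>The approximant \<open>f\<close> may have components outside \<open>W\<close>.
      The one orthogonal to \<open>R\<close> is killed by \<open>H\<close>; the rest splits into
      \<open>w\<close> in \<open>W\<close> and \<open>m\<close> in \<open>N\<close>.\<close>
    obtain r where r: "r \<in> R" "\<And>s. s \<in> R \<Longrightarrow> inner2 circ (\<lambda>z. f z - r z) s = 0"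
      by (rule R_projection[OF f(1)], rule that)
    obtain a where a: "a \<in> L2 \<rho>" "(\<lambda>z. r z - U a z) \<in> N" by (rule decomposition[OF r(1)], rule that)
    define w where "w = U a"
    define m where "m = (\<lambda>z. r z - U a z)"
    have w: "w \<in> W" "w \<in> H2" and m: "m \<in> N" "m \<in> H2"
      using a U_in_W N_R W_R R_H2 by (auto simp: w_def m_def)
    have rH: "r \<in> H2" using r R_H2 by auto
    have "norm2 circ (H (\<lambda>z. f z - r z)) = 0"
      by (intro norm_H_perp_R subspace2_diff[OF subspace2_H2] f rH r(2))
    then have "norm2 circ (\<lambda>z. H f z - H r z) = 0"
      using bounded_antilinear_on_diff[OF subspace2_H2 anti f(1) rH] by simp
    then have "eq_ae circ (H f) (H r)" using eq_ae_iff_norm2_diff[OF H_L2[OF f(1)] H_L2[OF rH]] by simp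
    also have "eq_ae circ (H r) (\<lambda>z. H w z + H m z)"
      using bounded_antilinear_on_lincomb[OF anti w(2) m(2), of 1 1] by (simp add: w_def m_def)
    finally have Hf: "eq_ae circ (H f) (\<lambda>z. H w z + H m z)" .
    have Hw: "H w \<in> W" "H w \<in> H2" and Hm: "H m \<in> N" using H_W H_N H_in w m by auto
    have L: "x \<in> L2 circ" "H w \<in> L2 circ" "H m \<in> L2 circ"
      using xR Hw Hm H_L2 R_L2 w m by auto
    \<comment> \<open>Since \<open>H m\<close> lies in \<open>N\<close> and \<open>x - H w\<close>
      in \<open>W\<close>, the two are orthogonal, and discarding \<open>H m\<close> only improves
      the approximation of \<open>x\<close>.\<close>
    define b where "b = (\<lambda>z. x z - H w z)"
    define c where "c = (\<lambda>z. (- 1) * H m z)"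
    have b: "b \<in> W" unfolding b_def by (intro subspace2_diff[OF subspace2_W] x Hw)
    have c: "c \<in> N" unfolding c_def by (intro subspace2_scale[OF subspace2_N] Hm)
    have bc: "b \<in> L2 circ" "c \<in> L2 circ" using b c W_R N_R R_L2 by auto
    have "eq_ae circ (\<lambda>z. x z - H f z) (\<lambda>z. x z - (H w z + H m z))" by (intro eq_ae_diff eq_ae_refl Hf)
    then have "eq_ae circ (\<lambda>z. x z - H f z) (\<lambda>z. b z + c z)" by (simp add: b_def c_def algebra_simps)
    then have "norm2 circ (\<lambda>z. x z - H f z) = norm2 circ (\<lambda>z. b z + c z)"
      by (intro norm2_cong L2_diff L2_add bc L H_L2 f)
    moreover have "(norm2 circ (\<lambda>z. b z + c z))\<^sup>2 = (norm2 circ b)\<^sup>2 + (norm2 circ c)\<^sup>2"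
      by (intro pythagoras2 bc W_N_perp b c)
    ultimately have "(norm2 circ b)\<^sup>2 \<le> (norm2 circ (\<lambda>z. x z - H f z))\<^sup>2" by simp
    then have be: "norm2 circ b \<le> e" using f(2) power2_le_imp_le[OF _ norm2_nonneg] by fastforce
    have "shift_star (H w) \<in> W" using Ht_W[OF w(1)] by (simp add: hankel_tilde_def)
    then have "inner2 circ n (shift_star (H w)) = 0" using n by (intro N_W_perp)
    then have "inner2 circ n (shift_star x) = inner2 circ n (\<lambda>z. shift_star x z - shift_star (H w) z)"
      using nL H2_L2[OF shift_star_in[OF xH]] H2_L2[OF shift_star_in[OF Hw(2)]] by (simp add: inner2_right)
    then have "cmod (inner2 circ n (shift_star x))
        \<le> norm2 circ n * norm2 circ (\<lambda>z. shift_star x z - shift_star (H w) z)"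
      using nL H2_L2[OF shift_star_in[OF xH]] H2_L2[OF shift_star_in[OF Hw(2)]]
      by (simp only:) (intro cauchy_schwarz2 L2_diff)
    also have "norm2 circ (\<lambda>z. shift_star x z - shift_star (H w) z) \<le> norm2 circ b"
      unfolding b_def using bounded_linear_on_diff[OF subspace2_H2 bounded_linear_shift_star xH Hw(2)]
        norm_shift_star[OF subspace2_diff[OF subspace2_H2 xH Hw(2)]] by simp
    finally have "cmod (inner2 circ n (shift_star x)) \<le> norm2 circ n * norm2 circ b"
      by (simp add: mult_left_mono)
    also have "\<dots> \<le> norm2 circ n * e" using be by (intro mult_left_mono) auto
    finally show "cmod (inner2 circ n (shift_star x)) \<le> e * norm2 circ n" by (simp add: mult.commute)
  qed
  then show ?thesis using xR by (simp add: W_def shift_star_in_R)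
qed

section \<open>The adjoint of the spectral map and the operator \<open>Sig\<close>\<close>

abbreviation "Us \<equiv> adjoint2 \<rho> (L2 \<rho>) circ R U"

text \<open>The witness for the adjoint sends \<open>g\<close> to the function \<open>f\<close> of
  \<open>decomposition\<close>: the remainder \<open>g - U f\<close> is in \<open>N\<close> and so
  orthogonal to all values of \<open>U\<close>.\<close>

lemma Us_in: "g \<in> R \<Longrightarrow> Us g \<in> L2 \<rho>"
  and Us_adj: "f \<in> L2 \<rho> \<Longrightarrow> g \<in> R \<Longrightarrow> inner2 circ (U f) g = inner2 \<rho> f (Us g)"
proof -
  have "\<exists>f. f \<in> L2 \<rho> \<and> (\<lambda>z. g z - U f z) \<in> N" if "g \<in> R" for g
    by (rule decomposition[OF that]) blast
  then obtain T' where T': "\<And>g. g \<in> R \<Longrightarrow> T' g \<in> L2 \<rho>" "\<And>g. g \<in> R \<Longrightarrow> (\<lambda>z. g z - U (T' g) z) \<in> N"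
    by metis
  have adj: "inner2 circ (U f) g = inner2 \<rho> f (T' g)" if f: "f \<in> L2 \<rho>" and g: "g \<in> R" for f g
  proof -
    have "inner2 circ (U f) (\<lambda>z. g z - U (T' g) z) = 0" using T'(2)[OF g] U_in_W[OF f] by (rule W_N_perp)
    then show ?thesis using f g T'(1)[OF g] by (simp add: inner2_right U_L2 R_L2 U_inner)
  qed
  show "g \<in> R \<Longrightarrow> Us g \<in> L2 \<rho>"
    "f \<in> L2 \<rho> \<Longrightarrow> g \<in> R \<Longrightarrow> inner2 circ (U f) g = inner2 \<rho> f (Us g)"
    using adjoint2_props[where T=U and T'=T', OF T'(1) adj] by blast+
qed

lemma norm_Us:
  assumes g: "g \<in> R"
  shows "norm2 \<rho> (Us g) \<le> norm2 circ g"
proof -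
  note s = Us_in[OF g]
  have "(norm2 \<rho> (Us g))\<^sup>2 = Re (inner2 circ (U (Us g)) g)"
    using Us_adj[OF s g] by (simp add: norm2_eq_inner2)
  also have "\<dots> \<le> norm2 \<rho> (Us g) * norm2 circ g"
    using cauchy_schwarz2[OF U_L2[OF s] R_L2[OF g]] complex_Re_le_cmod norm_U[OF s]
    by (metis order_trans)
  finally show ?thesis by (cases "norm2 \<rho> (Us g) = 0") (auto simp: power2_eq_square less_le)
qed

lemma U_Us:
  assumes w: "w \<in> W"
  shows "eq_ae circ (U (Us w)) w"
proof -
  note wR = W_R[OF w]
  obtain f where f: "f \<in> L2 \<rho>" "eq_ae circ w (U f)" by (rule W_eq_U[OF w], rule that)
  have "eq_ae \<rho> (Us w) f"
  proof (rule eq_ae_by_inner2[OF subspace2_L2 Us_in[OF wR] f(1)])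
    fix k assume k: "k \<in> L2 \<rho>"
    have "inner2 \<rho> k (Us w) = inner2 circ (U k) w" using Us_adj[OF k wR] by simp
    also have "\<dots> = inner2 circ (U k) (U f)" by (intro inner2_cong eq_ae_refl f U_L2 k R_L2 wR)
    also have "\<dots> = inner2 \<rho> k f" by (intro U_inner k f)
    finally show "inner2 \<rho> (Us w) k = inner2 \<rho> f k" by (metis inner2_cnj)
  qed
  then have "norm2 \<rho> (\<lambda>s. Us w s - f s) = 0" using eq_ae_iff_norm2_diff[OF Us_in[OF wR] f(1)] by simp
  then have "norm2 circ (\<lambda>z. U (Us w) z - U f z) = 0" using norm_U_diff[OF Us_in[OF wR] f(1)] by simp
  then have "eq_ae circ (U (Us w)) (U f)" using eq_ae_iff_norm2_diff[OF U_L2[OF Us_in[OF wR]] U_L2[OF f(1)]] by simp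
  also have "eq_ae circ (U f) w" by (rule eq_ae_sym[OF f(2)])
  finally show ?thesis .
qed

abbreviation "Sig \<equiv> Us \<circ> shift_star \<circ> U"

lemma Sig_in: "f \<in> L2 \<rho> \<Longrightarrow> Sig f \<in> L2 \<rho>"
  by (simp add: Us_in shift_star_in_R U_in)

text \<open>\<open>Us\<close> is a choice of representatives, so linearity is checked weakly; moving
  \<open>Us\<close> to the other side leaves only \<open>shift_star\<close> and \<open>U\<close> to
  be expanded.\<close>

lemma Sig_contraction: "contraction_on \<rho> (L2 \<rho>) Sig"
proof -
  have bd: "norm2 \<rho> (Sig f) \<le> norm2 \<rho> f" if f: "f \<in> L2 \<rho>" for f
    using norm_Us[OF shift_star_in_R[OF U_in[OF f]]] norm_shift_star[OF U_H2[OF f]] norm_U[OF f] by simp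
  have lin: "eq_ae \<rho> (Sig (\<lambda>x. a * f x + b * g x)) (\<lambda>x. a * Sig f x + b * Sig g x)"
    if f: "f \<in> L2 \<rho>" and g: "g \<in> L2 \<rho>" for f g a b
  proof (rule eq_ae_by_inner2[OF subspace2_L2])
    have h: "(\<lambda>x. a * f x + b * g x) \<in> L2 \<rho>" by (intro L2_lincomb f g)
    show "Sig (\<lambda>x. a * f x + b * g x) \<in> L2 \<rho>" by (rule Sig_in[OF h])
    show "(\<lambda>x. a * Sig f x + b * Sig g x) \<in> L2 \<rho>" by (intro L2_lincomb Sig_in f g)
    fix k assume k: "k \<in> L2 \<rho>"
    have S: "inner2 \<rho> k (Sig x) = inner2 circ (U k) (shift_star (U x))" if "x \<in> L2 \<rho>" for x
      using Us_adj[OF k shift_star_in_R[OF U_in[OF that]]] by simp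
    have SL: "shift_star (U x) \<in> L2 circ" if "x \<in> L2 \<rho>" for x
      by (intro H2_L2 shift_star_in U_H2 that)
    have "eq_ae circ (shift_star (U (\<lambda>x. a * f x + b * g x))) (shift_star (\<lambda>z. a * U f z + b * U g z))"
      by (intro bounded_linear_on_cong[OF subspace2_H2 bounded_linear_shift_star] U_H2 h U_lincomb f g
          subspace2_lincomb[OF subspace2_H2])
    also have "eq_ae circ \<dots> (\<lambda>z. a * shift_star (U f) z + b * shift_star (U g) z)"
      by (intro bounded_linear_on_lincomb[OF bounded_linear_shift_star] U_H2 f g)
    finally have "inner2 circ (U k) (shift_star (U (\<lambda>x. a * f x + b * g x)))
        = inner2 circ (U k) (\<lambda>z. a * shift_star (U f) z + b * shift_star (U g) z)"
      by (intro inner2_cong eq_ae_refl SL L2_lincomb f g h U_L2 k)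
    also have "\<dots> = cnj a * inner2 circ (U k) (shift_star (U f)) + cnj b * inner2 circ (U k) (shift_star (U g))"
      using f g k by (simp add: inner2_right L2_scale SL U_L2)
    finally have "inner2 \<rho> k (Sig (\<lambda>x. a * f x + b * g x)) = inner2 \<rho> k (\<lambda>x. a * Sig f x + b * Sig g x)"
      using S[OF h] S[OF f] S[OF g] f g k by (simp add: inner2_right L2_scale Sig_in[unfolded comp_def])
    then show "inner2 \<rho> (Sig (\<lambda>x. a * f x + b * g x)) k = inner2 \<rho> (\<lambda>x. a * Sig f x + b * Sig g x) k"
      by (rule inner2_flip)
  qed
  show ?thesis
    unfolding contraction_on_def bounded_linear_on_def
    using bd lin Sig_in by (auto intro!: exI[of _ 1])
qed

text \<open>\<open>U \<circ> Us\<close> cancels at each stage because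
  \<open>shift_star (U f)\<close> is in \<open>W\<close>.\<close>

lemma Sig_power:
  "(Sig ^^ k) (\<lambda>s. 1) \<in> L2 \<rho> \<and> eq_ae circ (U ((Sig ^^ k) (\<lambda>s. 1))) ((shift_star ^^ k) u)"
proof (induction k)
  case 0
  then show ?case using U_one by simp
next
  case (Suc k)
  define f where "f = (Sig ^^ k) (\<lambda>s. 1)"
  have f: "f \<in> L2 \<rho>" "eq_ae circ (U f) ((shift_star ^^ k) u)" using Suc unfolding f_def by blast+
  have "eq_ae circ (U (Us (shift_star (U f)))) (shift_star (U f))"
    by (intro U_Us shift_star_W U_in_W f)
  also have "eq_ae circ \<dots> (shift_star ((shift_star ^^ k) u))"
    using fourier_shift_star[OF u, of k]
    by (intro bounded_linear_on_cong[OF subspace2_H2 bounded_linear_shift_star] U_H2 f) auto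
  finally have "eq_ae circ (U (Sig f)) ((shift_star ^^ Suc k) u)" by simp
  moreover have "(Sig ^^ Suc k) (\<lambda>s. 1) = Sig f" by (simp only: f_def funpow.simps comp_apply)
  ultimately show ?case using Sig_in[OF f(1)] by (simp only:)
qed

text \<open>Let \<open>d n\<close> be a cutoff of \<open>1/s\<close>, and put
  \<open>x = d(A) u\<close> and \<open>y = d(A) x\<close>, so that \<open>A y = x\<close>. The
  squared norm of \<open>x\<close> is \<open><y, u>\<close>; as \<open>u = H 1\<close>, its modulus
  is that of \<open><H y, 1>\<close>, at most the norm of \<open>H y\<close>, which is that of
  \<open>A y = x\<close>. Hence \<open>x\<close> has norm at most \<open>1\<close>, uniformly in
  \<open>n\<close>, and Fatou's lemma concludes.\<close>

lemma integrable_inverse_square: "integrable \<rho> (\<lambda>s. 1 / s\<^sup>2)"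
proof -
  define d where "d n s = (if \<bar>s\<bar> \<ge> 1 / real (Suc n) then 1 / complex_of_real s else 0)" for n s
  have d_meas: "d n \<in> borel_measurable borel" for n unfolding d_def by measurable
  have d_bd: "cmod (d n s) \<le> real (Suc n)" for n s
  proof (cases "\<bar>s\<bar> \<ge> 1 / real (Suc n)")
    case True
    have "0 < 1 / real (Suc n)" by simp
    then have "\<bar>s\<bar> > 0" using True by linarith
    then show ?thesis using True by (simp add: d_def norm_divide field_simps)
  qed (simp add: d_def)
  have d2_bd: "cmod ((d n s)\<^sup>2) \<le> (real (Suc n))\<^sup>2" for n s
    unfolding norm_power by (intro power_mono d_bd) auto
  have d_rho: "d n \<in> borel_measurable \<rho>" for n using d_meas by simp
  have dL: "d n \<in> L2 \<rho>" for n by (rule L2_bounded[OF finite_rho d_rho d_bd])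
  have d2L: "(\<lambda>s. (d n s)\<^sup>2) \<in> L2 \<rho>" for n
    by (rule L2_bounded[OF finite_rho _ d2_bd]) (use d_rho in measurable)
  \<comment> \<open>Where \<open>d n\<close> is nonzero it equals \<open>1/s\<close>, so
    multiplication by \<open>s\<close> cancels one factor of its square.\<close>
  have sd: "complex_of_real s * (d n s)\<^sup>2 = d n s" for n s
    by (auto simp: d_def power2_eq_square)
  have bound: "(\<integral>s. (cmod (d n s))\<^sup>2 \<partial>\<rho>) \<le> 1" for n
  proof -
    define x where "x = U (d n)"
    define y where "y = U (\<lambda>s. (d n s)\<^sup>2)"
    have y: "y \<in> H2" unfolding y_def by (rule U_H2[OF d2L])
    have cy: "sp.cal (\<lambda>s. (d n s)\<^sup>2) u y" unfolding y_def by (rule cal_R_H2[OF cal_U[OF d2L]])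
    have cx: "sp.cal (d n) u x" unfolding x_def by (rule cal_R_H2[OF cal_U[OF dL]])
    have "integrable (sp.mu u) (\<lambda>s. complex_of_real s * (d n s)\<^sup>2)"
      unfolding sd using cx by (simp add: sp.cal_def)
    from sp.fun_calc_compose[OF cy fun_calc_A[OF y] this] have "sp.cal (d n) u (A y)" unfolding sd .
    then have "eq_ae circ (A y) x" by (rule sp.cal_unique[OF _ cx]) simp
    then have "norm2 circ (A y) = norm2 circ x"
      unfolding x_def by (intro norm2_cong A_L2 y U_L2 dL)
    then have Hy: "norm2 circ (H y) = norm2 circ x" by (simp add: norm_H_A[OF y])
    have "cmod (inner2 circ y u) = cmod (inner2 circ u y)" by (metis inner2_cnj complex_mod_cnj)
    also have "inner2 circ u y = inner2 circ (H (\<lambda>z. 1)) y"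
      by (intro inner2_cong eq_ae_sym[OF H_one] eq_ae_refl H2_L2 u y H_L2 H2_one)
    also have "\<dots> = inner2 circ (H y) (\<lambda>z. 1)" by (intro H_sym H2_one y)
    also have "cmod \<dots> \<le> norm2 circ (H y) * norm2 circ (\<lambda>z. 1)"
      by (intro cauchy_schwarz2 H_L2 y one_L2)
    also have "norm2 circ (\<lambda>z. 1) = 1" by (simp add: norm2_def measure_def)
    finally have le: "cmod (inner2 circ y u) \<le> norm2 circ x" by (simp add: Hy)
    have "inner2 circ y u = (\<integral>s. (d n s)\<^sup>2 \<partial>\<rho>)" unfolding rho_eq by (rule sp.cal_inner[OF cy])
    also have "\<dots> = inner2 \<rho> (d n) (d n)"
      unfolding inner2_def by (intro Bochner_Integration.integral_cong) (auto simp: d_def power2_eq_square)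
    also have "\<dots> = inner2 circ x x" unfolding x_def by (intro U_inner[symmetric] dL)
    also have "\<dots> = complex_of_real ((norm2 circ x)\<^sup>2)" by (rule inner2_self)
    finally have "(norm2 circ x)\<^sup>2 \<le> norm2 circ x" using le by (simp add: norm_power)
    then have "norm2 circ x \<le> 1" by (cases "norm2 circ x = 0") (auto simp: power2_eq_square less_le)
    then have "(norm2 circ x)\<^sup>2 \<le> 1" by (simp add: power_le_one)
    then show ?thesis using norm_U[OF dL, of n] by (simp add: x_def norm2_square)
  qed
  have "(\<integral>\<^sup>+s. ennreal (1 / s\<^sup>2) \<partial>\<rho>) \<le> (\<integral>\<^sup>+s. liminf (\<lambda>n. ennreal ((cmod (d n s))\<^sup>2)) \<partial>\<rho>)"
  proof (rule nn_integral_mono)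
    fix s :: real
    have "(\<lambda>n. (cmod (d n s))\<^sup>2) \<longlonglongrightarrow> 1 / s\<^sup>2"
    proof (cases "s = 0")
      case False
      obtain m :: nat where m: "1 / \<bar>s\<bar> < real m" using reals_Archimedean2 by blast
      have "(cmod (d n s))\<^sup>2 = 1 / s\<^sup>2" if "n \<ge> m" for n
      proof -
        have "1 / \<bar>s\<bar> < real (Suc n)" using m that by linarith
        then have "1 / real (Suc n) \<le> \<bar>s\<bar>" using False by (simp add: field_simps)
        then show ?thesis by (simp add: d_def norm_divide power_divide)
      qed
      then show ?thesis by (intro tendsto_eventually) (auto simp: eventually_sequentially)
    qed (simp add: d_def)
    then have "(\<lambda>n. ennreal ((cmod (d n s))\<^sup>2)) \<longlonglongrightarrow> ennreal (1 / s\<^sup>2)" by (rule tendsto_ennrealI)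
    from lim_imp_Liminf[OF _ this]
    show "ennreal (1 / s\<^sup>2) \<le> liminf (\<lambda>n. ennreal ((cmod (d n s))\<^sup>2))" by simp
  qed
  also have "\<dots> \<le> liminf (\<lambda>n. \<integral>\<^sup>+s. ennreal ((cmod (d n s))\<^sup>2) \<partial>\<rho>)"
    using d_meas by (intro nn_integral_liminf) measurable
  also have "\<dots> \<le> 1"
  proof (rule Liminf_le)
    have "(\<integral>\<^sup>+s. ennreal ((cmod (d n s))\<^sup>2) \<partial>\<rho>) \<le> 1" for n
      using bound[of n] L2_integrable[OF dL[of n]]
      by (subst nn_integral_eq_integral) (auto simp: ennreal_le_1)
    then show "\<forall>\<^sub>F n in sequentially. (\<integral>\<^sup>+s. ennreal ((cmod (d n s))\<^sup>2) \<partial>\<rho>) \<le> 1" by simp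
  qed simp
  finally have "(\<integral>\<^sup>+s. ennreal (1 / s\<^sup>2) \<partial>\<rho>) < \<infinity>" using ennreal_one_less_top by (auto intro: le_less_trans)
  then show ?thesis by (intro integrableI_nonneg) auto
qed

text \<open>With \<open>q = cnj \<Psi> / s\<close>, the defining property of \<open>\<Psi>\<close> gives \<open>H (U q) = A ((1/s)(A) u) = u = H 1\<close>,
  so that \<open>U q\<close> is the projection of \<open>1\<close> onto the closed range of \<open>H\<close>.\<close>

lemma Psi_projection:
  assumes Psi: "is_Psi R E H A u \<rho> \<Psi>" and q_def: "q = (\<lambda>s. cnj (\<Psi> s) / complex_of_real s)"
  shows "q \<in> L2 \<rho>" "g \<in> R \<Longrightarrow> inner2 circ g (U q) = inner2 circ g (\<lambda>z. 1)"
proof -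
  have [measurable]: "\<Psi> \<in> borel_measurable \<rho>" and uni: "AE s in \<rho>. cmod (\<Psi> s) = 1"
    using Psi by (auto simp: is_Psi_def)
  have q_meas: "q \<in> borel_measurable \<rho>" unfolding q_def by measurable
  have "integrable \<rho> (\<lambda>s. (cmod (q s))\<^sup>2)"
  proof (subst integrable_cong_AE)
    show "AE s in \<rho>. (cmod (q s))\<^sup>2 = 1 / s\<^sup>2"
      using uni by (rule AE_mp) (auto simp: q_def norm_divide power_divide)
    show "integrable \<rho> (\<lambda>s. 1 / s\<^sup>2)" by (rule integrable_inverse_square)
  qed (use q_meas in measurable)
  then show q: "q \<in> L2 \<rho>" using q_meas by (simp add: L2_def)
  obtain x y w where x: "fun_calc circ R E q u x"
    and y: "fun_calc circ R E (\<lambda>s. cnj (q s)) u y"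
    and w: "fun_calc circ R E (\<lambda>s. cnj (\<Psi> s)) y w"
    and Hx: "eq_ae circ (H x) (A w)"
    using Psi q unfolding is_Psi_def by blast
  have V: "x \<in> H2" "y \<in> H2" "w \<in> H2" using x y w R_H2 by (auto simp: fun_calc_def)
  \<comment> \<open>\<open>cnj (q s)\<close> is \<open>\<Psi> s / s\<close>, and
    \<open>\<Psi>\<close> is unimodular.\<close>
  have mu_inv: "AE s in \<rho>. cnj (\<Psi> s) * cnj (q s) = 1 / complex_of_real s"
    using uni
  proof (rule AE_mp, intro AE_I2 impI)
    fix s assume "cmod (\<Psi> s) = 1"
    then have "\<Psi> s * cnj (\<Psi> s) = 1" using complex_norm_square[of "\<Psi> s"] by simp
    then show "cnj (\<Psi> s) * cnj (q s) = 1 / complex_of_real s" by (simp add: q_def mult.commute)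
  qed
  have "integrable \<rho> (\<lambda>s. cnj (\<Psi> s) * cnj (q s))"
  proof -
    have "integrable \<rho> (\<lambda>s. cnj (q s) * cnj 1)" using q by (intro integrable_inner2 L2_cnj one_rho)
    then show ?thesis
    proof (rule Bochner_Integration.integrable_bound)
      show "AE s in \<rho>. norm (cnj (\<Psi> s) * cnj (q s)) \<le> norm (cnj (q s) * cnj 1)"
        using uni by (rule AE_mp) (auto simp: norm_mult)
    qed (use q_meas in measurable)
  qed
  then have cw: "sp.cal (\<lambda>s. cnj (\<Psi> s) * cnj (q s)) u w"
    unfolding rho_eq by (intro cal_R_H2 Rsp.fun_calc_compose[OF Rsp.fun_calc_cal[OF y] w])
  \<comment> \<open>At \<open>s = 0\<close> the convention for division makes the product
    \<open>0\<close>; that point has no mass by \<open>rho_0\<close>.\<close>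
  have one: "AE s in \<rho>. complex_of_real s * (cnj (\<Psi> s) * cnj (q s)) = 1"
    using mu_inv rho_0 by eventually_elim auto
  have "integrable \<rho> (\<lambda>s. complex_of_real s * (cnj (\<Psi> s) * cnj (q s)))"
  proof (subst integrable_cong_AE)
    show "AE s in \<rho>. complex_of_real s * (cnj (\<Psi> s) * cnj (q s)) = 1" by (rule one)
    show "integrable \<rho> (\<lambda>s. 1 :: complex)" using finite_rho by (simp add: finite_measure.integrable_const)
  qed (use q_meas in measurable)
  then have "sp.cal (\<lambda>s. complex_of_real s * (cnj (\<Psi> s) * cnj (q s))) u (A w)"
    unfolding rho_eq by (intro sp.fun_calc_compose[OF cw fun_calc_A[OF V(3)]])
  then have "eq_ae circ (A w) u"
    by (rule sp.cal_unique[OF _ sp.cal_one[OF u] one[unfolded rho_eq]])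
  with Hx have "eq_ae circ (H x) u" by (rule eq_ae_trans)
  moreover have "eq_ae circ u (H (\<lambda>z. 1))" by (rule eq_ae_sym[OF H_one])
  ultimately have "eq_ae circ (H x) (H (\<lambda>z. 1))" by (rule eq_ae_trans)
  then have "norm2 circ (\<lambda>z. H x z - H (\<lambda>z. 1) z) = 0"
    using eq_ae_iff_norm2_diff[OF H_L2[OF V(1)] H_L2[OF H2_one]] by simp
  then have k0: "norm2 circ (H (\<lambda>z. x z - 1)) = 0"
    using bounded_antilinear_on_diff[OF subspace2_H2 anti V(1) H2_one] by simp
  have kH: "(\<lambda>z. x z - 1) \<in> H2" by (intro subspace2_diff[OF subspace2_H2] V H2_one)
  have xU: "eq_ae circ (U q) x" by (rule Rsp.cal_unique[OF cal_U[OF q] Rsp.fun_calc_cal[OF x]]) simp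
  assume g: "g \<in> R"
  \<comment> \<open>\<open>x - 1\<close> is in the kernel of \<open>H\<close>, which is orthogonal
    to \<open>R\<close>.\<close>
  have "inner2 circ (\<lambda>z. x z - 1) g = 0" by (rule ker_perp_R[OF kH k0 g])
  then have "inner2 circ x g = inner2 circ (\<lambda>z. 1) g"
    using V g by (simp add: inner2_left H2_L2 R_L2)
  then have "inner2 circ g x = inner2 circ g (\<lambda>z. 1)" by (metis inner2_cnj)
  moreover have "inner2 circ g (U q) = inner2 circ g x"
    by (intro inner2_cong eq_ae_refl xU R_L2 g U_L2 q H2_L2 V)
  ultimately show "inner2 circ g (U q) = inner2 circ g (\<lambda>z. 1)" by simp
qed

end

text \<open>The resolvent appears as some \<open>T\<close> with \<open>inverse_on\<close>. Two such
  inverses agree up to null sets, so the inner product with \<open>q\<close> does not depend on the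
  choice.\<close>

theorem theorem2p2:
  fixes u :: "complex \<Rightarrow> complex"
    and H A :: "(complex \<Rightarrow> complex) \<Rightarrow> (complex \<Rightarrow> complex)"
    and E :: "real set \<Rightarrow> (complex \<Rightarrow> complex) \<Rightarrow> (complex \<Rightarrow> complex)"
    and \<rho> :: "real measure"
    and \<Psi> :: "real \<Rightarrow> complex"
    and R :: "(complex \<Rightarrow> complex) set"
    and U :: "(real \<Rightarrow> complex) \<Rightarrow> (complex \<Rightarrow> complex)"
    and Sig :: "(real \<Rightarrow> complex) \<Rightarrow> (real \<Rightarrow> complex)"
    and q :: "real \<Rightarrow> complex"
  assumes u: "u \<in> BMOA_simp"
    and H: "is_hankel u H"
    and A: "is_modulus H A"
    and E: "spectral_resolution circ H2 A E"
    and rho: "is_spectral_measure E u \<rho>"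
    and R: "R = closure_range circ H2 H"
    and Psi: "is_Psi R E H A u \<rho> \<Psi>"
    and U: "is_spectral_map R E u \<rho> U"
    and Sig: "Sig = adjoint2 \<rho> (L2 \<rho>) circ R U \<circ> shift_star \<circ> U"
    and q: "q = (\<lambda>s. cnj (\<Psi> s) / complex_of_real s)"
  shows "contraction_on \<rho> (L2 \<rho>) Sig \<and>
    q \<in> L2 \<rho> \<and>
    (\<forall>k. fourier u (int k) = inner2 \<rho> ((Sig ^^ k) (\<lambda>s. 1)) q) \<and>
    (\<forall>z. cmod z < 1 \<longrightarrow>
       (\<exists>T. inverse_on \<rho> (L2 \<rho>) (\<lambda>f s. f s - z * Sig f s) T \<and>
            disc_ext u z = inner2 \<rho> (T (\<lambda>s. 1)) q))"
proof -
  have uH2: "u \<in> H2" using u by (simp add: BMOA_simp_def BMOA_def)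
  interpret S: hankel_simple u H A E \<rho> U
    using uH2 H A E rho U u R by unfold_locales simp_all
  have Sig': "Sig = S.Sig" by (simp add: Sig R)
  have Psi': "is_Psi S.R E H A u \<rho> \<Psi>" using Psi by (simp add: R)
  note qL = S.Psi_projection(1)[OF Psi' q]
  have contr: "contraction_on \<rho> (L2 \<rho>) Sig" unfolding Sig' by (rule S.Sig_contraction)
  have coeff: "fourier u (int k) = inner2 \<rho> ((Sig ^^ k) (\<lambda>s. 1)) q" for k
  proof -
    define f where "f = (Sig ^^ k) (\<lambda>s. 1)"
    have f: "f \<in> L2 \<rho>" "eq_ae circ (U f) ((shift_star ^^ k) u)"
      using S.Sig_power[of k] by (simp_all add: f_def Sig')
    have k: "(shift_star ^^ k) u \<in> H2" "inner2 circ ((shift_star ^^ k) u) (\<lambda>z. z ^ 0) = fourier u (int k)"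
      using fourier_shift_star[OF uH2, of k] by (auto simp del: power_0)
    have "fourier u (int k) = inner2 circ (U f) (\<lambda>z. 1)"
      unfolding k(2)[symmetric] power_0
      by (intro inner2_cong eq_ae_sym[OF f(2)] eq_ae_refl H2_L2 k S.U_H2 f H2_one)
    \<comment> \<open>The constant \<open>1\<close> need not belong to \<open>R\<close>; against a
      vector of \<open>R\<close> it can be replaced by its projection \<open>U q\<close>, and
      \<open>U\<close> then carries the inner product to \<open>L2 \<rho>\<close>.\<close>
    also have "\<dots> = inner2 circ (U f) (U q)"
      by (rule S.Psi_projection(2)[OF Psi' q, symmetric]) (rule S.U_in[OF f(1)])
    also have "\<dots> = inner2 \<rho> f q" by (intro S.U_inner f qL)
    finally show ?thesis by (simp add: f_def)
  qed
  have "\<exists>T. inverse_on \<rho> (L2 \<rho>) (\<lambda>f s. f s - z * Sig f s) T \<and> disc_ext u z = inner2 \<rho> (T (\<lambda>s. 1)) q"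
    if z: "cmod z < 1" for z
  proof -
    obtain T where T: "inverse_on \<rho> (L2 \<rho>) (\<lambda>f s. f s - z * Sig f s) T"
      "\<And>f q. f \<in> L2 \<rho> \<Longrightarrow> q \<in> L2 \<rho> \<Longrightarrow> (\<lambda>j. z ^ j * inner2 \<rho> ((Sig ^^ j) f) q) sums inner2 \<rho> (T f) q"
      by (rule neumann_series[OF contr z], rule that)
    \<comment> \<open>The coefficient formula turns the Neumann series paired with \<open>q\<close>
      into the power series of \<open>u\<close>, and supplies its convergence as well.\<close>
    have "(\<lambda>j. fourier u (int j) * z ^ j) sums inner2 \<rho> (T (\<lambda>s. 1)) q"
      using T(2)[OF S.one_rho qL] by (simp add: coeff mult.commute)
    then have "disc_ext u z = inner2 \<rho> (T (\<lambda>s. 1)) q"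
      unfolding disc_ext_def by (rule sums_unique[symmetric])
    with T(1) show ?thesis by blast
  qed
  with contr qL coeff show ?thesis by blast
qed

end
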